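(* Let $\mathcal{G}$ be a class of generators of the hyperbolic quadric $\mathcal{P}=\mathcal{Q}^{+}(2d-1,q)$, $d$ even, and let $\mathcal{L}\subseteq\mathcal{G}$ with characteristic vector $\boldsymbol{\chi}\in\mathbb{R}^{\mathcal{G}}$. Let $A'$ be the incidence matrix of points of $\mathcal{P}$ versus generators in $\mathcal{G}$, let $K$ be the disjointness matrix of $\mathcal{G}$, and let $V'_0\perp\dots\perp V'_{d/2}$ be the eigenspace decomposition of $\mathbb{R}^{\mathcal{G}}$ described in the context. Put $x=|\mathcal{L}|/\prod_{i=1}^{d-2}(q^i+1)$. The following are equivalent: (i) for every $\pi\in\mathcal{G}$, the number of elements of $\mathcal{L}$ disjoint from $\pi$ equals $(x-(\boldsymbol{\chi})_\pi)q^{\binom{d-1}{2}}$; (ii) $\boldsymbol{\chi}-\frac{x}{q^{d-1}+1}\boldsymbol{j}$ lies in the eigenspace of $K$ for eigenvalue $-q^{\binom{d-1}{2}}$; (iii) $\boldsymbol{\chi}\in V'_0\perp V'_1$; (iv) $\boldsymbol{\chi}\in\mathrm{im}(A'^t)$; (v) $\boldsymbol{\chi}\in(\ker A')^{\perp}$. If $\mathcal{P}$ admits a spread, the following are also equivalent to them: (vi) $|\mathcal{L}\cap\mathcal{S}|=x$ for every spread $\mathcal{S}$ of $\mathcal{P}$ whose elements are in $\mathcal{G}$; (vii) $|\mathcal{L}\cap\mathcal{S}|=x$ for every spread $\mathcal{S}\in\mathcal{C}$ of $\mathcal{P}$ whose elements are in $\mathcal{G}$, where $\mathcal{C}$ is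 a class of spreads which is a union of some orbits under the action of an automorphism group acting transitively on the ordered pairs of disjoint generators of $\mathcal{G}$.
   Context: $\mathcal{Q}^{+}(2d-1,q)$ is the hyperbolic quadric in $\mathrm{PG}(2d-1,q)$, a polar space of rank $d$ whose generators are its $(d-1)$-dimensional subspaces. They form two classes: two generators lie in the same class iff their intersection has projective dimension $\equiv d-1\pmod 2$; for $d$ even, disjoint generators lie in the same class. A spread is a set of generators such that every point lies in exactly one of them. Let $\Omega$ be the set of all generators; the dual polar graph (generators adjacent iff they meet in a $(d-2)$-space) gives an orthogonal eigenspace decomposition $\mathbb{R}^{\Omega}=V_0\perp\dots\perp V_d$ of its distance-regular association scheme, with $V_0=\langle\boldsymbol{j}\rangle$, ordered so that $\mathrm{im}(C_k^t)=V_0\perp\dots\perp V_k$ for $k=1,\dots,d$, $C_k$ the incidence matrix of $(k-1)$-spaces versus generators. Identifying $\mathbb{R}^{\mathcal{G}}$ with the vectors of $\mathbb{R}^{\Omega}$ supported on $\mathcal{G}$, set $V'_j=(V_j\perp V_{d-j})\cap\mathbb{R}^{\mathcal{G}}$ for $j=0,\dots,d/2$ (with $V_j\perp V_{d-j}$ read as $V_{d/2}$ when $j=d/2$); these are the eigenspaces of the association scheme on $\mathcal{G}$ given by the relations "meeting in a $(d-2i-1)$-space", $i=0,\dots,d/2$. $K$ is the $\mathcal{G}\times\mathcal{G}$ 0/1 matrix with entry 1 iff the generators are disjoint; $\boldsymbol{j}$ is the all-one vector. *)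

theory Defs
  imports "HOL-Analysis.Analysis" "HOL-Algebra.Group_Action"
begin

section \<open>The hyperbolic quadric\<close>

text \<open>With \<^term>\<open>d = CARD('m)\<close> and \<^term>\<open>q = CARD('a)\<close>, the type below is the vector space of dimension
  \<open>2d\<close> over the field with \<open>q\<close> elements. Projective subspaces are represented by linear subspaces,
  so a projective \<open>(k - 1)\<close>-space is a linear subspace of dimension \<open>k\<close>, and projectively
  disjoint means meeting in \<open>{0}\<close>.\<close>

type_synonym ('a, 'm) space = "'a ^ ('m + 'm)"

definition hyperbolic_form :: "('a::{field,finite}, 'm::finite) space \<Rightarrow> 'a" where
  "hyperbolic_form v = (\<Sum>i\<in>UNIV. v $ Inl i * v $ Inr i)"

definition singular_subspaces :: "('a::{field,finite}, 'm::finite) space set set" where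
  "singular_subspaces = {U. vec.subspace U \<and> (\<forall>u\<in>U. hyperbolic_form u = 0)}"

definition singular_subspaces_dim :: "nat \<Rightarrow> ('a::{field,finite}, 'm::finite) space set set" where
  "singular_subspaces_dim k = {U \<in> singular_subspaces. vec.dim U = k}"

abbreviation points :: "('a::{field,finite}, 'm::finite) space set set" where
  "points \<equiv> singular_subspaces_dim 1"

definition generators :: "('a::{field,finite}, 'm::finite) space set set" where
  "generators = singular_subspaces_dim CARD('m)"

text \<open>Projective dimension congruent to \<open>d - 1\<close> modulo 2 is linear dimension congruent to \<open>d\<close>.\<close>

definition same_class :: "(('a::{field,finite}, 'm::finite) space set \<times> ('a, 'm) space set) set" where
  "same_class = {(\<pi>, \<sigma>). \<pi> \<in> generators \<and> \<sigma> \<in> generators \<and>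
                   vec.dim (\<pi> \<inter> \<sigma>) mod 2 = CARD('m) mod 2}"

definition generator_classes :: "('a::{field,finite}, 'm::finite) space set set set" where
  "generator_classes = generators // same_class"

definition spreads :: "('a::{field,finite}, 'm::finite) space set set set" where
  "spreads = {S. S \<subseteq> generators \<and> (\<forall>p\<in>points. \<exists>!\<pi>. \<pi> \<in> S \<and> p \<subseteq> \<pi>)}"


section \<open>Vectors and matrices indexed by generators\<close>

text \<open>Real vectors are indexed by all sets of vectors of the underlying space, a finite type; for
  a set \<open>X\<close> of generators, the vector space of real functions on \<open>X\<close> is identified with the
  vectors supported on \<open>X\<close>. Matrices are padded with zeros accordingly.\<close>

type_synonym ('a, 'm) rvec = "real ^ (('a, 'm) space set)"
type_synonym ('a, 'm) rmat = "real ^ (('a, 'm) space set) ^ (('a, 'm) space set)"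

definition supported :: "'i::finite set \<Rightarrow> (real ^ 'i) set" where
  "supported X = {v. \<forall>i. i \<notin> X \<longrightarrow> v $ i = 0}"

definition char_vec :: "'i::finite set \<Rightarrow> real ^ 'i" where
  "char_vec X = (\<chi> i. if i \<in> X then 1 else 0)"

definition rel_matrix :: "'i::finite set \<Rightarrow> 'j::finite set \<Rightarrow> ('i \<Rightarrow> 'j \<Rightarrow> bool) \<Rightarrow> real ^ 'j ^ 'i" where
  "rel_matrix X Y R = (\<chi> i j. if i \<in> X \<and> j \<in> Y \<and> R i j then 1 else 0)"

definition eigenspace :: "'i::finite set \<Rightarrow> real ^ 'i ^ 'i \<Rightarrow> real \<Rightarrow> (real ^ 'i) set" where
  "eigenspace X M \<theta> = {v \<in> supported X. M *v v = \<theta> *\<^sub>R v}"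

definition im_transpose :: "real ^ 'j::finite ^ 'i::finite \<Rightarrow> (real ^ 'j) set" where
  "im_transpose M = range (\<lambda>y. transpose M *v y)"

definition kernel_on :: "'j::finite set \<Rightarrow> real ^ 'j ^ 'i::finite \<Rightarrow> (real ^ 'j) set" where
  "kernel_on Y M = {v \<in> supported Y. M *v v = 0}"

definition incidence_matrix :: "nat \<Rightarrow> ('a::{field,finite}, 'm::finite) rmat" where
  "incidence_matrix k = rel_matrix (singular_subspaces_dim k) generators (\<subseteq>)"

definition point_matrix :: "('a::{field,finite}, 'm::finite) space set set \<Rightarrow> ('a, 'm) rmat" where
  "point_matrix G = rel_matrix points G (\<subseteq>)"

definition disjointness_matrix :: "('a::{field,finite}, 'm::finite) space set set \<Rightarrow> ('a, 'm) rmat" where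
  "disjointness_matrix G = rel_matrix G G (\<lambda>\<pi> \<sigma>. \<pi> \<inter> \<sigma> = {0})"


section \<open>The eigenspace decompositions\<close>

definition dual_polar_matrix :: "('a::{field,finite}, 'm::finite) rmat" where
  "dual_polar_matrix =
     rel_matrix generators generators (\<lambda>\<pi> \<sigma>. vec.dim (\<pi> \<inter> \<sigma>) = CARD('m) - 1)"

text \<open>The dual polar graph is distance-regular, so the eigenspaces of its association scheme are
  those of its adjacency matrix.\<close>

definition is_dual_polar_decomposition ::
    "(nat \<Rightarrow> ('a::{field,finite}, 'm::finite) rvec set) \<Rightarrow> bool" where
  "is_dual_polar_decomposition V \<longleftrightarrow>
     (\<forall>j\<le>CARD('m). \<exists>\<theta>. V j = eigenspace generators dual_polar_matrix \<theta> \<and> V j \<noteq> {0}) \<and>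
     (\<forall>i\<le>CARD('m). \<forall>j\<le>CARD('m). i \<noteq> j \<longrightarrow> (\<forall>u\<in>V i. \<forall>v\<in>V j. orthogonal u v)) \<and>
     span (\<Union>j\<le>CARD('m). V j) = supported generators \<and>
     V 0 = span {char_vec generators} \<and>
     (\<forall>k\<in>{1..CARD('m)}. im_transpose (incidence_matrix k :: ('a, 'm) rmat) = span (\<Union>j\<le>k. V j))"

text \<open>The condition determines \<open>V j\<close> uniquely for \<open>j \<le> d\<close>: it is the orthogonal complement of the
  image for \<open>j - 1\<close> inside the image for \<open>j\<close>. Only these indices are used.\<close>

definition dual_polar_V :: "nat \<Rightarrow> ('a::{field,finite}, 'm::finite) rvec set" where
  "dual_polar_V = (SOME V. is_dual_polar_decomposition V)"

text \<open>For \<open>j = d/2\<close> the span below is just \<^term>\<open>dual_polar_V (CARD('m) div 2)\<close>, as required.\<close>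

definition half_V :: "('a::{field,finite}, 'm::finite) space set set \<Rightarrow> nat \<Rightarrow> ('a, 'm) rvec set" where
  "half_V G j = span (dual_polar_V j \<union> dual_polar_V (CARD('m) - j)) \<inter> supported G"


section \<open>Automorphism groups and classes of spreads\<close>

text \<open>An automorphism of the polar space is an inclusion-preserving and -reflecting permutation of
  its singular subspaces (it then preserves dimension). Elements of \<^term>\<open>Bij X\<close> are extensional
  on \<open>X\<close>.\<close>

definition polar_automorphisms ::
    "(('a::{field,finite}, 'm::finite) space set \<Rightarrow> ('a, 'm) space set) set" where
  "polar_automorphisms = {g \<in> Bij singular_subspaces.
     \<forall>U\<in>singular_subspaces. \<forall>W\<in>singular_subspaces. g U \<subseteq> g W \<longleftrightarrow> U \<subseteq> W}"

definition automorphism_group ::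
    "(('a::{field,finite}, 'm::finite) space set \<Rightarrow> ('a, 'm) space set) set \<Rightarrow> bool" where
  "automorphism_group H \<longleftrightarrow> subgroup H (BijGroup singular_subspaces) \<and> H \<subseteq> polar_automorphisms"

definition transitive_on_disjoint_pairs ::
    "(('a::{field,finite}, 'm::finite) space set \<Rightarrow> ('a, 'm) space set) set \<Rightarrow>
     ('a, 'm) space set set \<Rightarrow> bool" where
  "transitive_on_disjoint_pairs H G \<longleftrightarrow>
     (\<forall>\<pi>\<in>G. \<forall>\<sigma>\<in>G. \<forall>\<pi>'\<in>G. \<forall>\<sigma>'\<in>G. \<pi> \<inter> \<sigma> = {0} \<and> \<pi>' \<inter> \<sigma>' = {0} \<longrightarrow>
        (\<exists>g\<in>H. g \<pi> = \<pi>' \<and> g \<sigma> = \<sigma>'))"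

definition union_of_spread_orbits ::
    "(('a::{field,finite}, 'm::finite) space set \<Rightarrow> ('a, 'm) space set) set \<Rightarrow>
     ('a, 'm) space set set set \<Rightarrow> bool" where
  "union_of_spread_orbits H C \<longleftrightarrow>
     (\<exists>\<O> \<subseteq> orbits ((BijGroup singular_subspaces)\<lparr>carrier := H\<rparr>) spreads (\<lambda>g S. g ` S). C = \<Union>\<O>)"

text \<open>The class of spreads is required to contain a spread with all elements in \<open>G\<close>; otherwise
  conditions on its spreads inside \<open>G\<close> would hold vacuously.\<close>

definition admissible_spread_class ::
    "('a::{field,finite}, 'm::finite) space set set \<Rightarrow> ('a, 'm) space set set set \<Rightarrow> bool" where
  "admissible_spread_class G C \<longleftrightarrow>
     (\<exists>H. automorphism_group H \<and> transitive_on_disjoint_pairs H G \<and> union_of_spread_orbits H C) \<and>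
     (\<exists>S\<in>C. S \<subseteq> G)"

end

(* The flag of the images of the transposed incidence matrices of k-spaces versus generators is preserved by
   the dual polar adjacency matrix A and by the disjointness matrix K, and each acts as a scalar on every
   quotient: counting generators and Moebius inversion over the subspaces of U give [d-k] - [k] for A and
   (-1)^k q^(C(d-k,2) + C(k,2)) for K. Hence the layers (orthogonal differences of the flag) are the
   eigenspaces of both. For d even, the K-eigenvalue -q^C(d-1,2) occurs only for k = 1 and k = d - 1, and these
   two layers are exchanged by the sign change on one class of generators, so on that class the eigenspace is
   the restriction of the first layer; this gives the equivalence of (i)-(v).
   A point pencil meets a spread once, which gives (vi) and (vii); conversely, the number of spreads of a class
   through two disjoint generators is constant, and double counting gives (i). For (vi), the isometry group is
   transitive on the ordered pairs of disjoint generators, since opposite generators have dual bases. *)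

theory Submission
  imports Defs "HOL-Computational_Algebra.Polynomial"
begin

section \<open>Subspaces over a finite field\<close>

text \<open>Everything rests on one feature of the hyperbolic form: a singular subspace of dimension
  d - 1 lies in exactly two generators. It drives the counts of generators and makes the dual polar
  graph bipartite, which is the source of the sign change exchanging the layers k and d - k. A
  scalar action on the quotients of the flag is only triangularity; it becomes an eigenvalue on the
  layers because the matrices are symmetric. For d even, K takes the same value on the layers k and
  d - k, so it is A, with d + 1 distinct values, that singles out the layers. The decomposition in
  the statement is fixed by a choice operator, so its existence and uniqueness have to be proved;
  the delicate clause of existence is that no layer vanishes. As to the constants, the product in
  the definition of x is the number of generators of the class through a point, and q^(d-1) + 1 is
  the size of a spread. Hence x/(q^(d-1) + 1) is the density |L|/|G|, and the vector in (ii) is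
  orthogonal to j.\<close>

definition qint :: "nat \<Rightarrow> nat \<Rightarrow> nat" where
  "qint q n = (\<Sum>i<n. q ^ i)"

lemma qint_0 [simp]: "qint q 0 = 0" by (simp add: qint_def)

lemma qint_Suc: "qint q (Suc n) = q ^ n + qint q n" by (simp add: qint_def)

text \<open>\<open>qint q n\<close> is the Gaussian number (q^n - 1)/(q - 1), the number of
  one-dimensional subspaces in dimension n; the identity avoids the division.\<close>

lemma qint_power:
  assumes "q \<ge> 1"
  shows "q ^ n = 1 + (q - 1) * qint q n"
proof -
  obtain r where "q = Suc r" using assms by (cases q) auto
  then show ?thesis by (induction n) (auto simp: qint_Suc algebra_simps)
qed

lemma qint_strict_mono: "q \<ge> 1 \<Longrightarrow> m < n \<Longrightarrow> qint q m < qint q n"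
  unfolding qint_def by (rule sum_strict_mono2[where b = m]) auto

lemma two_le_card_field: "2 \<le> CARD('a::{field,finite})"
proof -
  have "card {0, 1::'a} \<le> CARD('a)" by (rule card_mono) auto
  then show ?thesis by simp
qed

lemma card_independent_span:
  fixes B :: "('a::{field,finite}^'n::finite) set"
  assumes "vec.independent B"
  shows "card (vec.span B) = CARD('a) ^ card B"
proof -
  have "finite B" by simp
  then show ?thesis using assms
  proof (induction B rule: finite_induct)
    case empty
    then show ?case by simp
  next
    case (insert b B)
    have b: "b \<notin> vec.span B" and B: "vec.independent B"
      using insert.prems insert.hyps by (auto simp: vec.independent_insert)
    let ?f = "\<lambda>(c, v). c *s b + v"
    have "inj_on ?f (UNIV \<times> vec.span B)"
    proof (rule inj_onI, clarsimp)
      fix c v c' v'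
      assume v: "v \<in> vec.span B" "v' \<in> vec.span B" and eq: "c *s b + v = c' *s b + v'"
      have diff: "(c - c') *s b = v' - v" using eq by (simp add: algebra_simps)
      have "c = c'"
      proof (rule ccontr)
        assume "c \<noteq> c'"
        have "(c - c') *s b \<in> vec.span B" unfolding diff using v by (rule vec.span_diff[rotated])
        then have "inverse (c - c') *s ((c - c') *s b) \<in> vec.span B" by (rule vec.span_scale)
        moreover have "inverse (c - c') *s ((c - c') *s b) = b"
          using \<open>c \<noteq> c'\<close> by (simp only: vec.scale_scale) simp
        ultimately show False using b by simp
      qed
      with eq show "c = c' \<and> v = v'" by simp
    qed
    moreover have "?f ` (UNIV \<times> vec.span B) = vec.span (insert b B)"
    proof (rule Set.set_eqI)
      fix x
      show "x \<in> ?f ` (UNIV \<times> vec.span B) \<longleftrightarrow> x \<in> vec.span (insert b B)"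
      proof
        assume "x \<in> ?f ` (UNIV \<times> vec.span B)"
        then obtain c v where "v \<in> vec.span B" "x = c *s b + v" by auto
        then show "x \<in> vec.span (insert b B)"
          by (auto simp: vec.span_insert intro!: exI[of _ c])
      next
        assume "x \<in> vec.span (insert b B)"
        then obtain c where "x - c *s b \<in> vec.span B" by (auto simp: vec.span_insert)
        then show "x \<in> ?f ` (UNIV \<times> vec.span B)"
          by (intro image_eqI[of _ _ "(c, x - c *s b)"]) auto
      qed
    qed
    ultimately have "card (vec.span (insert b B)) = card (UNIV \<times> vec.span B :: ('a \<times> _) set)"
      by (metis card_image)
    then show ?case using insert B by (simp add: card_cartesian_product)
  qed
qed

lemma card_subspace:
  fixes U :: "('a::{field,finite}^'n::finite) set"
  assumes "vec.subspace U"
  shows "card U = CARD('a) ^ vec.dim U"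
proof -
  obtain B where B: "B \<subseteq> U" "vec.independent B" "U \<subseteq> vec.span B" "card B = vec.dim U"
    using vec.basis_exists[of U] by metis
  then have "vec.span B = U" using assms by (metis vec.span_mono vec.span_eq_iff subset_antisym)
  then show ?thesis using card_independent_span[OF B(2)] B(4) by simp
qed

text \<open>The dimension of a set is that of its span, so the union can stand for the sum of the
  two subspaces.\<close>

lemma dim_Un_Int:
  fixes S T :: "('a::field^'n::finite) set"
  assumes "vec.subspace S" "vec.subspace T"
  shows "vec.dim (S \<union> T) + vec.dim (S \<inter> T) = vec.dim S + vec.dim T"
proof -
  have "vec.span (S \<union> T) = {x + y |x y. x \<in> S \<and> y \<in> T}"
    using assms by (subst vec.span_Un) (metis vec.span_eq_iff)
  then show ?thesis using vec.dim_sums_Int[OF assms] vec.dim_span[of "S \<union> T"] by simp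
qed

lemma subspace_eqI_dim:
  fixes S T :: "('a::field^'n::finite) set"
  assumes "vec.subspace S" "vec.subspace T" "S \<subseteq> T" "vec.dim T \<le> vec.dim S"
  shows "S = T"
  using assms vec.subspace_dim_equal by blast

lemma dim_psubset_subspace:
  fixes S T :: "('a::field^'n::finite) set"
  assumes "vec.subspace S" "vec.subspace T" "S \<subset> T"
  shows "vec.dim S < vec.dim T"
  using assms by (metis vec.dim_psubset vec.span_eq_iff)

lemma dim_insert_subspace:
  fixes S :: "('a::field^'n::finite) set"
  assumes "vec.subspace S"
  shows "vec.dim (insert x S) = (if x \<in> S then vec.dim S else vec.dim S + 1)"
  using vec.dim_insert[of x S] assms by (metis Suc_eq_plus1 vec.span_eq_iff)

lemma span_insert_eq_cover:
  fixes S T :: "('a::field^'n::finite) set"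
  assumes "vec.subspace S" "vec.subspace T" "S \<subseteq> T" "vec.dim T = vec.dim S + 1" "x \<in> T" "x \<notin> S"
  shows "vec.span (insert x S) = T"
proof (rule subspace_eqI_dim)
  show "vec.span (insert x S) \<subseteq> T" using assms by (intro vec.span_minimal) auto
  show "vec.dim T \<le> vec.dim (vec.span (insert x S))"
    using dim_insert_subspace[OF assms(1), of x] assms by simp
qed (use assms in auto)

lemma ex_hyperplane_between:
  fixes S T :: "('a::field^'n::finite) set"
  assumes "vec.subspace S" "vec.subspace T" "S \<subset> T"
  obtains H where "vec.subspace H" "S \<subseteq> H" "H \<subseteq> T" "vec.dim T = vec.dim H + 1"
proof -
  have "\<exists>H. vec.subspace H \<and> S \<subseteq> H \<and> H \<subseteq> T \<and> vec.dim T = vec.dim H + 1"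
    using assms
  proof (induction "vec.dim T - vec.dim S" arbitrary: S rule: less_induct)
    case less
    then obtain x where x: "x \<in> T" "x \<notin> S" by auto
    let ?S = "vec.span (insert x S)"
    have d: "vec.dim ?S = vec.dim S + 1" using dim_insert_subspace[OF less.prems(1)] x by simp
    have sub: "?S \<subseteq> T" using less.prems x by (intro vec.span_minimal) auto
    have SS: "S \<subseteq> ?S" using vec.span_superset by blast
    show ?case
    proof (cases "?S = T")
      case True
      then show ?thesis using d less.prems by blast
    next
      case False
      then have "?S \<subset> T" using sub by blast
      moreover have "vec.dim ?S < vec.dim T"
        by (rule dim_psubset_subspace[OF _ less.prems(2) \<open>?S \<subset> T\<close>]) simp
      ultimately have "\<exists>H. vec.subspace H \<and> ?S \<subseteq> H \<and> H \<subseteq> T \<and> vec.dim T = vec.dim H + 1"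
        using d less.prems by (intro less.hyps) auto
      then show ?thesis using SS by blast
    qed
  qed
  then show ?thesis using that by blast
qed

text \<open>The covers T of P inside W correspond to the points of W/P: the sets T - P partition W -
  P, and each has q^p (q - 1) elements, where p = dim P.\<close>

lemma card_covers_between:
  fixes P W :: "('a::{field,finite}^'n::finite) set"
  assumes "vec.subspace P" "vec.subspace W" "P \<subseteq> W"
  shows "card {T. vec.subspace T \<and> P \<subseteq> T \<and> T \<subseteq> W \<and> vec.dim T = vec.dim P + 1}
           = qint CARD('a) (vec.dim W - vec.dim P)" (is "card ?C = _")
proof -
  let ?q = "CARD('a)"
  define p where "p = vec.dim P"
  define n where "n = vec.dim W - vec.dim P"
  have w: "vec.dim W = p + n" using vec.dim_subset[OF assms(3)] by (simp add: p_def n_def)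
  have cT: "card (T - P) = ?q ^ p * (?q - 1)" if "T \<in> ?C" for T
  proof -
    have "card (T - P) = card T - card P" using that by (intro card_Diff_subset) auto
    also have "\<dots> = ?q ^ (p + 1) - ?q ^ p" using that card_subspace[of T] card_subspace[OF assms(1)]
      by (simp add: p_def)
    finally show ?thesis by (simp add: algebra_simps diff_mult_distrib2)
  qed
  have disj: "(T - P) \<inter> (T' - P) = {}" if "T \<in> ?C" "T' \<in> ?C" "T \<noteq> T'" for T T'
  proof (rule ccontr)
    assume "(T - P) \<inter> (T' - P) \<noteq> {}"
    then obtain x where "x \<in> T" "x \<in> T'" "x \<notin> P" by auto
    then have "vec.span (insert x P) = T" "vec.span (insert x P) = T'"
      using that span_insert_eq_cover[OF assms(1)] by blast+
    then show False using that by simp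
  qed
  have cover: "W - P = (\<Union>T\<in>?C. T - P)"
  proof (intro equalityI subsetI)
    fix x assume x: "x \<in> W - P"
    have "vec.span (insert x P) \<subseteq> W" using x assms by (intro vec.span_minimal) auto
    moreover have "P \<subseteq> vec.span (insert x P)" "x \<in> vec.span (insert x P)"
      by (auto intro: vec.span_base)
    moreover have "vec.dim (vec.span (insert x P)) = vec.dim P + 1"
      using x dim_insert_subspace[OF assms(1), of x] by simp
    ultimately have "vec.span (insert x P) \<in> ?C" by auto
    then show "x \<in> (\<Union>T\<in>?C. T - P)" using x \<open>x \<in> vec.span (insert x P)\<close> by blast
  qed auto
  have "card (W - P) = (\<Sum>T\<in>?C. card (T - P))"
    unfolding cover by (rule card_UN_disjoint) (use disj in auto)
  also have "\<dots> = card ?C * (?q ^ p * (?q - 1))" using cT by simp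
  finally have 1: "card (W - P) = card ?C * (?q ^ p * (?q - 1))" .
  have "card (W - P) = card W - card P" using assms by (intro card_Diff_subset) auto
  also have "\<dots> = ?q ^ p * (?q ^ n - 1)"
    using card_subspace[OF assms(1)] card_subspace[OF assms(2)] w
    by (simp add: p_def power_add diff_mult_distrib2)
  also have "\<dots> = qint ?q n * (?q ^ p * (?q - 1))"
    using qint_power[of ?q n] two_le_card_field[where 'a = 'a] by (simp add: mult_ac)
  finally have "card ?C * (?q ^ p * (?q - 1)) = qint ?q n * (?q ^ p * (?q - 1))" using 1 by simp
  then show ?thesis using two_le_card_field[where 'a = 'a] by (simp add: n_def)
qed

section \<open>The polar form\<close>

text \<open>The bilinear form Q(u + v) - Q(u) - Q(v) in coordinates. No division by 2 occurs, so all
  characteristics are covered; in characteristic 2 every vector is orthogonal to itself, and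
  singularity has to be tracked through the quadratic form.\<close>

definition polar :: "('a::{field,finite}, 'm::finite) space \<Rightarrow> ('a, 'm) space \<Rightarrow> 'a" where
  "polar u v = (\<Sum>i\<in>UNIV. u $ Inl i * v $ Inr i + u $ Inr i * v $ Inl i)"

lemma hyperbolic_form_add: "hyperbolic_form (u + v) = hyperbolic_form u + hyperbolic_form v + polar u v"
  by (simp add: hyperbolic_form_def polar_def sum.distrib[symmetric] algebra_simps)

lemma hyperbolic_form_scale: "hyperbolic_form (c *s v) = c * c * hyperbolic_form v"
  by (simp add: hyperbolic_form_def sum_distrib_left mult_ac)

lemma polar_commute: "polar u v = polar v u"
  by (simp add: polar_def mult.commute add.commute)

lemma polar_add_right: "polar u (v + w) = polar u v + polar u w"
  by (simp add: polar_def sum.distrib[symmetric] algebra_simps)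

lemma polar_scale_right: "polar u (c *s v) = c * polar u v"
  by (simp add: polar_def sum_distrib_left algebra_simps)

lemma polar_scale_left: "polar (c *s u) v = c * polar u v"
  by (simp add: polar_def sum_distrib_left algebra_simps)

lemma polar_zero [simp]: "polar u 0 = 0" "polar 0 u = 0"
  by (simp_all add: polar_def)

lemma polar_diff_right: "polar u (v - w) = polar u v - polar u w"
  by (simp add: polar_def sum_subtractf[symmetric] algebra_simps)

lemma polar_nondegenerate:
  assumes "\<And>v. polar u v = 0"
  shows "u = 0"
proof -
  have "u $ Inl i = 0" for i
    using assms[of "axis (Inr i) 1"]
    by (simp add: polar_def axis_def if_distrib[of "\<lambda>x. _ * x"] sum.distrib cong: if_cong)
  moreover have "u $ Inr i = 0" for i
    using assms[of "axis (Inl i) 1"]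
    by (simp add: polar_def axis_def if_distrib[of "\<lambda>x. _ * x"] sum.distrib cong: if_cong)
  ultimately have "u $ j = 0" for j by (cases j) auto
  then show ?thesis by (simp add: vec_eq_iff)
qed

definition perp :: "('a::{field,finite}, 'm::finite) space set \<Rightarrow> ('a, 'm) space set" where
  "perp U = {v. \<forall>u\<in>U. polar u v = 0}"

lemma subspace_perp [simp]: "vec.subspace (perp U)"
  by (auto simp: perp_def vec.subspace_def polar_add_right polar_scale_right)

lemma perp_antimono: "U \<subseteq> W \<Longrightarrow> perp W \<subseteq> perp U"
  by (auto simp: perp_def)

lemma subset_perp_perp: "U \<subseteq> perp (perp U)"
  by (auto simp: perp_def polar_commute)

lemma subset_perp_commute: "U \<subseteq> perp W \<longleftrightarrow> W \<subseteq> perp U"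
  by (metis perp_antimono subset_perp_perp subset_trans)

lemma perp_span [simp]: "perp (vec.span U) = perp U"
proof
  show "perp (vec.span U) \<subseteq> perp U" by (rule perp_antimono) (rule vec.span_superset)
  have "vec.span U \<subseteq> perp (perp U)" by (rule vec.span_minimal[OF subset_perp_perp]) simp
  then show "perp U \<subseteq> perp (vec.span U)" by (simp add: subset_perp_commute)
qed

lemma perp_Un: "perp (U \<union> W) = perp U \<inter> perp W"
  by (auto simp: perp_def)

lemma perp_UNIV: "perp UNIV = {0}"
  by (auto simp: perp_def polar_commute intro: polar_nondegenerate)

lemma dim_Int_kernel_ge:
  assumes "vec.subspace S"
  shows "vec.dim S \<le> vec.dim (S \<inter> {v. polar u v = 0}) + 1"
proof (cases "\<exists>s\<in>S. polar u s \<noteq> 0")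
  case True
  then obtain s where s: "s \<in> S" "polar u s \<noteq> 0" by auto
  let ?K = "S \<inter> {v. polar u v = 0}"
  have "S \<subseteq> vec.span (insert s ?K)"
  proof
    fix x assume x: "x \<in> S"
    let ?c = "polar u x / polar u s"
    have "x - ?c *s s \<in> S" using x s assms by (intro vec.subspace_diff vec.subspace_scale)
    moreover have "polar u (x - ?c *s s) = 0"
      using s by (simp add: polar_diff_right polar_scale_right)
    ultimately have "x - ?c *s s \<in> vec.span ?K" by (auto intro: vec.span_base)
    then show "x \<in> vec.span (insert s ?K)" by (auto simp: vec.span_insert)
  qed
  then have "vec.dim S \<le> vec.dim (insert s ?K)" by (metis vec.dim_mono)
  also have "\<dots> \<le> vec.dim ?K + 1" by (simp add: vec.dim_insert)
  finally show ?thesis .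
next
  case False
  then have "S \<inter> {v. polar u v = 0} = S" by auto
  then show ?thesis by simp
qed

lemma dim_Int_perp_ge_card:
  assumes "vec.subspace S" "finite B"
  shows "vec.dim S \<le> vec.dim (S \<inter> perp B) + card B"
  using assms(2)
proof (induction B rule: finite_induct)
  case empty
  then show ?case by (simp add: perp_def)
next
  case (insert b B)
  have "S \<inter> perp (insert b B) = (S \<inter> perp B) \<inter> {v. polar b v = 0}" by (auto simp: perp_def)
  moreover have "vec.subspace (S \<inter> perp B)" using assms by (intro vec.subspace_inter) auto
  ultimately show ?case using dim_Int_kernel_ge[of "S \<inter> perp B" b] insert by simp
qed

lemma dim_perp_ge:
  fixes U :: "('a::{field,finite}, 'm::finite) space set"
  shows "2 * CARD('m) \<le> vec.dim (perp U) + vec.dim U"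
proof -
  obtain B where B: "B \<subseteq> U" "vec.independent B" "U \<subseteq> vec.span B" "card B = vec.dim U"
    using vec.basis_exists[of U] by metis
  have "perp B = perp U"
    using B perp_antimono[OF B(1)] perp_antimono[OF B(3)] by simp
  then show ?thesis
    using dim_Int_perp_ge_card[of "UNIV :: ('a, 'm) space set" B] B(4) vec_dim_card[where 'a = 'a and 'n = "'m + 'm"]
    by simp
qed

text \<open>The lower bound \<open>dim_perp_ge\<close> is applied twice, to U and to a set
  completing a basis of U. By nondegeneracy the two orthogonal spaces meet in zero, so their
  dimensions add up to at most 2d, which makes both bounds sharp.\<close>

lemma dim_perp:
  fixes U :: "('a::{field,finite}, 'm::finite) space set"
  assumes "vec.subspace U"
  shows "vec.dim (perp U) + vec.dim U = 2 * CARD('m)"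
proof -
  obtain B where B: "B \<subseteq> U" "vec.independent B" "U \<subseteq> vec.span B" "card B = vec.dim U"
    using vec.basis_exists[of U] by metis
  let ?B' = "vec.extend_basis B - B"
  have ex: "B \<subseteq> vec.extend_basis B" "vec.independent (vec.extend_basis B)" "vec.span (vec.extend_basis B) = UNIV"
    using B(2) vec.extend_basis_superset vec.independent_extend_basis vec.span_extend_basis by auto
  have "card (vec.extend_basis B) = 2 * CARD('m)"
    using vec.dim_eq_card_independent[OF ex(2)] ex(3)
    by (metis vec.dim_span vec_dim_card card_sum mult_2 finite UNIV_Plus_UNIV card_Plus)
  then have c: "card ?B' + vec.dim U = 2 * CARD('m)"
    using B(4) ex(1) by (metis card_Diff_subset card_mono finite le_add_diff_inverse2)
  have "vec.dim ?B' = card ?B'"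
    using vec.independent_mono[OF ex(2), of ?B'] by (intro vec.dim_eq_card_independent) auto
  then have T: "2 * CARD('m) \<le> vec.dim (perp ?B') + card ?B'" using dim_perp_ge[of ?B'] by simp
  have "perp U \<inter> perp ?B' = {0}"
  proof -
    have "perp U \<inter> perp ?B' \<subseteq> perp (vec.extend_basis B)"
      using perp_antimono[OF B(1)] by (auto simp: perp_def)
    also have "\<dots> = {0}" using ex(3) perp_span perp_UNIV by metis
    finally show ?thesis using vec.subspace_0[OF subspace_perp] by blast
  qed
  then have "vec.dim (perp U) + vec.dim (perp ?B') \<le> 2 * CARD('m)"
    using dim_Un_Int[of "perp U" "perp ?B'"] dim_subset_UNIV_cart_gen[of "perp U \<union> perp ?B'"]
    by simp
  then show ?thesis using T c dim_perp_ge[of U] by linarith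
qed

lemma perp_perp:
  assumes "vec.subspace U"
  shows "perp (perp U) = U"
  using dim_perp[OF assms] dim_perp[of "perp U"] subset_perp_perp[of U] assms
  by (intro subspace_eqI_dim[symmetric]) auto

text \<open>Orthogonality reverses the lattice of all subspaces, so it turns the hyperplanes of X
  above W into the covers of \<open>perp X\<close> below \<open>perp W\<close>. The form serves only
  as a duality here; X and W are arbitrary subspaces.\<close>

lemma card_hyperplanes_above:
  fixes X W :: "('a::{field,finite}, 'm::finite) space set"
  assumes "vec.subspace X" "vec.subspace W" "W \<subseteq> X"
  shows "card {H. vec.subspace H \<and> W \<subseteq> H \<and> H \<subseteq> X \<and> vec.dim X = vec.dim H + 1}
           = qint CARD('a) (vec.dim X - vec.dim W)" (is "card ?H = _")
proof -
  let ?C = "{T. vec.subspace T \<and> perp X \<subseteq> T \<and> T \<subseteq> perp W \<and> vec.dim T = vec.dim (perp X) + 1}"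
  have "bij_betw perp ?H ?C"
  proof (rule bij_betw_byWitness[where f' = perp])
    show "perp ` ?H \<subseteq> ?C"
    proof (rule image_subsetI)
      fix H assume "H \<in> ?H"
      then show "perp H \<in> ?C"
        using dim_perp[of H] dim_perp[OF assms(1)] by (auto intro: perp_antimono[THEN subsetD])
    qed
    show "perp ` ?C \<subseteq> ?H"
    proof (rule image_subsetI)
      fix T assume T: "T \<in> ?C"
      then have "perp T \<subseteq> X" "W \<subseteq> perp T"
        using perp_antimono[of "perp X" T] perp_perp[OF assms(1)] subset_perp_commute[of T W] by auto
      then show "perp T \<in> ?H" using T dim_perp[of T] dim_perp[OF assms(1)] by auto
    qed
  qed (auto simp: perp_perp)
  then have "card ?H = card ?C" by (rule bij_betw_same_card)
  also have "\<dots> = qint CARD('a) (vec.dim (perp W) - vec.dim (perp X))"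
    using perp_antimono[OF assms(3)] by (intro card_covers_between) auto
  also have "vec.dim (perp W) - vec.dim (perp X) = vec.dim X - vec.dim W"
    using dim_perp[OF assms(1)] dim_perp[OF assms(2)] vec.dim_subset[OF assms(3)] by linarith
  finally show ?thesis .
qed

section \<open>Singular subspaces and generators\<close>

lemma singular_subspacesD:
  assumes "U \<in> singular_subspaces"
  shows "vec.subspace U" "\<And>u. u \<in> U \<Longrightarrow> hyperbolic_form u = 0"
  using assms by (auto simp: singular_subspaces_def)

lemma singular_subset_perp:
  assumes "U \<in> singular_subspaces"
  shows "U \<subseteq> perp U"
proof
  fix v assume v: "v \<in> U"
  have "polar u v = 0" if "u \<in> U" for u
  proof -
    have "u + v \<in> U" using v that singular_subspacesD(1)[OF assms] by (simp add: vec.subspace_add)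
    then show ?thesis using hyperbolic_form_add[of u v] v that singular_subspacesD(2)[OF assms] by simp
  qed
  then show "v \<in> perp U" by (simp add: perp_def)
qed

lemma dim_singular_le:
  assumes "U \<in> (singular_subspaces :: ('a::{field,finite}, 'm::finite) space set set)"
  shows "vec.dim U \<le> CARD('m)"
  using dim_perp[OF singular_subspacesD(1)[OF assms]] vec.dim_subset[OF singular_subset_perp[OF assms]]
  by linarith

lemma singular_mono:
  assumes "U \<in> singular_subspaces" "W \<subseteq> U" "vec.subspace W"
  shows "W \<in> singular_subspaces"
  using assms by (auto simp: singular_subspaces_def)

lemma singular_Int:
  assumes "U \<in> singular_subspaces" "vec.subspace W"
  shows "U \<inter> W \<in> singular_subspaces"
  using assms by (intro singular_mono[OF assms(1)]) (auto simp: singular_subspaces_def intro: vec.subspace_inter)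

lemma singular_span_Un:
  assumes U: "U \<in> singular_subspaces" and W: "W \<in> singular_subspaces" and UW: "W \<subseteq> perp U"
  shows "vec.span (U \<union> W) \<in> singular_subspaces"
proof -
  have "hyperbolic_form v = 0" if v: "v \<in> vec.span (U \<union> W)" for v
  proof -
    have sp: "vec.span U = U" "vec.span W = W"
      using U W by (simp_all add: singular_subspacesD(1))
    obtain u w where "u \<in> U" "w \<in> W" "v = u + w"
      using v unfolding vec.span_Un sp by auto
    then show ?thesis
      using UW singular_subspacesD(2)[OF U] singular_subspacesD(2)[OF W]
      by (auto simp: hyperbolic_form_add perp_def)
  qed
  then show ?thesis by (simp add: singular_subspaces_def)
qed

lemma generatorsD:
  assumes "\<pi> \<in> (generators :: ('a::{field,finite}, 'm::finite) space set set)"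
  shows "\<pi> \<in> singular_subspaces" "vec.subspace \<pi>" "vec.dim \<pi> = CARD('m)"
  using assms by (auto simp: generators_def singular_subspaces_dim_def singular_subspaces_def)

lemma generatorsI:
  assumes "\<pi> \<in> (singular_subspaces :: ('a::{field,finite}, 'm::finite) space set set)" "CARD('m) \<le> vec.dim \<pi>"
  shows "\<pi> \<in> generators"
  using assms dim_singular_le[OF assms(1)] by (auto simp: generators_def singular_subspaces_dim_def)

lemma perp_generator:
  assumes "\<pi> \<in> generators"
  shows "perp \<pi> = \<pi>"
  using dim_perp[OF generatorsD(2)[OF assms]] generatorsD[OF assms] singular_subset_perp[of \<pi>]
  by (intro subspace_eqI_dim[symmetric]) auto

lemma generator_eqI:
  assumes "\<pi> \<in> generators" "\<sigma> \<in> generators" "\<pi> \<subseteq> \<sigma>"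
  shows "\<pi> = \<sigma>"
  using assms by (intro subspace_eqI_dim) (auto simp: generatorsD)

text \<open>The projection of \<pi> on U: a generator through U lies in \<open>perp U\<close>, so
  for singular U this is the generator through U that meets \<pi> in the largest possible
  subspace.\<close>

definition join_proj :: "('a::{field,finite}, 'm::finite) space set \<Rightarrow> ('a, 'm) space set \<Rightarrow> ('a, 'm) space set" where
  "join_proj U \<pi> = vec.span (U \<union> (perp U \<inter> \<pi>))"

text \<open>As \<pi> is its own orthogonal space, \<open>perp U \<inter> \<pi>\<close> is the
  orthogonal space of U + \<pi>, whose dimension is known.\<close>

lemma dim_perp_Int_generator:
  fixes U :: "('a::{field,finite}, 'm::finite) space set"
  assumes "vec.subspace U" "\<pi> \<in> generators"
  shows "vec.dim (perp U \<inter> \<pi>) + vec.dim U = CARD('m) + vec.dim (U \<inter> \<pi>)"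
proof -
  have "perp U \<inter> \<pi> = perp (U \<union> \<pi>)" using perp_generator[OF assms(2)] by (simp add: perp_Un)
  then have "perp U \<inter> \<pi> = perp (vec.span (U \<union> \<pi>))" by simp
  then have "vec.dim (perp U \<inter> \<pi>) + vec.dim (U \<union> \<pi>) = 2 * CARD('m)"
    using dim_perp[of "vec.span (U \<union> \<pi>)"] by simp
  then show ?thesis
    using dim_Un_Int[OF assms(1) generatorsD(2)[OF assms(2)]] generatorsD(3)[OF assms(2)] by linarith
qed

text \<open>U and \<open>perp U \<inter> \<pi>\<close> meet in \<open>U \<inter> \<pi>\<close>, so
  by the preceding formula their span has dimension exactly d.\<close>

lemma join_proj:
  fixes U :: "('a::{field,finite}, 'm::finite) space set"
  assumes U: "U \<in> singular_subspaces" and \<pi>: "\<pi> \<in> generators"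
  shows "join_proj U \<pi> \<in> generators" "U \<subseteq> join_proj U \<pi>" "join_proj U \<pi> \<inter> \<pi> = perp U \<inter> \<pi>"
proof -
  note sU = singular_subspacesD(1)[OF U] and s\<pi> = generatorsD(2)[OF \<pi>]
  have sI: "vec.subspace (perp U \<inter> \<pi>)" using s\<pi> by (intro vec.subspace_inter) auto
  have sing: "perp U \<inter> \<pi> \<in> singular_subspaces"
    using singular_mono[OF generatorsD(1)[OF \<pi>] _ sI] by auto
  have J: "join_proj U \<pi> \<in> singular_subspaces"
    unfolding join_proj_def by (rule singular_span_Un[OF U sing]) simp
  show UJ: "U \<subseteq> join_proj U \<pi>" by (auto simp: join_proj_def intro: vec.span_base)
  have "U \<inter> (perp U \<inter> \<pi>) = U \<inter> \<pi>" using singular_subset_perp[OF U] by auto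
  then have "vec.dim (join_proj U \<pi>) = CARD('m)"
    using dim_Un_Int[OF sU sI] dim_perp_Int_generator[OF sU \<pi>] by (simp add: join_proj_def)
  then show "join_proj U \<pi> \<in> generators" using J by (intro generatorsI) auto
  show "join_proj U \<pi> \<inter> \<pi> = perp U \<inter> \<pi>"
  proof
    have "join_proj U \<pi> \<subseteq> perp U"
      using singular_subset_perp[OF J] perp_antimono[OF UJ] by blast
    then show "join_proj U \<pi> \<inter> \<pi> \<subseteq> perp U \<inter> \<pi>" by blast
    show "perp U \<inter> \<pi> \<subseteq> join_proj U \<pi> \<inter> \<pi>" by (auto simp: join_proj_def intro: vec.span_base)
  qed
qed

text \<open>The two injections enter in either order, so one argument serves both coordinate
  generators: in each product of the form one factor vanishes.\<close>

lemma coordinate_generator: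
  fixes c c' :: "'m::finite \<Rightarrow> 'm + 'm"
  assumes c: "c = Inl \<and> c' = Inr \<or> c = Inr \<and> c' = Inl"
  shows "{v :: ('a::{field,finite}, 'm) space. \<forall>i. v $ c i = 0} \<in> generators" (is "?G \<in> _")
proof -
  have "i \<notin> range c' \<longleftrightarrow> i \<in> range c" for i using c by (cases i) auto
  then have eq: "?G = {v. \<forall>i. i \<notin> range c' \<longrightarrow> v $ i = 0}" by auto
  have "card (range c') = CARD('m)" using c by (auto simp: card_image)
  then have "vec.dim ?G = CARD('m)" unfolding eq dim_substandard_cart .
  moreover have "hyperbolic_form v = 0" if "v \<in> ?G" for v
    using that c by (auto simp: hyperbolic_form_def)
  ultimately show ?thesis by (intro generatorsI) (auto simp: singular_subspaces_def vec.subspace_def)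
qed

definition left_generator :: "('a::{field,finite}, 'm::finite) space set" where
  "left_generator = {v. \<forall>i. v $ Inr i = 0}"

definition right_generator :: "('a::{field,finite}, 'm::finite) space set" where
  "right_generator = {v. \<forall>i. v $ Inl i = 0}"

lemma left_generator: "left_generator \<in> generators"
  unfolding left_generator_def by (rule coordinate_generator[where c = Inr and c' = Inl]) simp

lemma right_generator: "right_generator \<in> generators"
  unfolding right_generator_def by (rule coordinate_generator[where c = Inl and c' = Inr]) simp

lemma singular_in_generator:
  assumes "U \<in> singular_subspaces"
  obtains \<pi> where "\<pi> \<in> generators" "U \<subseteq> \<pi>"
  using join_proj[OF assms left_generator] that by blast

section \<open>Counting generators\<close>

lemma dim_le_Int_hyperplane:
  fixes \<sigma> \<pi> :: "('a::field^'n::finite) set"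
  assumes "vec.subspace \<sigma>" "vec.subspace H" "vec.subspace \<pi>" "H \<subseteq> \<sigma>" "vec.dim \<sigma> = vec.dim H + 1"
  shows "vec.dim (\<sigma> \<inter> \<pi>) \<le> vec.dim (H \<inter> \<pi>) + 1"
proof -
  have s: "vec.subspace (\<sigma> \<inter> \<pi>)" using assms by (intro vec.subspace_inter)
  have "vec.dim (H \<union> (\<sigma> \<inter> \<pi>)) \<le> vec.dim \<sigma>" using assms by (intro vec.dim_subset) auto
  moreover have "H \<inter> (\<sigma> \<inter> \<pi>) = H \<inter> \<pi>" using assms by auto
  ultimately show ?thesis using dim_Un_Int[OF assms(2) s] assms by simp
qed

lemma dim_Int_eq_iff_subset:
  fixes \<sigma> \<pi> :: "('a::field^'n::finite) set"
  assumes "vec.subspace \<sigma>" "vec.subspace H" "vec.subspace \<pi>" "H \<subseteq> \<sigma>"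
  shows "vec.dim (\<sigma> \<inter> \<pi>) = vec.dim (H \<inter> \<pi>) \<longleftrightarrow> \<sigma> \<inter> \<pi> \<subseteq> H"
proof
  assume "vec.dim (\<sigma> \<inter> \<pi>) = vec.dim (H \<inter> \<pi>)"
  then have "H \<inter> \<pi> = \<sigma> \<inter> \<pi>" using assms by (intro subspace_eqI_dim vec.subspace_inter) auto
  then show "\<sigma> \<inter> \<pi> \<subseteq> H" by blast
next
  assume "\<sigma> \<inter> \<pi> \<subseteq> H"
  then have "H \<inter> \<pi> = \<sigma> \<inter> \<pi>" using assms by blast
  then show "vec.dim (\<sigma> \<inter> \<pi>) = vec.dim (H \<inter> \<pi>)" by simp
qed

text \<open>The quotient of \<open>perp H\<close> by H is a hyperbolic plane, which has exactly two
  singular one-dimensional subspaces; they are the images of \<sigma> and \<tau>.\<close>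

lemma other_generatorE:
  fixes \<sigma> :: "('a::{field,finite}, 'm::finite) space set"
  assumes \<sigma>: "\<sigma> \<in> generators" and H: "vec.subspace H" "H \<subseteq> \<sigma>" "vec.dim H + 1 = CARD('m)"
  obtains \<tau> where "\<tau> \<in> generators" "H \<subseteq> \<tau>" "\<tau> \<noteq> \<sigma>" "{\<rho> \<in> generators. H \<subseteq> \<rho>} = {\<sigma>, \<tau>}"
proof -
  note s\<sigma> = generatorsD(2)[OF \<sigma>]
  have HS: "H \<in> singular_subspaces" using singular_mono[OF generatorsD(1)[OF \<sigma>] H(2,1)] .
  have dp: "vec.dim (perp H) = vec.dim \<sigma> + 1" using dim_perp[OF H(1)] H(3) generatorsD(3)[OF \<sigma>] by simp
  have \<sigma>p: "\<sigma> \<subseteq> perp H" using perp_antimono[OF H(2)] perp_generator[OF \<sigma>] by simp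
  have "perp H \<noteq> \<sigma>" using dp by auto
  then obtain v where v: "v \<in> perp H" "v \<notin> \<sigma>" using \<sigma>p by blast
  then obtain s where s: "s \<in> \<sigma>" "polar s v \<noteq> 0" using perp_generator[OF \<sigma>] by (auto simp: perp_def)
  \<comment> \<open>Since s is singular, Q(v + a s) = Q(v) + a B(v, s), and this a makes it
    zero.\<close>
  define a where "a = - hyperbolic_form v / polar s v"
  define w where "w = v + a *s s"
  have "a * polar v s = - hyperbolic_form v" using s(2) by (simp add: a_def polar_commute[of v s])
  then have wQ: "hyperbolic_form w = 0"
    using singular_subspacesD(2)[OF generatorsD(1)[OF \<sigma>] s(1)]
    by (simp add: w_def hyperbolic_form_add hyperbolic_form_scale polar_scale_right)
  have wp: "w \<in> perp H"
    unfolding w_def using v(1) s(1) \<sigma>p by (intro vec.subspace_add vec.subspace_scale subspace_perp) auto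
  have w\<sigma>: "w \<notin> \<sigma>"
  proof
    assume "w \<in> \<sigma>"
    then have "w - a *s s \<in> \<sigma>"
      using s(1) s\<sigma> by (intro vec.subspace_diff vec.subspace_scale)
    then show False using v(2) by (simp add: w_def)
  qed
  have wS: "vec.span {w} \<in> singular_subspaces"
    unfolding singular_subspaces_def mem_Collect_eq
    by (intro conjI vec.subspace_span) (auto simp: vec.span_singleton hyperbolic_form_scale wQ)
  define \<tau> where "\<tau> = vec.span (insert w H)"
  have "vec.span {w} \<subseteq> perp H" using wp by (intro vec.span_minimal) auto
  then have "vec.span (H \<union> vec.span {w}) \<in> singular_subspaces" by (rule singular_span_Un[OF HS wS])
  moreover have "\<tau> \<subseteq> vec.span (H \<union> vec.span {w})"
    unfolding \<tau>_def by (rule vec.span_mono) (auto intro: vec.span_base)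
  ultimately have "\<tau> \<in> singular_subspaces" by (rule singular_mono) (simp add: \<tau>_def)
  moreover have "vec.dim \<tau> = CARD('m)"
    using dim_insert_subspace[OF H(1), of w] w\<sigma> H by (auto simp: \<tau>_def)
  ultimately have \<tau>: "\<tau> \<in> generators" by (intro generatorsI) auto
  have w\<tau>: "w \<in> \<tau>" "H \<subseteq> \<tau>" by (auto simp: \<tau>_def intro: vec.span_base)
  have "\<tau>' = \<tau>" if \<tau>': "\<tau>' \<in> generators" "H \<subseteq> \<tau>'" "\<tau>' \<noteq> \<sigma>" for \<tau>'
  proof -
    obtain w' where w': "w' \<in> \<tau>'" "w' \<notin> \<sigma>" using \<tau>' generator_eqI[OF \<tau>'(1) \<sigma>] by auto
    have "\<tau>' \<subseteq> perp H" using perp_antimono[OF \<tau>'(2)] perp_generator[OF \<tau>'(1)] by simp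
    moreover have "vec.span (insert w \<sigma>) = perp H"
      using dp by (intro span_insert_eq_cover s\<sigma> \<sigma>p wp w\<sigma>) auto
    ultimately have "w' \<in> vec.span (insert w \<sigma>)" using w' by blast
    then obtain c where c: "w' - c *s w \<in> \<sigma>"
      unfolding vec.span_insert vec.span_eq_iff[THEN iffD2, OF s\<sigma>] by blast
    \<comment> \<open>With w' = c w + t, singularity of w' reads c B(w, t) = 0, so t is orthogonal
      to w. It is also orthogonal to H, hence lies in \<open>perp \<tau>\<close>, which is
      \<tau>.\<close>
    define t where "t = w' - c *s w"
    have w'e: "w' = c *s w + t" by (simp add: t_def)
    have t: "t \<in> \<sigma>" using c by (simp add: t_def)
    have c0: "c \<noteq> 0" using w'(2) t w'e by auto
    have "hyperbolic_form w' = 0" using singular_subspacesD(2)[OF generatorsD(1)[OF \<tau>'(1)] w'(1)] .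
    then have "polar w t = 0"
      using c0 wQ singular_subspacesD(2)[OF generatorsD(1)[OF \<sigma>] t]
      by (simp add: w'e hyperbolic_form_add hyperbolic_form_scale polar_scale_left)
    then have "t \<in> perp (insert w H)" using t \<sigma>p by (auto simp: perp_def)
    then have "t \<in> \<tau>" using perp_generator[OF \<tau>] perp_span[of "insert w H"] by (simp add: \<tau>_def)
    then have "w' \<in> \<tau>"
      unfolding w'e using w\<tau> generatorsD(2)[OF \<tau>] by (intro vec.subspace_add vec.subspace_scale)
    moreover have "vec.span (insert w' H) = \<tau>'"
      using w' \<tau>' H generatorsD[OF \<tau>'(1)] by (intro span_insert_eq_cover) auto
    ultimately have "\<tau>' \<subseteq> \<tau>"
      using w\<tau> generatorsD(2)[OF \<tau>] vec.span_minimal[of "insert w' H" \<tau>] by auto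
    then show ?thesis using generator_eqI[OF \<tau>'(1) \<tau>] by simp
  qed
  then have eq: "{\<rho> \<in> generators. H \<subseteq> \<rho>} = {\<sigma>, \<tau>}" using \<sigma> \<tau> H(2) w\<tau>(2) by blast
  have "\<tau> \<noteq> \<sigma>" using w\<tau> w\<sigma> by blast
  then show ?thesis by (rule that[OF \<tau> w\<tau>(2) _ eq])
qed

section \<open>Generators through a hyperplane and their intersections with a fixed
  generator\<close>

context
  fixes \<pi> H :: "('a::{field,finite}, 'm::finite) space set"
  assumes \<pi>: "\<pi> \<in> generators" and H: "H \<in> singular_subspaces" "vec.dim H + 1 = CARD('m)"
begin

lemma dim_join_proj_hyperplane: "vec.dim (join_proj H \<pi> \<inter> \<pi>) = vec.dim (H \<inter> \<pi>) + 1"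
  using dim_perp_Int_generator[OF singular_subspacesD(1)[OF H(1)] \<pi>] join_proj(3)[OF H(1) \<pi>] H(2) by simp

lemma dim_generator_above_hyperplane:
  assumes "\<sigma> \<in> generators" "H \<subseteq> \<sigma>"
  shows "vec.dim (\<sigma> \<inter> \<pi>) = vec.dim (H \<inter> \<pi>) \<or> vec.dim (\<sigma> \<inter> \<pi>) = vec.dim (H \<inter> \<pi>) + 1"
proof -
  have "vec.dim (H \<inter> \<pi>) \<le> vec.dim (\<sigma> \<inter> \<pi>)" using assms by (intro vec.dim_subset) auto
  moreover have "vec.dim (\<sigma> \<inter> \<pi>) \<le> vec.dim (H \<inter> \<pi>) + 1"
    by (rule dim_le_Int_hyperplane[OF generatorsD(2)[OF assms(1)] singular_subspacesD(1)[OF H(1)] generatorsD(2)[OF \<pi>] assms(2)])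
      (simp add: generatorsD(3)[OF assms(1)] H(2)[symmetric])
  ultimately show ?thesis by linarith
qed

lemma generator_above_hyperplane_eq_join_proj:
  assumes "\<sigma> \<in> generators" "H \<subseteq> \<sigma>" "vec.dim (\<sigma> \<inter> \<pi>) = vec.dim (H \<inter> \<pi>) + 1"
  shows "\<sigma> = join_proj H \<pi>"
proof -
  have "\<sigma> \<subseteq> perp H" using perp_antimono[OF assms(2)] perp_generator[OF assms(1)] by simp
  then have "\<sigma> \<inter> \<pi> = perp H \<inter> \<pi>"
    using assms generatorsD(2) \<pi> dim_join_proj_hyperplane join_proj(3)[OF H(1) \<pi>]
    by (intro subspace_eqI_dim vec.subspace_inter) auto
  then have "join_proj H \<pi> \<subseteq> \<sigma>"
    unfolding join_proj_def using assms generatorsD(2) by (intro vec.span_minimal) auto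
  then show ?thesis using generator_eqI[OF join_proj(1)[OF H(1) \<pi>] assms(1)] by simp
qed

text \<open>Of the two generators through H, only the projection gains a dimension on \<pi>; the
  other one meets \<pi> exactly as H does.\<close>

lemma card_generators_above_hyperplane_meet_same:
  "card {\<sigma> \<in> generators. H \<subseteq> \<sigma> \<and> vec.dim (\<sigma> \<inter> \<pi>) = vec.dim (H \<inter> \<pi>)} = 1"
proof -
  let ?J = "join_proj H \<pi>"
  note J = join_proj[OF H(1) \<pi>]
  obtain \<tau> where \<tau>: "\<tau> \<in> generators" "H \<subseteq> \<tau>" "\<tau> \<noteq> ?J" and eq: "{\<rho> \<in> generators. H \<subseteq> \<rho>} = {?J, \<tau>}"
    by (rule other_generatorE[OF J(1) singular_subspacesD(1)[OF H(1)] J(2) H(2)])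
  have "{\<sigma> \<in> generators. H \<subseteq> \<sigma> \<and> vec.dim (\<sigma> \<inter> \<pi>) = vec.dim (H \<inter> \<pi>)} = {\<tau>}"
  proof -
    have "\<sigma> = \<tau>" if "\<sigma> \<in> generators" "H \<subseteq> \<sigma>" "vec.dim (\<sigma> \<inter> \<pi>) = vec.dim (H \<inter> \<pi>)" for \<sigma>
    proof -
      have "\<sigma> \<in> {?J, \<tau>}" unfolding eq[symmetric] using that(1,2) by simp
      moreover have "\<sigma> \<noteq> ?J"
      proof
        assume "\<sigma> = ?J"
        then have "vec.dim (?J \<inter> \<pi>) = vec.dim (H \<inter> \<pi>)" using that(3) by simp
        then show False using dim_join_proj_hyperplane by simp
      qed
      ultimately show ?thesis by simp
    qed
    moreover have "vec.dim (\<tau> \<inter> \<pi>) = vec.dim (H \<inter> \<pi>)"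
      using \<tau> generator_above_hyperplane_eq_join_proj[OF \<tau>(1,2)]
        dim_generator_above_hyperplane[OF \<tau>(1,2)] by blast
    ultimately show ?thesis using \<tau> by blast
  qed
  then show ?thesis by simp
qed

text \<open>One of the two generators gains a dimension on \<pi> over H and the other does not. The
  odd sum is what makes the dual polar graph bipartite.\<close>

lemma dim_other_generator:
  assumes "\<sigma> \<in> generators" "H \<subseteq> \<sigma>" "\<tau> \<in> generators" "H \<subseteq> \<tau>" "\<sigma> \<noteq> \<tau>"
  shows "vec.dim (\<sigma> \<inter> \<pi>) + vec.dim (\<tau> \<inter> \<pi>) = 2 * vec.dim (H \<inter> \<pi>) + 1"
proof -
  have "\<not> (vec.dim (\<sigma> \<inter> \<pi>) = vec.dim (H \<inter> \<pi>) + 1 \<and> vec.dim (\<tau> \<inter> \<pi>) = vec.dim (H \<inter> \<pi>) + 1)"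
    using generator_above_hyperplane_eq_join_proj assms by metis
  moreover have "\<not> (vec.dim (\<sigma> \<inter> \<pi>) = vec.dim (H \<inter> \<pi>) \<and> vec.dim (\<tau> \<inter> \<pi>) = vec.dim (H \<inter> \<pi>))"
  proof
    assume a: "vec.dim (\<sigma> \<inter> \<pi>) = vec.dim (H \<inter> \<pi>) \<and> vec.dim (\<tau> \<inter> \<pi>) = vec.dim (H \<inter> \<pi>)"
    have "{\<sigma>, \<tau>} \<subseteq> {\<sigma> \<in> generators. H \<subseteq> \<sigma> \<and> vec.dim (\<sigma> \<inter> \<pi>) = vec.dim (H \<inter> \<pi>)}"
      using a assms by auto
    from card_mono[OF finite this] have "card {\<sigma>, \<tau>} \<le> 1"
      using card_generators_above_hyperplane_meet_same by simp
    then show False using assms by simp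
  qed
  ultimately show ?thesis
    using dim_generator_above_hyperplane[OF assms(1,2)] dim_generator_above_hyperplane[OF assms(3,4)] by auto
qed

end

text \<open>For \<open>x \<in> \<pi>\<close> perpendicular to \<open>U\<close> and \<open>W = \<langle>U, x\<rangle>\<close>, the generators \<open>\<sigma> \<supseteq> U\<close> with \<open>\<sigma> \<inter> \<pi> = U \<inter> \<pi>\<close> and
  \<open>\<sigma>' \<supseteq> W\<close> with \<open>\<sigma>' \<inter> \<pi> = W \<inter> \<pi>\<close> are matched by the hyperplanes \<open>\<sigma> \<inter> \<sigma>' = \<sigma> \<inter> W\<^sup>\<bottom>\<close>.\<close>

lemma card_generators_above_meeting:
  fixes U \<pi> :: "('a::{field,finite}, 'm::finite) space set"
  assumes "U \<in> singular_subspaces" and \<pi>: "\<pi> \<in> generators"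
  shows "card {\<sigma> \<in> generators. U \<subseteq> \<sigma> \<and> \<sigma> \<inter> \<pi> = U \<inter> \<pi>} = CARD('a) ^ ((CARD('m) - vec.dim U) choose 2)"
  using assms(1)
proof (induction "CARD('m) - vec.dim U" arbitrary: U)
  case 0
  then have "U \<in> generators" using dim_singular_le[of U] by (intro generatorsI) auto
  then have "{\<sigma> \<in> generators. U \<subseteq> \<sigma> \<and> \<sigma> \<inter> \<pi> = U \<inter> \<pi>} = {U}" using generator_eqI by blast
  then show ?case using 0 by (simp add: numeral_2_eq_2)
next
  case (Suc m)
  let ?q = "CARD('a)"
  note U = Suc.prems and s\<pi> = generatorsD(2)[OF \<pi>]
  note sU = singular_subspacesD(1)[OF U]
  have dU: "CARD('m) = vec.dim U + Suc m" using Suc.hyps(2) by simp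
  have sUI: "vec.subspace (U \<inter> \<pi>)" using sU s\<pi> by (rule vec.subspace_inter)
  \<comment> \<open>By the dimension formula \<open>perp U \<inter> \<pi>\<close> exceeds
    \<open>U \<inter> \<pi>\<close> by d - dim U dimensions, a positive number here.\<close>
  have "\<not> perp U \<inter> \<pi> \<subseteq> U \<inter> \<pi>"
    using vec.dim_subset[of "perp U \<inter> \<pi>" "U \<inter> \<pi>"] dim_perp_Int_generator[OF sU \<pi>] dU by auto
  then obtain x where x: "x \<in> perp U" "x \<in> \<pi>" "x \<notin> U" by blast
  define W where "W = vec.span (insert x U)"
  have W: "U \<subseteq> W" "x \<in> W" "vec.subspace W" "vec.dim W = vec.dim U + 1"
    using dim_insert_subspace[OF sU, of x] x(3) by (auto simp: W_def intro: vec.span_base)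
  have "W \<subseteq> join_proj U \<pi>"
    unfolding W_def using x join_proj(2)[OF U \<pi>] generatorsD(2)[OF join_proj(1)[OF U \<pi>]]
    by (intro vec.span_minimal) (auto simp: join_proj_def intro: vec.span_base)
  then have WS: "W \<in> singular_subspaces" using singular_mono[OF generatorsD(1)[OF join_proj(1)[OF U \<pi>]] _ W(3)] by blast
  have x_in: "W \<subseteq> Z" if "vec.subspace Z" "U \<subseteq> Z" "x \<in> Z" for Z
    unfolding W_def using that by (intro vec.span_minimal) auto
  have WZ: "W \<inter> Z = U" if "vec.subspace Z" "U \<subseteq> Z" "x \<notin> Z" for Z
  proof (rule subspace_eqI_dim[symmetric])
    have s: "vec.subspace (W \<inter> Z)" using W(3) that(1) by (rule vec.subspace_inter)
    then show "vec.subspace (W \<inter> Z)" .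
    have "W \<inter> Z \<subset> W" using that(3) W(2) by blast
    then show "vec.dim (W \<inter> Z) \<le> vec.dim U" using dim_psubset_subspace[OF s W(3)] W(4) by simp
  qed (use sU W(1) that(2) in auto)
  let ?X = "{\<sigma> \<in> generators. U \<subseteq> \<sigma> \<and> \<sigma> \<inter> \<pi> = U \<inter> \<pi>}"
  let ?X' = "{\<sigma> \<in> generators. W \<subseteq> \<sigma> \<and> \<sigma> \<inter> \<pi> = W \<inter> \<pi>}"
  define Y where "Y = {H \<in> singular_subspaces. vec.dim H + 1 = CARD('m) \<and> U \<subseteq> H \<and> H \<subseteq> perp W \<and> x \<notin> H \<and> H \<inter> \<pi> = U \<inter> \<pi>}"
  have YD: "H \<in> singular_subspaces" "vec.subspace H" "vec.dim H + 1 = CARD('m)" "U \<subseteq> H" "H \<subseteq> perp W" "x \<notin> H" "H \<inter> \<pi> = U \<inter> \<pi>"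
    if "H \<in> Y" for H using that by (auto simp: Y_def singular_subspacesD(1))
  have "(\<Sum>\<sigma>\<in>?X. card {H \<in> Y. H \<subseteq> \<sigma>}) = 1 * card Y"
  proof (rule sum_multicount[OF finite finite], rule ballI)
    fix H assume "H \<in> Y"
    note H = YD[OF this]
    have "vec.dim (\<sigma> \<inter> \<pi>) = vec.dim (H \<inter> \<pi>) \<longleftrightarrow> \<sigma> \<inter> \<pi> = U \<inter> \<pi>" if "\<sigma> \<in> generators" "H \<subseteq> \<sigma>" for \<sigma>
      using dim_Int_eq_iff_subset[OF generatorsD(2)[OF that(1)] H(2) s\<pi> that(2)] H(7) that(2) by blast
    then have "{\<sigma> \<in> ?X. H \<subseteq> \<sigma>} = {\<sigma> \<in> generators. H \<subseteq> \<sigma> \<and> vec.dim (\<sigma> \<inter> \<pi>) = vec.dim (H \<inter> \<pi>)}"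
      using H(4) by auto
    then show "card {\<sigma> \<in> ?X. H \<subseteq> \<sigma>} = 1" using card_generators_above_hyperplane_meet_same[OF \<pi> H(1,3)] by simp
  qed
  moreover have "card {H \<in> Y. H \<subseteq> \<sigma>} = 1" if "\<sigma> \<in> ?X" for \<sigma>
  proof -
    have \<sigma>: "\<sigma> \<in> generators" "U \<subseteq> \<sigma>" "\<sigma> \<inter> \<pi> = U \<inter> \<pi>" using that by auto
    note s\<sigma> = generatorsD(2)[OF \<sigma>(1)]
    have x\<sigma>: "x \<notin> \<sigma>" using \<sigma>(3) x by blast
    have sI: "vec.subspace (perp W \<inter> \<sigma>)" using s\<sigma> by (intro vec.subspace_inter) auto
    have d: "vec.dim (perp W \<inter> \<sigma>) + 1 = CARD('m)"
      using dim_perp_Int_generator[OF W(3) \<sigma>(1)] WZ[OF s\<sigma> \<sigma>(2) x\<sigma>] W(4) by simp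
    have "U \<subseteq> perp W" using singular_subset_perp[OF WS] W(1) by blast
    then have "perp W \<inter> \<sigma> \<in> {H \<in> Y. H \<subseteq> \<sigma>}"
      using singular_mono[OF generatorsD(1)[OF \<sigma>(1)] _ sI] d \<sigma> x\<sigma> by (auto simp: Y_def)
    moreover have "H = perp W \<inter> \<sigma>" if "H \<in> {H \<in> Y. H \<subseteq> \<sigma>}" for H
      using that YD[of H] d sI by (intro subspace_eqI_dim) auto
    ultimately have "{H \<in> Y. H \<subseteq> \<sigma>} = {perp W \<inter> \<sigma>}" by blast
    then show ?thesis by simp
  qed
  moreover have "(\<Sum>\<sigma>\<in>?X'. card {H \<in> Y. H \<subseteq> \<sigma>}) = 1 * card Y"
  proof (rule sum_multicount[OF finite finite], rule ballI)
    fix H assume "H \<in> Y"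
    note H = YD[OF this]
    note J = join_proj[OF H(1) \<pi>]
    have "x \<in> perp H" using H(5) W(2) subset_perp_commute by blast
    then have xJ: "x \<in> join_proj H \<pi> \<inter> \<pi>" unfolding J(3) using x(2) by blast
    have WJ: "W \<subseteq> join_proj H \<pi>" using H(4) J(2) xJ generatorsD(2)[OF J(1)] by (intro x_in) auto
    have sWI: "vec.subspace (W \<inter> \<pi>)" using W(3) s\<pi> by (rule vec.subspace_inter)
    have "U \<inter> \<pi> \<subset> W \<inter> \<pi>" using W x by blast
    then have "vec.dim (U \<inter> \<pi>) < vec.dim (W \<inter> \<pi>)" by (rule dim_psubset_subspace[OF sUI sWI])
    then have "W \<inter> \<pi> = join_proj H \<pi> \<inter> \<pi>"
      using WJ dim_join_proj_hyperplane[OF \<pi> H(1,3)] H(7)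
      by (intro subspace_eqI_dim[OF sWI vec.subspace_inter[OF generatorsD(2)[OF J(1)] s\<pi>]]) auto
    then have "join_proj H \<pi> \<in> {\<sigma> \<in> ?X'. H \<subseteq> \<sigma>}" using J WJ by simp
    moreover have "\<sigma> = join_proj H \<pi>" if "\<sigma> \<in> {\<sigma> \<in> ?X'. H \<subseteq> \<sigma>}" for \<sigma>
      using that \<open>W \<inter> \<pi> = join_proj H \<pi> \<inter> \<pi>\<close> dim_join_proj_hyperplane[OF \<pi> H(1,3)]
      by (intro generator_above_hyperplane_eq_join_proj[OF \<pi> H(1,3)]) auto
    ultimately have "{\<sigma> \<in> ?X'. H \<subseteq> \<sigma>} = {join_proj H \<pi>}" by blast
    then show "card {\<sigma> \<in> ?X'. H \<subseteq> \<sigma>} = 1" by simp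
  qed
  moreover have "card {H \<in> Y. H \<subseteq> \<sigma>} = ?q ^ m" if "\<sigma> \<in> ?X'" for \<sigma>
  proof -
    have \<sigma>: "\<sigma> \<in> generators" "W \<subseteq> \<sigma>" "\<sigma> \<inter> \<pi> = W \<inter> \<pi>" using that by auto
    let ?H = "\<lambda>Z. {H. vec.subspace H \<and> Z \<subseteq> H \<and> H \<subseteq> \<sigma> \<and> vec.dim \<sigma> = vec.dim H + 1}"
    have \<sigma>W: "\<sigma> \<subseteq> perp W" using perp_antimono[OF \<sigma>(2)] perp_generator[OF \<sigma>(1)] by simp
    have "H \<in> Y" if H: "H \<in> ?H U" "\<not> W \<subseteq> H" for H
    proof -
      have "x \<notin> H" using H x_in by blast
      then have "W \<inter> H = U" using H by (intro WZ) auto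
      then have "H \<inter> \<pi> = U \<inter> \<pi>" using H \<sigma>(3) by blast
      then show ?thesis
        using H \<open>x \<notin> H\<close> \<sigma>W singular_mono[OF generatorsD(1)[OF \<sigma>(1)]] generatorsD(3)[OF \<sigma>(1)]
        by (auto simp: Y_def)
    qed
    moreover have "H \<in> ?H U - ?H W" if "H \<in> Y" "H \<subseteq> \<sigma>" for H
      using that YD[OF that(1)] W(2) generatorsD(3)[OF \<sigma>(1)] by auto
    \<comment> \<open>The factor q^m of the recursion: the hyperplanes of the generator above U but
      not above W number [m + 1] - [m] = q^m.\<close>
    ultimately have eq: "{H \<in> Y. H \<subseteq> \<sigma>} = ?H U - ?H W" by blast
    have 1: "card (?H U - ?H W) = card (?H U) - card (?H W)" using W(1) by (intro card_Diff_subset) auto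
    have 2: "card (?H U) = qint ?q (vec.dim \<sigma> - vec.dim U)"
      by (rule card_hyperplanes_above[OF generatorsD(2)[OF \<sigma>(1)] sU]) (use W(1) \<sigma>(2) in blast)
    have 3: "card (?H W) = qint ?q (vec.dim \<sigma> - vec.dim W)"
      by (rule card_hyperplanes_above[OF generatorsD(2)[OF \<sigma>(1)] W(3) \<sigma>(2)])
    have "vec.dim \<sigma> - vec.dim U = Suc m" "vec.dim \<sigma> - vec.dim W = m"
      using generatorsD(3)[OF \<sigma>(1)] dU W(4) by linarith+
    then show ?thesis unfolding eq 1 2 3 by (simp add: qint_Suc)
  qed
  ultimately have "card ?X = card ?X' * ?q ^ m" by simp
  moreover have "card ?X' = ?q ^ (m choose 2)" using Suc.hyps(1)[OF _ WS] W(4) dU by simp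
  ultimately show ?case using dU by (simp add: numeral_2_eq_2 power_add)
qed

lemma singular_extend:
  fixes U :: "('a::{field,finite}, 'm::finite) space set"
  assumes U: "U \<in> singular_subspaces" and "vec.dim U < CARD('m)"
  obtains W where "W \<in> singular_subspaces" "U \<subseteq> W" "vec.dim W = vec.dim U + 1"
proof -
  obtain \<pi> where \<pi>: "\<pi> \<in> generators" "U \<subseteq> \<pi>" using singular_in_generator[OF U] .
  have "U \<noteq> \<pi>" using assms(2) generatorsD(3)[OF \<pi>(1)] by auto
  then obtain x where x: "x \<in> \<pi>" "x \<notin> U" using \<pi> by blast
  have "vec.span (insert x U) \<subseteq> \<pi>"
    using \<pi> x generatorsD(2)[OF \<pi>(1)] by (intro vec.span_minimal) auto
  then have "vec.span (insert x U) \<in> singular_subspaces"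
    by (rule singular_mono[OF generatorsD(1)[OF \<pi>(1)]]) simp
  moreover have "U \<subseteq> vec.span (insert x U)" by (auto intro: vec.span_base)
  moreover have "vec.dim (vec.span (insert x U)) = vec.dim U + 1"
    using dim_insert_subspace[OF singular_subspacesD(1)[OF U]] x by simp
  ultimately show ?thesis by (rule that)
qed

text \<open>Counting the pairs of generators \<open>\<sigma> \<supseteq> W\<close>, \<open>\<tau> \<supseteq> U\<close> with \<open>\<sigma> \<inter> \<tau> = U\<close> in two ways, where \<open>W\<close>
  covers \<open>U\<close>, gives the recursion.\<close>

lemma card_generators_above:
  fixes U :: "('a::{field,finite}, 'm::finite) space set"
  assumes "U \<in> singular_subspaces"
  shows "card {\<sigma> \<in> generators. U \<subseteq> \<sigma>} = (\<Prod>i<CARD('m) - vec.dim U. CARD('a) ^ i + 1)"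
  using assms
proof (induction "CARD('m) - vec.dim U" arbitrary: U)
  case 0
  then have U: "U \<in> generators" using dim_singular_le[of U] by (intro generatorsI) auto
  then have "{\<sigma> \<in> generators. U \<subseteq> \<sigma>} = {U}" using generator_eqI by blast
  then show ?case using 0 by simp
next
  case (Suc m)
  let ?q = "CARD('a)"
  have dU: "CARD('m) = vec.dim U + Suc m" using Suc.hyps(2) by simp
  obtain W where W: "W \<in> singular_subspaces" "U \<subseteq> W" "vec.dim W = vec.dim U + 1"
    using singular_extend[OF Suc.prems] dU by (metis less_add_same_cancel1 zero_less_Suc)
  have dW: "CARD('m) - vec.dim W = m" using dU W by simp
  let ?A = "{\<sigma> \<in> generators. U \<subseteq> \<sigma>}" and ?B = "{\<sigma> \<in> generators. W \<subseteq> \<sigma>}"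
  have gB: "card ?B = (\<Prod>i<m. ?q ^ i + 1)" using Suc.hyps(1)[OF _ W(1)] dW by simp
  have "(\<Sum>\<tau>\<in>?A. card {\<sigma> \<in> ?B. \<sigma> \<inter> \<tau> = U}) = ?q ^ (Suc m choose 2) * card ?B"
  proof (rule sum_multicount[OF finite finite], rule ballI)
    fix \<sigma> assume "\<sigma> \<in> ?B"
    then have \<sigma>: "\<sigma> \<in> generators" "U \<inter> \<sigma> = U" using W by auto
    have "{\<tau> \<in> ?A. \<sigma> \<inter> \<tau> = U} = {\<tau> \<in> generators. U \<subseteq> \<tau> \<and> \<tau> \<inter> \<sigma> = U \<inter> \<sigma>}"
      unfolding \<sigma>(2) by blast
    then show "card {\<tau> \<in> ?A. \<sigma> \<inter> \<tau> = U} = ?q ^ (Suc m choose 2)"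
      using card_generators_above_meeting[OF Suc.prems \<sigma>(1)] dU by simp
  qed
  \<comment> \<open>A generator \<tau> through U may contain W, and then no \<sigma> through W meets
    it in U. Otherwise it meets W exactly in U, because W covers U, and the preceding count applies
    with W in place of U.\<close>
  moreover have "(\<Sum>\<tau>\<in>?A. card {\<sigma> \<in> ?B. \<sigma> \<inter> \<tau> = U}) = (\<Sum>\<tau>\<in>?A. if W \<subseteq> \<tau> then 0 else ?q ^ (m choose 2))"
  proof (rule sum.cong[OF refl])
    fix \<tau> assume "\<tau> \<in> ?A"
    then have \<tau>: "\<tau> \<in> generators" "U \<subseteq> \<tau>" by auto
    show "card {\<sigma> \<in> ?B. \<sigma> \<inter> \<tau> = U} = (if W \<subseteq> \<tau> then 0 else ?q ^ (m choose 2))"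
    proof (cases "W \<subseteq> \<tau>")
      case True
      have "W \<noteq> U" using W by auto
      then have "{\<sigma> \<in> ?B. \<sigma> \<inter> \<tau> = U} = {}" using True W by blast
      then show ?thesis using True by simp
    next
      case False
      have sI: "vec.subspace (W \<inter> \<tau>)"
        using singular_subspacesD(1)[OF W(1)] generatorsD(2)[OF \<tau>(1)] by (rule vec.subspace_inter)
      have "W \<inter> \<tau> \<subset> W" using False by blast
      then have "vec.dim (W \<inter> \<tau>) < vec.dim W"
        by (rule dim_psubset_subspace[OF sI singular_subspacesD(1)[OF W(1)]])
      then have WU: "W \<inter> \<tau> = U"
        using W \<tau> sI singular_subspacesD(1)[OF Suc.prems] by (intro subspace_eqI_dim[symmetric]) auto
      have "{\<sigma> \<in> ?B. \<sigma> \<inter> \<tau> = U} = {\<sigma> \<in> generators. W \<subseteq> \<sigma> \<and> \<sigma> \<inter> \<tau> = W \<inter> \<tau>}"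
        unfolding WU by blast
      then show ?thesis using card_generators_above_meeting[OF W(1) \<tau>(1)] dW False by simp
    qed
  qed
  moreover have "\<dots> = card (?A - ?B) * ?q ^ (m choose 2)"
  proof -
    have "{\<tau> \<in> ?A. \<not> W \<subseteq> \<tau>} = ?A - ?B" by blast
    then show ?thesis by (simp add: sum.If_cases Int_def)
  qed
  moreover have "card (?A - ?B) = card ?A - card ?B" "card ?B \<le> card ?A"
  proof -
    have "?B \<subseteq> ?A" using W by blast
    then show "card (?A - ?B) = card ?A - card ?B" "card ?B \<le> card ?A"
      by (auto intro: card_Diff_subset card_mono)
  qed
  moreover have "?q ^ (Suc m choose 2) = ?q ^ m * ?q ^ (m choose 2)"
    by (simp add: numeral_2_eq_2 power_add)
  ultimately have "?q ^ m * card ?B * ?q ^ (m choose 2) = (card ?A - card ?B) * ?q ^ (m choose 2)"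
    by (simp add: mult_ac)
  then have "card ?A - card ?B = ?q ^ m * card ?B"
    by simp
  then have "card ?A = (?q ^ m + 1) * card ?B"
    using \<open>card ?B \<le> card ?A\<close> by (simp add: algebra_simps)
  then show ?case unfolding Suc.hyps(2)[symmetric] gB by simp
qed

text \<open>With U = {0} the preceding count gives a power of q, which is positive.\<close>

lemma ex_opposite_generator:
  assumes "\<pi> \<in> (generators :: ('a::{field,finite}, 'm::finite) space set set)"
  obtains \<sigma> where "\<sigma> \<in> generators" "\<sigma> \<inter> \<pi> = {0}"
proof -
  have z: "{0} \<in> (singular_subspaces :: ('a, 'm) space set set)"
    by (auto simp: singular_subspaces_def hyperbolic_form_def)
  have "{0} \<inter> \<pi> = {0}" using generatorsD(2)[OF assms] by (auto simp: vec.subspace_0)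
  then have c: "card {\<sigma> \<in> generators. {0} \<subseteq> \<sigma> \<and> \<sigma> \<inter> \<pi> = {0}} \<noteq> 0" (is "card ?S \<noteq> 0")
    using card_generators_above_meeting[OF z assms] by simp
  have "?S \<noteq> {}"
  proof
    assume "?S = {}"
    then show False using c by (simp only: card.empty)
  qed
  then have "\<exists>\<sigma>. \<sigma> \<in> ?S" unfolding ex_in_conv .
  then obtain \<sigma> where "\<sigma> \<in> ?S" ..
  then show ?thesis by (intro that[of \<sigma>]) simp_all
qed

section \<open>The two classes of generators\<close>

text \<open>Take a hyperplane H of \<sigma> containing \<open>\<sigma> \<inter> \<pi>\<close>. As
  \<sigma> gains nothing on \<pi> over H, the other generator through H gains one dimension.\<close>

lemma ex_closer_neighbour:
  fixes \<sigma> \<pi> :: "('a::{field,finite}, 'm::finite) space set"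
  assumes \<sigma>: "\<sigma> \<in> generators" and \<pi>: "\<pi> \<in> generators" and ne: "\<sigma> \<noteq> \<pi>"
  obtains \<tau> where "\<tau> \<in> generators" "vec.dim (\<sigma> \<inter> \<tau>) + 1 = CARD('m)"
    "vec.dim (\<tau> \<inter> \<pi>) = vec.dim (\<sigma> \<inter> \<pi>) + 1"
proof -
  note s\<sigma> = generatorsD(2)[OF \<sigma>] and s\<pi> = generatorsD(2)[OF \<pi>]
  have ps: "\<sigma> \<inter> \<pi> \<subset> \<sigma>" using ne generator_eqI[OF \<sigma> \<pi>] by blast
  have sI: "vec.subspace (\<sigma> \<inter> \<pi>)" using s\<sigma> s\<pi> by (rule vec.subspace_inter)
  obtain H where H: "vec.subspace H" "\<sigma> \<inter> \<pi> \<subseteq> H" "H \<subseteq> \<sigma>" "vec.dim \<sigma> = vec.dim H + 1"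
    using ex_hyperplane_between[OF sI s\<sigma> ps] by metis
  have HS: "H \<in> singular_subspaces" using singular_mono[OF generatorsD(1)[OF \<sigma>] H(3,1)] .
  have dH: "vec.dim H + 1 = CARD('m)" using H(4) generatorsD(3)[OF \<sigma>] by simp
  obtain \<tau> where \<tau>: "\<tau> \<in> generators" "H \<subseteq> \<tau>" "\<tau> \<noteq> \<sigma>"
    using other_generatorE[OF \<sigma> H(1,3) dH] by metis
  have "vec.dim (\<sigma> \<inter> \<pi>) = vec.dim (H \<inter> \<pi>)"
    using dim_Int_eq_iff_subset[OF s\<sigma> H(1) s\<pi> H(3)] H(2) by simp
  then have 1: "vec.dim (\<tau> \<inter> \<pi>) = vec.dim (\<sigma> \<inter> \<pi>) + 1"
    using dim_other_generator[OF \<pi> HS dH \<sigma> H(3) \<tau>(1,2)] \<tau>(3) by simp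
  have "\<sigma> \<inter> \<tau> \<subset> \<sigma>" using \<tau>(3) generator_eqI[OF \<sigma> \<tau>(1)] by blast
  then have "vec.dim (\<sigma> \<inter> \<tau>) < vec.dim \<sigma>"
    by (intro dim_psubset_subspace vec.subspace_inter s\<sigma> generatorsD(2)[OF \<tau>(1)])
  moreover have "vec.dim H \<le> vec.dim (\<sigma> \<inter> \<tau>)" using H \<tau> by (intro vec.dim_subset) auto
  ultimately have "vec.dim (\<sigma> \<inter> \<tau>) + 1 = CARD('m)" using H(4) dH by linarith
  then show ?thesis using that[OF \<tau>(1) _ 1] by simp
qed

lemma odd_dim_Int_neighbours:
  fixes \<sigma> \<tau> \<rho> :: "('a::{field,finite}, 'm::finite) space set"
  assumes \<sigma>: "\<sigma> \<in> generators" and \<tau>: "\<tau> \<in> generators" and \<rho>: "\<rho> \<in> generators"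
    and d: "vec.dim (\<sigma> \<inter> \<tau>) + 1 = CARD('m)"
  shows "odd (vec.dim (\<sigma> \<inter> \<rho>) + vec.dim (\<tau> \<inter> \<rho>))"
proof -
  have "\<sigma> \<noteq> \<tau>" using d generatorsD(3)[OF \<sigma>] by auto
  then show ?thesis
    using dim_other_generator[OF \<rho> singular_Int[OF generatorsD(1)[OF \<sigma>] generatorsD(2)[OF \<tau>]] d \<sigma> _ \<tau>] by simp
qed

text \<open>With d - dim as the distance in the dual polar graph, the three distances of a triple
  have even sum, as in any bipartite graph. The induction walks from \<sigma> to \<tau>; each step
  changes the distances to \<tau> and to \<pi> by odd amounts.\<close>

lemma even_dim_Int_generators:
  fixes \<pi> \<sigma> \<tau> :: "('a::{field,finite}, 'm::finite) space set"
  assumes \<pi>: "\<pi> \<in> generators" and "\<sigma> \<in> generators" and \<tau>: "\<tau> \<in> generators"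
  shows "even (vec.dim (\<sigma> \<inter> \<pi>) + vec.dim (\<sigma> \<inter> \<tau>) + vec.dim (\<tau> \<inter> \<pi>) + CARD('m))"
  using assms(2)
proof (induction "CARD('m) - vec.dim (\<sigma> \<inter> \<tau>)" arbitrary: \<sigma> rule: less_induct)
  case less
  show ?case
  proof (cases "\<sigma> = \<tau>")
    case True
    have "even (a + d + a + d)" for a d :: nat by presburger
    then show ?thesis unfolding True Int_absorb generatorsD(3)[OF \<tau>] .
  next
    case False
    obtain \<sigma>' where \<sigma>': "\<sigma>' \<in> generators" "vec.dim (\<sigma> \<inter> \<sigma>') + 1 = CARD('m)"
      and 1: "vec.dim (\<sigma>' \<inter> \<tau>) = vec.dim (\<sigma> \<inter> \<tau>) + 1"
      by (rule ex_closer_neighbour[OF less.prems \<tau> False])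
    have 2: "odd (vec.dim (\<sigma> \<inter> \<pi>) + vec.dim (\<sigma>' \<inter> \<pi>))"
      by (rule odd_dim_Int_neighbours[OF less.prems \<sigma>'(1) \<pi> \<sigma>'(2)])
    have "vec.dim (\<sigma>' \<inter> \<tau>) \<le> CARD('m)"
      using vec.dim_subset[of "\<sigma>' \<inter> \<tau>" \<tau>] generatorsD(3)[OF \<tau>] by simp
    then have "even (vec.dim (\<sigma>' \<inter> \<pi>) + vec.dim (\<sigma>' \<inter> \<tau>) + vec.dim (\<tau> \<inter> \<pi>) + CARD('m))"
      using 1 by (intro less.hyps \<sigma>'(1)) simp
    moreover have "even (a + b + e + d)" if "even (a' + b' + e + d)" "b' = b + 1" "odd (a + a')"
      for a a' b b' e d :: nat
      using that by presburger
    ultimately show ?thesis using 1 2 by metis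
  qed
qed

lemma generator_classE:
  assumes "G \<in> (generator_classes :: ('a::{field,finite}, 'm::finite) space set set set)"
  obtains \<pi>0 where "\<pi>0 \<in> generators"
    "G = {\<sigma> \<in> generators. vec.dim (\<sigma> \<inter> \<pi>0) mod 2 = CARD('m) mod 2}"
proof -
  obtain \<pi>0 where \<pi>0: "\<pi>0 \<in> generators" "G = same_class `` {\<pi>0}"
    using assms by (auto simp: generator_classes_def quotient_def)
  then have "G = {\<sigma> \<in> generators. vec.dim (\<sigma> \<inter> \<pi>0) mod 2 = CARD('m) mod 2}"
    by (auto simp: same_class_def Int_commute)
  then show ?thesis using \<pi>0 that by blast
qed

context
  fixes G :: "('a::{field,finite}, 'm::finite) space set set"
  assumes G: "G \<in> generator_classes"
begin

lemma class_subset_generators: "\<pi> \<in> G \<Longrightarrow> \<pi> \<in> generators"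
  using generator_classE[OF G] by blast

lemma class_nonempty: "\<exists>\<pi>. \<pi> \<in> G"
proof -
  obtain \<pi>0 where \<pi>0: "\<pi>0 \<in> generators"
    "G = {\<sigma> \<in> generators. vec.dim (\<sigma> \<inter> \<pi>0) mod 2 = CARD('m) mod 2}"
    by (rule generator_classE[OF G])
  then have "\<pi>0 \<in> G" using generatorsD(3)[OF \<pi>0(1)] by simp
  then show ?thesis ..
qed

text \<open>Any member can replace the representative that defines the class; this is the
  transitivity of \<open>same_class\<close>, obtained from the parity of triples.\<close>

lemma class_mem_iff:
  assumes "\<pi> \<in> G" "\<sigma> \<in> generators"
  shows "\<sigma> \<in> G \<longleftrightarrow> even (vec.dim (\<sigma> \<inter> \<pi>) + CARD('m))"
proof -
  obtain \<pi>0 where \<pi>0: "\<pi>0 \<in> generators"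
    "G = {\<sigma> \<in> generators. vec.dim (\<sigma> \<inter> \<pi>0) mod 2 = CARD('m) mod 2}"
    by (rule generator_classE[OF G])
  have "even (vec.dim (\<sigma> \<inter> \<pi>0) + vec.dim (\<sigma> \<inter> \<pi>) + vec.dim (\<pi> \<inter> \<pi>0) + CARD('m))"
    using even_dim_Int_generators[OF \<pi>0(1) assms(2) class_subset_generators[OF assms(1)]] .
  moreover have "vec.dim (\<pi> \<inter> \<pi>0) mod 2 = CARD('m) mod 2" using \<pi>0 assms(1) by auto
  moreover have "\<sigma> \<in> G \<longleftrightarrow> vec.dim (\<sigma> \<inter> \<pi>0) mod 2 = CARD('m) mod 2" using \<pi>0 assms(2) by auto
  moreover have "b mod 2 = d mod 2 \<longleftrightarrow> even (c + d)"
    if "even (b + c + e + d)" "e mod 2 = d mod 2" for b c d e :: nat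
    using that by presburger
  ultimately show ?thesis by simp
qed

lemma class_adjacent:
  assumes "\<sigma> \<in> generators" "\<tau> \<in> generators" "vec.dim (\<sigma> \<inter> \<tau>) + 1 = CARD('m)"
  shows "\<sigma> \<in> G \<longleftrightarrow> \<tau> \<notin> G"
proof -
  obtain \<pi> where \<pi>: "\<pi> \<in> G" using class_nonempty ..
  have "even (vec.dim (\<sigma> \<inter> \<pi>) + vec.dim (\<sigma> \<inter> \<tau>) + vec.dim (\<tau> \<inter> \<pi>) + CARD('m))"
    using even_dim_Int_generators[OF class_subset_generators[OF \<pi>] assms(1,2)] .
  moreover have "even (b + d) \<longleftrightarrow> odd (c + d)" if "even (b + e + c + d)" "e + 1 = d" for b c d e :: nat
    using that by presburger
  ultimately show ?thesis using class_mem_iff[OF \<pi>] assms by (simp add: Int_commute[of \<tau>])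
qed

lemma class_opposite:
  assumes "even CARD('m)" "\<sigma> \<in> G" "\<tau> \<in> generators" "\<tau> \<inter> \<sigma> = {0}"
  shows "\<tau> \<in> G"
  using class_mem_iff[OF assms(2,3)] assms by simp

end

section \<open>Orthogonal layers of a flag\<close>

text \<open>The orthogonal difference of two consecutive members carries the index of the smaller
  one, so that the k-th layer of the flag below is V_k.\<close>

definition layer :: "(nat \<Rightarrow> 'v::euclidean_space set) \<Rightarrow> nat \<Rightarrow> 'v set" where
  "layer F k = F (Suc k) \<inter> orthogonal_comp (F k)"

lemma inner_symmetric_matrix:
  fixes M :: "real ^ 'n::finite ^ 'n"
  assumes "transpose M = M"
  shows "inner (M *v u) v = inner u (M *v v)"
  by (metis assms dot_lmul_matrix vector_transpose_matrix)

context
  fixes F :: "nat \<Rightarrow> 'v::euclidean_space set"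
  assumes sub: "\<And>k. subspace (F k)" and zero: "F 0 = {0}" and mono: "\<And>k. F k \<subseteq> F (Suc k)"
begin

lemma chain_mono: "j \<le> k \<Longrightarrow> F j \<subseteq> F k"
  using mono by (rule lift_Suc_mono_le)

lemma layer_orthogonal:
  assumes "j \<noteq> k" "u \<in> layer F j" "v \<in> layer F k"
  shows "inner u v = 0"
proof -
  have *: "inner u v = 0" if "j < k" "u \<in> layer F j" "v \<in> layer F k" for j k u v
    using that chain_mono[of "Suc j" k]
    by (auto simp: layer_def orthogonal_comp_def orthogonal_def)
  from assms show ?thesis
    using *[of j k u v] *[of k j v u] by (cases "j < k") (auto simp: inner_commute)
qed

lemma subspace_layer: "subspace (layer F k)"
  unfolding layer_def by (intro subspace_inter sub subspace_orthogonal_comp)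

lemma layer_decomposition:
  assumes "v \<in> F n"
  obtains w where "\<forall>k<n. w k \<in> layer F k" "v = (\<Sum>k<n. w k)"
proof -
  have "\<exists>w. (\<forall>k<n. w k \<in> layer F k) \<and> v = (\<Sum>k<n. w k)"
    using assms
  proof (induction n arbitrary: v)
    case 0
    then show ?case using zero by simp
  next
    case (Suc n)
    obtain y z where yz: "y \<in> span (F n)" "\<And>u. u \<in> span (F n) \<Longrightarrow> orthogonal z u" "v = y + z"
      using orthogonal_subspace_decomp_exists[of "F n" v] by metis
    have sp: "span (F n) = F n" using sub by (simp add: span_eq_iff)
    obtain w where w: "\<forall>k<n. w k \<in> layer F k" "y = (\<Sum>k<n. w k)"
      using Suc.IH[of y] yz(1) sp by auto
    have "v - y \<in> F (Suc n)" using mono[of n] yz(1) sp Suc.prems sub by (intro subspace_diff) auto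
    then have "z \<in> layer F n"
      using yz(2,3) sp by (auto simp: layer_def orthogonal_comp_def orthogonal_commute)
    then show ?case using w yz(3) by (intro exI[of _ "w(n := z)"]) (auto simp: less_Suc_eq)
  qed
  then show ?thesis using that by blast
qed

lemma span_layers: "span (\<Union>k<n. layer F k) = F n"
proof
  have "layer F k \<subseteq> F n" if "k < n" for k
    using chain_mono[of "Suc k" n] that by (auto simp: layer_def)
  then show "span (\<Union>k<n. layer F k) \<subseteq> F n" using sub by (intro span_minimal) auto
  show "F n \<subseteq> span (\<Union>k<n. layer F k)"
  proof
    fix v assume "v \<in> F n"
    then obtain w where w: "\<forall>k<n. w k \<in> layer F k" "v = (\<Sum>k<n. w k)"
      by (rule layer_decomposition)
    show "v \<in> span (\<Union>k<n. layer F k)" unfolding w(2) using w(1) by (intro span_sum span_base) auto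
  qed
qed

text \<open>The hypothesis makes T preserve each F k. For v orthogonal to F k the error r = T v -
  \<theta> v lies in F k, and by symmetry (r, r) = (T r, v) - \<theta> (r, v) = 0.\<close>

lemma layer_eigen:
  fixes T :: "'v \<Rightarrow> 'v"
  assumes sym: "\<And>u v. inner (T u) v = inner u (T v)"
    and T: "\<And>k v. k < n \<Longrightarrow> v \<in> F (Suc k) \<Longrightarrow> T v - \<theta> k *\<^sub>R v \<in> F k"
    and "k < n" "v \<in> layer F k"
  shows "T v = \<theta> k *\<^sub>R v"
proof -
  have inv: "T y \<in> F k" if "y \<in> F k" for y
  proof (cases k)
    case 0
    \<comment> \<open>T is an arbitrary symmetric map, so \<open>T 0 = 0\<close> is read off the
      hypothesis at level 0.\<close>
    have "T 0 - \<theta> 0 *\<^sub>R 0 \<in> F 0"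
      using T[of 0 0] \<open>k < n\<close> 0 sub[of "Suc 0"] by (simp add: subspace_0)
    then show ?thesis using that 0 zero by simp
  next
    case (Suc j)
    then have "T y - \<theta> j *\<^sub>R y \<in> F k"
      using T[of j y] that \<open>k < n\<close> mono[of j] by auto
    then have "T y - \<theta> j *\<^sub>R y + \<theta> j *\<^sub>R y \<in> F k"
      using that sub by (intro subspace_add subspace_scale) auto
    then show ?thesis by simp
  qed
  have v: "v \<in> F (Suc k)" "\<And>y. y \<in> F k \<Longrightarrow> inner y v = 0"
    using assms(4) by (auto simp: layer_def orthogonal_comp_def orthogonal_def)
  define r where "r = T v - \<theta> k *\<^sub>R v"
  have r: "r \<in> F k" unfolding r_def using T v assms(3) by blast
  have "inner r r = inner r (T v) - \<theta> k * inner r v"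
    by (subst (2) r_def) (simp add: inner_diff_right)
  also have "inner r (T v) = inner (T r) v" by (simp add: sym)
  finally have "inner r r = 0" using v(2)[OF inv[OF r]] v(2)[OF r] by simp
  then show ?thesis by (simp add: r_def)
qed

text \<open>Subtracting \<mu> times the vector and pairing with w k leaves (\<theta> k - \<mu>) |w
  k|^2, because distinct layers are orthogonal.\<close>

lemma eigenvector_components:
  fixes T :: "'v \<Rightarrow> 'v"
  assumes "linear T" and eig: "\<And>k. k < n \<Longrightarrow> T (w k) = \<theta> k *\<^sub>R w k"
    and w: "\<And>k. k < n \<Longrightarrow> w k \<in> layer F k" and "T (\<Sum>k<n. w k) = \<mu> *\<^sub>R (\<Sum>k<n. w k)"
    and "k < n" "\<theta> k \<noteq> \<mu>"
  shows "w k = 0"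
proof -
  have "(\<Sum>j<n. (\<theta> j - \<mu>) *\<^sub>R w j) = 0"
    using assms(4) eig by (simp add: linear_sum[OF assms(1)] scaleR_left_diff_distrib sum_subtractf scaleR_right.sum)
  then have "0 = inner (\<Sum>j<n. (\<theta> j - \<mu>) *\<^sub>R w j) (w k)" by simp
  also have "\<dots> = (\<Sum>j<n. (\<theta> j - \<mu>) * inner (w j) (w k))" by (simp add: inner_sum_left)
  also have "\<dots> = (\<Sum>j<n. if j = k then (\<theta> k - \<mu>) * inner (w k) (w k) else 0)"
    using w assms(5) layer_orthogonal by (intro sum.cong) auto
  finally show ?thesis using assms(5,6) by simp
qed

lemma eigenspace_eq_layer:
  fixes T :: "'v \<Rightarrow> 'v"
  assumes "linear T" and eig: "\<And>k v. k < n \<Longrightarrow> v \<in> layer F k \<Longrightarrow> T v = \<theta> k *\<^sub>R v"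
    and inj: "inj_on \<theta> {..<n}" and "k < n"
  shows "{v \<in> F n. T v = \<theta> k *\<^sub>R v} = layer F k"
proof (intro equalityI subsetI)
  fix v assume v: "v \<in> {v \<in> F n. T v = \<theta> k *\<^sub>R v}"
  then obtain w where w: "\<forall>k<n. w k \<in> layer F k" "v = (\<Sum>k<n. w k)"
    using layer_decomposition[of v n] by blast
  have "w j = 0" if "j < n" "j \<noteq> k" for j
  proof (rule eigenvector_components[OF assms(1), of n w \<theta> "\<theta> k"])
    show "T (\<Sum>k<n. w k) = \<theta> k *\<^sub>R (\<Sum>k<n. w k)" using v w(2) by simp
    show "\<theta> j \<noteq> \<theta> k" using inj that \<open>k < n\<close> by (auto simp: inj_on_def)
  qed (use eig w(1) that in auto)
  then have "v = (\<Sum>j<n. if j = k then w k else 0)"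
    unfolding w(2) by (intro sum.cong) auto
  then show "v \<in> layer F k" using w(1) \<open>k < n\<close> by simp
next
  fix v assume "v \<in> layer F k"
  then show "v \<in> {v \<in> F n. T v = \<theta> k *\<^sub>R v}"
    using eig \<open>k < n\<close> chain_mono[of "Suc k" n] by (auto simp: layer_def)
qed

end

section \<open>Vectors and matrices indexed by finite sets\<close>

lemma subspace_supported: "subspace (supported X)"
  by (auto simp: subspace_def supported_def)

lemma supported_mono: "X \<subseteq> Y \<Longrightarrow> supported X \<subseteq> supported Y"
  by (auto simp: supported_def)

lemma char_vec_supported: "X \<subseteq> Y \<Longrightarrow> char_vec X \<in> supported Y"
  by (auto simp: supported_def char_vec_def)

lemma char_vec_component: "char_vec X $ i = (if i \<in> X then 1 else 0)"
  by (simp add: char_vec_def)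

lemma rel_matrix_mult_component:
  "(rel_matrix X Y R *v v) $ i = (if i \<in> X then \<Sum>j | j \<in> Y \<and> R i j. v $ j else 0)"
proof -
  have "(\<Sum>j\<in>UNIV. (if i \<in> X \<and> j \<in> Y \<and> R i j then 1 else 0) * v $ j)
      = (\<Sum>j\<in>UNIV. if j \<in> {j. i \<in> X \<and> j \<in> Y \<and> R i j} then v $ j else 0)"
    by (intro sum.cong) auto
  also have "\<dots> = (\<Sum>j | i \<in> X \<and> j \<in> Y \<and> R i j. v $ j)" by (subst sum.inter_restrict[symmetric]) simp_all
  finally show ?thesis by (auto simp: rel_matrix_def matrix_vector_mult_def)
qed

lemma rel_matrix_mult_char_vec:
  assumes "Z \<subseteq> Y"
  shows "(rel_matrix X Y R *v char_vec Z) $ i = (if i \<in> X then real (card {j \<in> Z. R i j}) else 0)"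
proof -
  have "(\<Sum>j | j \<in> Y \<and> R i j. char_vec Z $ j) = (\<Sum>j\<in>{j. j \<in> Y \<and> R i j} \<inter> Z. 1)"
    by (subst sum.inter_restrict) (auto simp: char_vec_def)
  also have "{j. j \<in> Y \<and> R i j} \<inter> Z = {j \<in> Z. R i j}" using assms by auto
  finally show ?thesis by (simp add: rel_matrix_mult_component)
qed

lemma transpose_rel_matrix:
  assumes "\<And>i j. R i j \<longleftrightarrow> R j i"
  shows "transpose (rel_matrix X X R) = rel_matrix X X R"
  using assms by (auto simp: transpose_def rel_matrix_def vec_eq_iff)

lemma inner_char_vec: "inner (char_vec X) v = (\<Sum>i\<in>X. v $ i)"
proof -
  have "inner (char_vec X) v = (\<Sum>i\<in>UNIV. if i \<in> X then v $ i else 0)"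
    by (auto simp: inner_vec_def char_vec_def intro!: sum.cong)
  also have "\<dots> = (\<Sum>i\<in>X. v $ i)" by (subst sum.inter_restrict[symmetric]) simp_all
  finally show ?thesis .
qed

lemma inner_char_vec_char_vec: "inner (char_vec X) (char_vec Y) = real (card (X \<inter> Y))"
  unfolding inner_char_vec by (simp add: char_vec_def sum.If_cases)

lemma transpose_mult_eq_sum: "transpose M *v y = (\<Sum>i\<in>UNIV. y $ i *\<^sub>R M $ i)"
  by (simp add: vec_eq_iff matrix_vector_mult_def transpose_def mult.commute)

lemma im_transpose_eq_span: "im_transpose M = span (range (\<lambda>i. M $ i))"
proof
  show "im_transpose M \<subseteq> span (range (\<lambda>i. M $ i))"
    unfolding im_transpose_def transpose_mult_eq_sum
    by (auto intro!: span_sum span_scale intro: span_base)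
  have "subspace (im_transpose M)"
    unfolding im_transpose_def
    by (rule linear_subspace_image[OF matrix_vector_mul_linear subspace_UNIV])
  moreover have "M $ i \<in> im_transpose M" for i
  proof -
    have "transpose M *v axis i 1 = (\<Sum>j\<in>UNIV. if j = i then M $ i else 0)"
      unfolding transpose_mult_eq_sum by (intro sum.cong) (auto simp: axis_def)
    then have "transpose M *v axis i 1 = M $ i" by simp
    then show ?thesis unfolding im_transpose_def by (metis rangeI)
  qed
  ultimately show "span (range (\<lambda>i. M $ i)) \<subseteq> im_transpose M" by (intro span_minimal) auto
qed

lemma rel_matrix_row:
  "rel_matrix X Y R $ i = (if i \<in> X then char_vec {j \<in> Y. R i j} else 0)"
  by (auto simp: rel_matrix_def char_vec_def vec_eq_iff)

lemma im_transpose_rel_matrix: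
  "im_transpose (rel_matrix X Y R) = span ((\<lambda>i. char_vec {j \<in> Y. R i j}) ` X)"
proof -
  let ?S = "(\<lambda>i. char_vec {j \<in> Y. R i j}) ` X"
  have "range (\<lambda>i. rel_matrix X Y R $ i) \<subseteq> insert 0 ?S" by (auto simp: rel_matrix_row)
  then have "span (range (\<lambda>i. rel_matrix X Y R $ i)) \<subseteq> span ?S"
    using span_mono span_insert_0 by metis
  moreover have "?S \<subseteq> range (\<lambda>i. rel_matrix X Y R $ i)"
  proof
    fix x assume "x \<in> ?S"
    then obtain i where "i \<in> X" "x = char_vec {j \<in> Y. R i j}" by auto
    then have "x = rel_matrix X Y R $ i" by (simp add: rel_matrix_row)
    then show "x \<in> range (\<lambda>i. rel_matrix X Y R $ i)" by blast
  qed
  ultimately show ?thesis unfolding im_transpose_eq_span by (auto dest: span_mono)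
qed

section \<open>The flag of the dual polar scheme\<close>

definition star :: "('a::{field,finite}, 'm::finite) space set \<Rightarrow> ('a, 'm) rvec" where
  "star U = char_vec {\<sigma> \<in> generators. U \<subseteq> \<sigma>}"

text \<open>The index is shifted by one: for k at most d, \<open>flag (Suc k)\<close> is the image
  of the transposed k-th incidence matrix, and the chain starts at zero. Admitting all smaller
  dimensions makes it increasing by construction; that the top dimension alone spans is shown
  afterwards.\<close>

definition flag :: "nat \<Rightarrow> ('a::{field,finite}, 'm::finite) rvec set" where
  "flag k = span (\<Union>j<k. star ` singular_subspaces_dim j)"

lemma subspace_flag: "subspace (flag k)"
  by (simp add: flag_def)

lemma flag_0: "flag 0 = {0}"
  by (simp add: flag_def)

lemma flag_Suc_mono: "flag k \<subseteq> flag (Suc k)"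
  unfolding flag_def by (intro span_mono UN_mono) auto

lemma star_in_flag: "U \<in> singular_subspaces \<Longrightarrow> vec.dim U < k \<Longrightarrow> star U \<in> flag k"
  unfolding flag_def by (intro span_base) (auto simp: singular_subspaces_dim_def)

lemma star_component: "star U $ \<sigma> = (if \<sigma> \<in> generators \<and> U \<subseteq> \<sigma> then 1 else 0)"
  by (simp add: star_def char_vec_def)

lemma singular_subspaces_dimD:
  assumes "U \<in> singular_subspaces_dim k"
  shows "U \<in> singular_subspaces" "vec.dim U = k" "vec.subspace U"
  using assms by (auto simp: singular_subspaces_dim_def singular_subspaces_def)

text \<open>A generator through W contains [d - j] covers of W, and a generator not through W
  contains none.\<close>

lemma sum_star_covers:
  fixes W :: "('a::{field,finite}, 'm::finite) space set"
  assumes W: "W \<in> singular_subspaces_dim j"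
  shows "(\<Sum>U | U \<in> singular_subspaces_dim (Suc j) \<and> W \<subseteq> U. star U)
           = real (qint CARD('a) (CARD('m) - j)) *\<^sub>R star W" (is "?L = ?R")
proof -
  have "?L $ \<sigma> = ?R $ \<sigma>" for \<sigma>
  proof -
    let ?S = "{U \<in> singular_subspaces_dim (Suc j). W \<subseteq> U}"
    have "?L $ \<sigma> = (\<Sum>U\<in>?S. if \<sigma> \<in> generators \<and> U \<subseteq> \<sigma> then 1 else 0)"
      by (simp add: star_component)
    also have "\<dots> = real (card {U \<in> ?S. \<sigma> \<in> generators \<and> U \<subseteq> \<sigma>})"
      by (simp add: sum.If_cases Int_def)
    also have "\<dots> = ?R $ \<sigma>"
    proof (cases "\<sigma> \<in> generators \<and> W \<subseteq> \<sigma>")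
      case True
      then have \<sigma>: "\<sigma> \<in> generators" "W \<subseteq> \<sigma>" by auto
      have "{U \<in> ?S. \<sigma> \<in> generators \<and> U \<subseteq> \<sigma>} = {T. vec.subspace T \<and> W \<subseteq> T \<and> T \<subseteq> \<sigma> \<and> vec.dim T = vec.dim W + 1}"
        using \<sigma> singular_mono[OF generatorsD(1)[OF \<sigma>(1)]] singular_subspaces_dimD(2)[OF W]
        by (auto simp: singular_subspaces_dim_def singular_subspacesD(1))
      then show ?thesis
        using card_covers_between[OF singular_subspaces_dimD(3)[OF W] generatorsD(2)[OF \<sigma>(1)] \<sigma>(2)] \<sigma>
          generatorsD(3)[OF \<sigma>(1)] singular_subspaces_dimD(2)[OF W]
        by (simp add: star_component)
    next
      case False
      then have "{U \<in> ?S. \<sigma> \<in> generators \<and> U \<subseteq> \<sigma>} = {}" by blast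
      then show ?thesis using False by (simp only: card.empty) (auto simp: star_component)
    qed
    finally show ?thesis .
  qed
  then show ?thesis by (simp add: vec_eq_iff)
qed

text \<open>Below dimension d the coefficient [d - k] is nonzero, so a star can be solved for in
  terms of the stars one dimension higher.\<close>

lemma star_in_span_larger:
  fixes W :: "('a::{field,finite}, 'm::finite) space set"
  assumes "W \<in> singular_subspaces_dim j" "j \<le> k" "k \<le> CARD('m)"
  shows "star W \<in> span (star ` singular_subspaces_dim k)"
  using assms(2,3)
proof (induction k rule: dec_induct)
  case base
  then show ?case using assms(1) by (intro span_base) auto
next
  case (step k)
  have "span (star ` singular_subspaces_dim k) \<subseteq> span (star ` (singular_subspaces_dim (Suc k) :: ('a, 'm) space set set))"
  proof (rule span_minimal, rule image_subsetI)
    fix W :: "('a, 'm) space set" assume W: "W \<in> singular_subspaces_dim k"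
    let ?n = "real (qint CARD('a) (CARD('m) - k))"
    have "0 < qint CARD('a) (CARD('m) - k)"
      using step.prems by (cases "CARD('m) - k") (auto simp: qint_Suc)
    then have "?n \<noteq> 0" by simp
    then have "star W = (1 / ?n) *\<^sub>R (\<Sum>U | U \<in> singular_subspaces_dim (Suc k) \<and> W \<subseteq> U. star U)"
      unfolding sum_star_covers[OF W] by simp
    also have "\<dots> \<in> span (star ` singular_subspaces_dim (Suc k))"
      by (intro span_scale span_sum span_base) auto
    finally show "star W \<in> span (star ` singular_subspaces_dim (Suc k))" .
  qed simp
  then show ?case using step by auto
qed

lemma im_incidence_matrix:
  assumes "k \<le> CARD('m)"
  shows "im_transpose (incidence_matrix k :: ('a::{field,finite}, 'm::finite) rmat) = flag (Suc k)"
proof -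
  have "im_transpose (incidence_matrix k :: ('a, 'm) rmat) = span (star ` singular_subspaces_dim k)"
    unfolding incidence_matrix_def im_transpose_rel_matrix star_def ..
  also have "\<dots> = flag (Suc k)"
  proof
    show "span (star ` singular_subspaces_dim k) \<subseteq> (flag (Suc k) :: ('a, 'm) rvec set)"
      unfolding flag_def by (intro span_mono) auto
    show "(flag (Suc k) :: ('a, 'm) rvec set) \<subseteq> span (star ` singular_subspaces_dim k)"
      unfolding flag_def using star_in_span_larger assms by (intro span_minimal) (auto simp: less_Suc_eq_le)
  qed
  finally show ?thesis .
qed

text \<open>A generator lies in no other generator, so its star is a unit vector.\<close>

lemma flag_top: "flag (Suc CARD('m)) = supported (generators :: ('a::{field,finite}, 'm::finite) space set set)"
proof
  show "flag (Suc CARD('m)) \<subseteq> supported (generators :: ('a, 'm) space set set)"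
    unfolding flag_def
    by (intro span_minimal subspace_supported) (auto simp: star_def intro!: char_vec_supported)
  show "supported (generators :: ('a, 'm) space set set) \<subseteq> flag (Suc CARD('m))"
  proof
    fix v :: "('a, 'm) rvec" assume v: "v \<in> supported generators"
    have "v = (\<Sum>\<sigma>\<in>generators. v $ \<sigma> *\<^sub>R star \<sigma>)"
    proof (subst vec_eq_iff, rule allI)
      fix \<tau>
      have "(\<Sum>\<sigma>\<in>generators. v $ \<sigma> *\<^sub>R star \<sigma>) $ \<tau> = (\<Sum>\<sigma>\<in>generators. if \<sigma> = \<tau> then v $ \<tau> else 0)"
        unfolding sum_component
      proof (rule sum.cong[OF refl])
        fix \<sigma> :: "('a, 'm) space set" assume "\<sigma> \<in> generators"
        then have "\<tau> \<in> generators \<and> \<sigma> \<subseteq> \<tau> \<longleftrightarrow> \<sigma> = \<tau>" using generator_eqI by blast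
        then show "(v $ \<sigma> *\<^sub>R star \<sigma>) $ \<tau> = (if \<sigma> = \<tau> then v $ \<tau> else 0)" by (simp add: star_component)
      qed
      also have "\<dots> = v $ \<tau>" using v by (auto simp: supported_def)
      finally show "v $ \<tau> = (\<Sum>\<sigma>\<in>generators. v $ \<sigma> *\<^sub>R star \<sigma>) $ \<tau>" by simp
    qed
    also have "\<dots> \<in> flag (Suc CARD('m))"
      using generatorsD(1,3)[where 'a = 'a and 'm = 'm]
      by (intro subspace_sum subspace_scale subspace_flag star_in_flag) auto
    finally show "v \<in> flag (Suc CARD('m))" .
  qed
qed

text \<open>The known eigenvalues of the dual polar graph of type D_d. The first term counts the
  neighbours of a generator through a k-space contained in it; the second stems from the [k]
  hyperplanes of the k-space.\<close>

definition dual_polar_eigenvalue :: "nat \<Rightarrow> nat \<Rightarrow> nat \<Rightarrow> real" where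
  "dual_polar_eigenvalue q d k = real (qint q (d - k)) - real (qint q k)"

lemma dual_polar_eigenvalue_strict_antimono:
  assumes "q \<ge> 1" "j < k" "k \<le> d"
  shows "dual_polar_eigenvalue q d k < dual_polar_eigenvalue q d j"
proof -
  have "qint q j < qint q k" "qint q (d - k) < qint q (d - j)"
    using assms by (auto intro: qint_strict_mono)
  then show ?thesis by (simp add: dual_polar_eigenvalue_def)
qed

lemma dual_polar_eigenvalue_inj:
  assumes "q \<ge> 1"
  shows "inj_on (dual_polar_eigenvalue q d) {..<Suc d}"
proof (rule linorder_inj_onI')
  fix i j assume "i \<in> {..<Suc d}" "j \<in> {..<Suc d}" "i < j"
  then show "dual_polar_eigenvalue q d i \<noteq> dual_polar_eigenvalue q d j"
    using dual_polar_eigenvalue_strict_antimono[OF assms, of i j d] by auto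
qed

lemma dual_polar_rel:
  "vec.dim (\<pi> \<inter> \<sigma>) = CARD('m::finite) - 1 \<longleftrightarrow> vec.dim (\<pi> \<inter> \<sigma>) + 1 = CARD('m)"
  using zero_less_card_finite[where 'a = 'm] by linarith

text \<open>A neighbour \<open>\<sigma>\<close> of \<open>\<pi>\<close> containing \<open>U\<close> corresponds to the hyperplane \<open>\<sigma> \<inter> \<pi>\<close> of \<open>\<pi>\<close> if \<open>U \<subseteq> \<pi>\<close>,
  and is the generator joining \<open>U\<close> to \<open>\<pi>\<close> if \<open>U \<inter> \<pi>\<close> is a hyperplane of \<open>U\<close>.\<close>

lemma card_neighbours_above:
  fixes U \<pi> :: "('a::{field,finite}, 'm::finite) space set"
  assumes U: "U \<in> singular_subspaces" and \<pi>: "\<pi> \<in> generators"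
  shows "card {\<sigma> \<in> generators. U \<subseteq> \<sigma> \<and> vec.dim (\<pi> \<inter> \<sigma>) = CARD('m) - 1}
    = (if U \<subseteq> \<pi> then qint CARD('a) (CARD('m) - vec.dim U)
       else if vec.dim U = vec.dim (U \<inter> \<pi>) + 1 then 1 else 0)" (is "card ?A = _")
proof -
  note sU = singular_subspacesD(1)[OF U] and s\<pi> = generatorsD(2)[OF \<pi>]
  have AD: "\<sigma> \<in> generators" "U \<subseteq> \<sigma>" "vec.dim (\<sigma> \<inter> \<pi>) + 1 = CARD('m)" "vec.subspace (\<sigma> \<inter> \<pi>)" if "\<sigma> \<in> ?A" for \<sigma>
    using that dual_polar_rel[where 'm = 'm, of \<pi> \<sigma>] vec.subspace_inter[OF generatorsD(2) s\<pi>, of \<sigma>]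
    unfolding Int_commute[of \<sigma>] by simp_all
  show ?thesis
  proof (cases "U \<subseteq> \<pi>")
    case True
    let ?B = "{H. vec.subspace H \<and> U \<subseteq> H \<and> H \<subseteq> \<pi> \<and> vec.dim \<pi> = vec.dim H + 1}"
    have "(\<Sum>\<sigma>\<in>?A. card {H \<in> ?B. H \<subseteq> \<sigma>}) = 1 * card ?B"
    proof (rule sum_multicount[OF finite finite], rule ballI)
      fix H assume "H \<in> ?B"
      then have H: "vec.subspace H" "U \<subseteq> H" "H \<subseteq> \<pi>" "vec.dim H + 1 = CARD('m)"
        using generatorsD(3)[OF \<pi>] by auto
      have HS: "H \<in> singular_subspaces" using singular_mono[OF generatorsD(1)[OF \<pi>] H(3,1)] .
      obtain \<tau> where \<tau>: "\<tau> \<in> generators" "H \<subseteq> \<tau>" "\<tau> \<noteq> \<pi>"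
        and eq: "{\<rho> \<in> generators. H \<subseteq> \<rho>} = {\<pi>, \<tau>}"
        by (rule other_generatorE[OF \<pi> H(1,3,4)])
      have "vec.dim (\<pi> \<inter> \<pi>) + vec.dim (\<tau> \<inter> \<pi>) = 2 * vec.dim (H \<inter> \<pi>) + 1"
        using dim_other_generator[OF \<pi> HS H(4) \<pi> H(3) \<tau>(1,2)] \<tau>(3) by simp
      moreover have "H \<inter> \<pi> = H" using H by blast
      ultimately have "vec.dim (\<pi> \<inter> \<tau>) + 1 = CARD('m)"
        using H(4) generatorsD(3)[OF \<pi>] by (simp add: Int_commute)
      then have "\<tau> \<in> {\<sigma> \<in> ?A. H \<subseteq> \<sigma>}" using \<tau> H by auto
      moreover have "\<pi> \<notin> ?A"
        using generatorsD(3)[OF \<pi>] dual_polar_rel[where 'm = 'm, of \<pi> \<pi>] by auto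
      moreover have "{\<sigma> \<in> ?A. H \<subseteq> \<sigma>} \<subseteq> {\<pi>, \<tau>}" unfolding eq[symmetric] by blast
      ultimately have "{\<sigma> \<in> ?A. H \<subseteq> \<sigma>} = {\<tau>}" by blast
      then show "card {\<sigma> \<in> ?A. H \<subseteq> \<sigma>} = 1" by simp
    qed
    moreover have "card {H \<in> ?B. H \<subseteq> \<sigma>} = 1" if "\<sigma> \<in> ?A" for \<sigma>
    proof -
      note \<sigma> = AD[OF that]
      have "H = \<sigma> \<inter> \<pi>" if "H \<in> {H \<in> ?B. H \<subseteq> \<sigma>}" for H
        using that \<sigma> generatorsD(3)[OF \<pi>] by (intro subspace_eqI_dim) auto
      moreover have "\<sigma> \<inter> \<pi> \<in> {H \<in> ?B. H \<subseteq> \<sigma>}" using \<sigma> True generatorsD(3)[OF \<pi>] by auto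
      ultimately have "{H \<in> ?B. H \<subseteq> \<sigma>} = {\<sigma> \<inter> \<pi>}" by blast
      then show ?thesis by simp
    qed
    ultimately have "card ?A = card ?B" by simp
    then show ?thesis using True card_hyperplanes_above[OF s\<pi> sU True] generatorsD(3)[OF \<pi>] by simp
  next
    case False
    have sI: "vec.subspace (U \<inter> \<pi>)" using sU s\<pi> by (rule vec.subspace_inter)
    have lt: "vec.dim (U \<inter> \<pi>) < vec.dim U" using False by (intro dim_psubset_subspace sI sU) auto
    have J: "vec.dim U = vec.dim (U \<inter> \<pi>) + 1 \<and> \<sigma> = join_proj U \<pi>" if "\<sigma> \<in> ?A" for \<sigma>
    proof -
      note \<sigma> = AD[OF that]
      \<comment> \<open>\<sigma> lies in \<open>perp U\<close>, so
        \<open>\<sigma> \<inter> \<pi>\<close> has dimension at most d - dim U + dim (U \<inter>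
        \<pi>). For a neighbour this must reach d - 1, which forces \<open>U \<inter> \<pi>\<close>
        to be a hyperplane of U.\<close>
      have "vec.dim (\<sigma> \<inter> \<pi>) + vec.dim U \<le> CARD('m) + vec.dim (U \<inter> \<pi>)"
      proof -
        have "\<sigma> \<inter> \<pi> \<subseteq> perp U \<inter> \<pi>" using perp_antimono[OF \<sigma>(2)] perp_generator[OF \<sigma>(1)] by blast
        then have "vec.dim (\<sigma> \<inter> \<pi>) \<le> vec.dim (perp U \<inter> \<pi>)" by (rule vec.dim_subset)
        then show ?thesis using dim_perp_Int_generator[OF sU \<pi>] by linarith
      qed
      then have dU: "vec.dim U = vec.dim (U \<inter> \<pi>) + 1" using lt \<sigma>(3) by linarith
      have "\<sigma> \<inter> \<pi> \<subseteq> perp U \<inter> \<pi>" using perp_antimono[OF \<sigma>(2)] perp_generator[OF \<sigma>(1)] by blast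
      moreover have "vec.dim (perp U \<inter> \<pi>) \<le> vec.dim (\<sigma> \<inter> \<pi>)"
        using dim_perp_Int_generator[OF sU \<pi>] dU \<sigma>(3) by linarith
      ultimately have "\<sigma> \<inter> \<pi> = perp U \<inter> \<pi>"
        using \<sigma>(4) vec.subspace_inter[OF subspace_perp s\<pi>] by (intro subspace_eqI_dim)
      then have "join_proj U \<pi> \<subseteq> \<sigma>"
        unfolding join_proj_def using \<sigma>(2) generatorsD(2)[OF \<sigma>(1)] by (intro vec.span_minimal) auto
      then show ?thesis using dU generator_eqI[OF join_proj(1)[OF U \<pi>] \<sigma>(1)] by simp
    qed
    show ?thesis
    proof (cases "vec.dim U = vec.dim (U \<inter> \<pi>) + 1")
      case True
      have "vec.dim (join_proj U \<pi> \<inter> \<pi>) + 1 = CARD('m)"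
        unfolding join_proj(3)[OF U \<pi>] using dim_perp_Int_generator[OF sU \<pi>] True by linarith
      then have "join_proj U \<pi> \<in> ?A" using join_proj[OF U \<pi>] by (simp add: Int_commute)
      then have "?A = {join_proj U \<pi>}" using J by blast
      then show ?thesis using True False by simp
    next
      case F2: False
      then have "?A = {}" using J by blast
      then show ?thesis using F2 False by (simp only: card.empty if_False)
    qed
  qed
qed

text \<open>The stars of dimension exactly k span \<open>flag (Suc k)\<close>, and the vectors
  satisfying the claim form a subspace, so it is enough to check stars.\<close>

lemma flag_Suc_minus:
  fixes T :: "('a::{field,finite}, 'm::finite) rvec \<Rightarrow> ('a, 'm) rvec"
  assumes "linear T"
    and gen: "\<And>U. U \<in> singular_subspaces \<Longrightarrow> T (star U) - \<theta> (vec.dim U) *\<^sub>R star U \<in> flag (vec.dim U)"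
    and v: "v \<in> flag (Suc k)" and k: "k \<le> CARD('m)"
  shows "T v - \<theta> k *\<^sub>R v \<in> flag k"
proof -
  have "v \<in> span (star ` singular_subspaces_dim k)"
    using v im_incidence_matrix[OF k, where 'a = 'a]
    unfolding incidence_matrix_def im_transpose_rel_matrix star_def[symmetric] by simp
  moreover have "span (star ` singular_subspaces_dim k) \<subseteq> {x. T x - \<theta> k *\<^sub>R x \<in> flag k}"
  proof (rule span_minimal)
    show "star ` singular_subspaces_dim k \<subseteq> {x. T x - \<theta> k *\<^sub>R x \<in> flag k}"
    proof (rule image_subsetI)
      fix U :: "('a, 'm) space set" assume U: "U \<in> singular_subspaces_dim k"
      then show "star U \<in> {x. T x - \<theta> k *\<^sub>R x \<in> flag k}"
        using gen[OF singular_subspaces_dimD(1)[OF U]] singular_subspaces_dimD(2)[OF U] by simp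
    qed
  next
    show "subspace {x. T x - \<theta> k *\<^sub>R x \<in> flag k}"
    proof (rule subspaceI; clarsimp)
      show "T 0 \<in> flag k" using linear_0[OF assms(1)] subspace_0[OF subspace_flag] by simp
      fix x y assume "T x - \<theta> k *\<^sub>R x \<in> flag k" "T y - \<theta> k *\<^sub>R y \<in> flag k"
      from subspace_add[OF subspace_flag this]
      show "T (x + y) - \<theta> k *\<^sub>R (x + y) \<in> flag k"
        by (simp add: linear_add[OF assms(1)] scaleR_right_distrib algebra_simps)
    next
      fix c x assume "T x - \<theta> k *\<^sub>R x \<in> flag k"
      from subspace_scale[OF subspace_flag this, of c]
      show "T (c *\<^sub>R x) - (\<theta> k * c) *\<^sub>R x \<in> flag k"
        by (simp add: linear_scale[OF assms(1)] scaleR_right_diff_distrib mult.commute)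
    qed
  qed
  ultimately show ?thesis by blast
qed

section \<open>The adjacency and disjointness matrices on the flag\<close>

text \<open>\<open>meets U U\<close> is \<open>star U\<close>; the vectors with smaller P refine the
  star and carry the Moebius inversion.\<close>

definition meets :: "('a::{field,finite}, 'm::finite) space set \<Rightarrow> ('a, 'm) space set \<Rightarrow> ('a, 'm) rvec" where
  "meets P U = char_vec {\<sigma> \<in> generators. U \<inter> \<sigma> = P}"

lemma meets_component: "meets P U $ \<sigma> = (if \<sigma> \<in> generators \<and> U \<inter> \<sigma> = P then 1 else 0)"
  by (simp add: meets_def char_vec_def)

text \<open>A generator meets H in P if and only if it meets U in P or in a cover of P outside H.
  This one-step recursion replaces a summation over the whole interval.\<close>

lemma meets_hyperplane:
  fixes U :: "('a::{field,finite}, 'm::finite) space set"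
  assumes sU: "vec.subspace U" and sH: "vec.subspace H" and sP: "vec.subspace P"
    and PH: "P \<subseteq> H" "H \<subseteq> U" and dH: "vec.dim U = vec.dim H + 1"
  shows "meets P U = meets P H
    - (\<Sum>Q | vec.subspace Q \<and> P \<subseteq> Q \<and> Q \<subseteq> U \<and> vec.dim Q = vec.dim P + 1 \<and> \<not> Q \<subseteq> H. meets Q U)"
    (is "_ = _ - (\<Sum>Q\<in>?Q. _)")
proof -
  have "meets P U $ \<sigma> = (meets P H - (\<Sum>Q\<in>?Q. meets Q U)) $ \<sigma>" for \<sigma>
  proof (cases "\<sigma> \<in> generators")
    case False
    then show ?thesis by (simp add: meets_component)
  next
    case True
    note s\<sigma> = generatorsD(2)[OF True]
    have sI: "vec.subspace (U \<inter> \<sigma>)" using sU s\<sigma> by (rule vec.subspace_inter)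
    have "(\<Sum>Q\<in>?Q. meets Q U) $ \<sigma> = (\<Sum>Q\<in>?Q. if U \<inter> \<sigma> = Q then 1 else 0)"
      using True by (simp add: meets_component)
    also have "\<dots> = (if U \<inter> \<sigma> \<in> ?Q then 1 else 0)" by (simp del: mem_Collect_eq)
    finally have S: "(\<Sum>Q\<in>?Q. meets Q U) $ \<sigma> = (if U \<inter> \<sigma> \<in> ?Q then 1 else 0)" .
    have HI: "H \<inter> (U \<inter> \<sigma>) = H \<inter> \<sigma>" using PH by blast
    have 1: "U \<inter> \<sigma> = P \<or> U \<inter> \<sigma> \<in> ?Q" if H: "H \<inter> \<sigma> = P"
    proof (cases "U \<inter> \<sigma> \<subseteq> H")
      case True
      then have "U \<inter> \<sigma> = H \<inter> \<sigma>" using PH by blast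
      then show ?thesis using H by simp
    next
      case False
      have "vec.dim (U \<inter> \<sigma>) \<le> vec.dim (H \<inter> \<sigma>) + 1"
        by (rule dim_le_Int_hyperplane[OF sU sH s\<sigma> PH(2) dH])
      moreover have "vec.dim (P) < vec.dim (U \<inter> \<sigma>)"
        using False H PH by (intro dim_psubset_subspace sP sI) auto
      moreover have "P \<subseteq> U \<inter> \<sigma>" using H PH by blast
      ultimately show ?thesis using False H sI by auto
    qed
    have 2: "H \<inter> \<sigma> = P" if "U \<inter> \<sigma> = P"
      using that PH by blast
    have 3: "H \<inter> \<sigma> = P" if Q: "U \<inter> \<sigma> \<in> ?Q"
    proof -
      have sHI: "vec.subspace (H \<inter> \<sigma>)" using sH s\<sigma> by (rule vec.subspace_inter)
      have "H \<inter> \<sigma> \<subset> U \<inter> \<sigma>" using Q PH by blast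
      then have "vec.dim (H \<inter> \<sigma>) < vec.dim (U \<inter> \<sigma>)" by (rule dim_psubset_subspace[OF sHI sI])
      moreover have "P \<subseteq> H \<inter> \<sigma>" using Q PH by blast
      ultimately show ?thesis using Q by (intro subspace_eqI_dim[symmetric] sP sHI) auto
    qed
    have 4: "U \<inter> \<sigma> \<notin> ?Q" if "U \<inter> \<sigma> = P" unfolding that by simp
    show ?thesis
      using 1 2 3 4 True S by (auto simp: meets_component simp del: mem_Collect_eq)
  qed
  then show ?thesis by (simp add: vec_eq_iff)
qed

text \<open>The coefficient is the Moebius function of the interval \<open>[P, U]\<close>.\<close>

lemma meets_minus_star_in_flag:
  fixes U :: "('a::{field,finite}, 'm::finite) space set"
  assumes "U \<in> singular_subspaces" "vec.subspace P" "P \<subseteq> U"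
  shows "meets P U - ((-1) ^ (vec.dim U - vec.dim P) * real CARD('a) ^ ((vec.dim U - vec.dim P) choose 2)) *\<^sub>R star U
    \<in> flag (vec.dim U)"
  using assms
proof (induction "vec.dim U - vec.dim P" arbitrary: P U)
  case 0
  have "P = U" using 0 singular_subspacesD(1)[of U] by (intro subspace_eqI_dim) auto
  then have "meets P U = star U"
    by (auto simp: meets_def star_def intro!: arg_cong[of _ _ char_vec])
  then show ?case using \<open>P = U\<close> subspace_0[OF subspace_flag] by (simp add: numeral_2_eq_2)
next
  case (Suc k)
  let ?q = "CARD('a)"
  note U = Suc.prems(1) and sP = Suc.prems(2) and PU = Suc.prems(3)
  note sU = singular_subspacesD(1)[OF U]
  have "P \<noteq> U" using Suc.hyps(2) by auto
  then obtain H where H: "vec.subspace H" "P \<subseteq> H" "H \<subseteq> U" "vec.dim U = vec.dim H + 1"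
    using ex_hyperplane_between[OF sP sU] PU by blast
  have HS: "H \<in> singular_subspaces" using singular_mono[OF U H(3,1)] .
  have kH: "k = vec.dim H - vec.dim P" and pH: "vec.dim P \<le> vec.dim H"
    using Suc.hyps(2) H(4) vec.dim_subset[OF H(2)] by auto
  let ?Q = "{Q. vec.subspace Q \<and> P \<subseteq> Q \<and> Q \<subseteq> U \<and> vec.dim Q = vec.dim P + 1 \<and> \<not> Q \<subseteq> H}"
  let ?c = "(-1) ^ k * real ?q ^ (k choose 2)"
  \<comment> \<open>The covers of P inside U but not inside H number [k + 1] - [k] = q^k.\<close>
  have cQ: "card ?Q = ?q ^ k"
  proof -
    let ?A = "{Q. vec.subspace Q \<and> P \<subseteq> Q \<and> Q \<subseteq> U \<and> vec.dim Q = vec.dim P + 1}"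
    let ?B = "{Q. vec.subspace Q \<and> P \<subseteq> Q \<and> Q \<subseteq> H \<and> vec.dim Q = vec.dim P + 1}"
    have "?Q = ?A - ?B" by blast
    moreover have "card (?A - ?B) = card ?A - card ?B"
      using H(3) by (intro card_Diff_subset) auto
    ultimately show ?thesis
      using card_covers_between[OF sP sU PU] card_covers_between[OF sP H(1,2)] Suc.hyps(2) kH
      by (simp add: qint_Suc flip: Suc.hyps(2))
  qed
  have fH: "meets P H \<in> flag (vec.dim U)"
  proof -
    have "meets P H - ?c *\<^sub>R star H \<in> flag (vec.dim U)"
      using Suc.hyps(1)[OF kH HS sP H(2)] flag_Suc_mono[of "vec.dim H"] kH H(4) by auto
    moreover have "?c *\<^sub>R star H \<in> flag (vec.dim U)"
      using HS H(4) by (intro subspace_scale subspace_flag star_in_flag) auto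
    ultimately have "meets P H - ?c *\<^sub>R star H + ?c *\<^sub>R star H \<in> flag (vec.dim U)"
      by (rule subspace_add[OF subspace_flag])
    then show ?thesis by simp
  qed
  \<comment> \<open>All intervals [Q, U] have length k and contribute the same coefficient, while
    the star of H lies in the smaller flag because dim H < dim U. So the coefficient for length k +
    1 is -q^k times the one for length k.\<close>
  have fQ: "meets Q U - ?c *\<^sub>R star U \<in> flag (vec.dim U)" if "Q \<in> ?Q" for Q
  proof -
    have k: "k = vec.dim U - vec.dim Q" using that Suc.hyps(2) by auto
    show ?thesis using Suc.hyps(1)[OF k U] that k by auto
  qed
  have "(\<Sum>Q\<in>?Q. meets Q U - ?c *\<^sub>R star U) \<in> flag (vec.dim U)"
    using fQ by (intro subspace_sum subspace_flag) auto
  then have "meets P H - (\<Sum>Q\<in>?Q. meets Q U - ?c *\<^sub>R star U) \<in> flag (vec.dim U)"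
    by (rule subspace_diff[OF subspace_flag fH])
  also have "meets P H - (\<Sum>Q\<in>?Q. meets Q U - ?c *\<^sub>R star U)
      = meets P U + (real ?q ^ k * ?c) *\<^sub>R star U"
    unfolding meets_hyperplane[OF sU H(1) sP H(2,3,4)] sum_subtractf sum_constant_scaleR cQ by simp
  also have "real ?q ^ k * ?c = - ((-1) ^ Suc k * real ?q ^ (Suc k choose 2))"
    by (simp add: numeral_2_eq_2 power_add)
  finally show ?case by (simp flip: Suc.hyps(2))
qed

text \<open>The entry at \<pi> is the number of neighbours of \<pi> through U. The first term
  accounts for U \<subseteq> \<pi>, and the sum is 1 exactly when \<open>U \<inter> \<pi>\<close> is
  a hyperplane of U.\<close>

lemma dual_polar_matrix_star:
  fixes U :: "('a::{field,finite}, 'm::finite) space set"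
  assumes U: "U \<in> singular_subspaces"
  shows "dual_polar_matrix *v star U = real (qint CARD('a) (CARD('m) - vec.dim U)) *\<^sub>R star U
    + (\<Sum>W | vec.subspace W \<and> {0} \<subseteq> W \<and> W \<subseteq> U \<and> vec.dim U = vec.dim W + 1. meets W U)" (is "?L = ?R + (\<Sum>W\<in>?S. _)")
proof -
  have "?L $ \<pi> = (?R + (\<Sum>W\<in>?S. meets W U)) $ \<pi>" for \<pi>
  proof (cases "\<pi> \<in> generators")
    case False
    then show ?thesis by (simp add: dual_polar_matrix_def star_component meets_component rel_matrix_mult_component)
  next
    case True
    have sI: "vec.subspace (U \<inter> \<pi>)"
      using singular_subspacesD(1)[OF U] generatorsD(2)[OF True] by (rule vec.subspace_inter)
    have "(\<Sum>W\<in>?S. meets W U) $ \<pi> = (\<Sum>W\<in>?S. if U \<inter> \<pi> = W then 1 else 0)"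
      using True by (simp add: meets_component)
    also have "\<dots> = (if U \<inter> \<pi> \<in> ?S then 1 else 0)" by (simp del: mem_Collect_eq)
    finally have S: "(\<Sum>W\<in>?S. meets W U) $ \<pi> = (if vec.dim U = vec.dim (U \<inter> \<pi>) + 1 then 1 else 0)"
      using sI vec.subspace_0[OF sI] by simp
    have "?L $ \<pi> = real (card {\<sigma> \<in> generators. U \<subseteq> \<sigma> \<and> vec.dim (\<pi> \<inter> \<sigma>) = CARD('m) - 1})"
      unfolding dual_polar_matrix_def star_def using True
      by (subst rel_matrix_mult_char_vec) (auto simp: conj_assoc)
    moreover have "vec.dim U \<noteq> vec.dim (U \<inter> \<pi>) + 1" if "U \<subseteq> \<pi>" using that by (simp add: Int_absorb2)
    ultimately show ?thesis
      unfolding card_neighbours_above[OF U True] vector_add_component S using True by (simp add: star_component)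
  qed
  then show ?thesis by (simp add: vec_eq_iff)
qed

text \<open>For a hyperplane W of U the Moebius coefficient is -1, so each of the [k] hyperplanes, k
  = dim U, contributes -star U modulo the smaller flag.\<close>

lemma dual_polar_matrix_star_flag:
  fixes U :: "('a::{field,finite}, 'm::finite) space set"
  assumes U: "U \<in> singular_subspaces"
  shows "dual_polar_matrix *v star U - dual_polar_eigenvalue CARD('a) CARD('m) (vec.dim U) *\<^sub>R star U
    \<in> flag (vec.dim U)"
proof -
  let ?S = "{W. vec.subspace W \<and> {0} \<subseteq> W \<and> W \<subseteq> U \<and> vec.dim U = vec.dim W + 1}"
  note sU = singular_subspacesD(1)[OF U]
  have "meets W U + star U \<in> flag (vec.dim U)" if "W \<in> ?S" for W
    using meets_minus_star_in_flag[OF U, of W] that by (simp add: numeral_2_eq_2)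
  then have "(\<Sum>W\<in>?S. meets W U + star U) \<in> flag (vec.dim U)" by (intro subspace_sum subspace_flag) auto
  moreover have "card ?S = qint CARD('a) (vec.dim U)"
    using card_hyperplanes_above[OF sU, of "{0}"] vec.subspace_0[OF sU] by (simp add: vec.subspace_0)
  then have "(\<Sum>W\<in>?S. meets W U + star U) = (\<Sum>W\<in>?S. meets W U) + real (qint CARD('a) (vec.dim U)) *\<^sub>R star U"
    by (simp only: sum.distrib sum_constant_scaleR)
  ultimately show ?thesis
    unfolding dual_polar_matrix_star[OF U] by (simp add: dual_polar_eigenvalue_def algebra_simps)
qed

text \<open>A generator through U can be disjoint from \<pi> only if U is, and then the number of
  such generators does not depend on \<pi>.\<close>

lemma disjointness_matrix_star:
  fixes U :: "('a::{field,finite}, 'm::finite) space set"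
  assumes U: "U \<in> singular_subspaces"
  shows "disjointness_matrix generators *v star U
    = (real CARD('a) ^ ((CARD('m) - vec.dim U) choose 2)) *\<^sub>R meets {0} U" (is "?L = ?R")
proof -
  have "?L $ \<pi> = ?R $ \<pi>" for \<pi>
  proof (cases "\<pi> \<in> generators")
    case False
    then show ?thesis by (simp add: disjointness_matrix_def meets_component rel_matrix_mult_component)
  next
    case True
    have "?L $ \<pi> = real (card {\<sigma> \<in> {\<sigma> \<in> generators. U \<subseteq> \<sigma>}. \<pi> \<inter> \<sigma> = {0}})"
      unfolding disjointness_matrix_def star_def using True
      by (subst rel_matrix_mult_char_vec) auto
    also have "{\<sigma> \<in> {\<sigma> \<in> generators. U \<subseteq> \<sigma>}. \<pi> \<inter> \<sigma> = {0}}
       = (if U \<inter> \<pi> = {0} then {\<sigma> \<in> generators. U \<subseteq> \<sigma> \<and> \<sigma> \<inter> \<pi> = U \<inter> \<pi>} else {})"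
    proof (cases "U \<inter> \<pi> = {0}")
      case True
      then show ?thesis by (auto simp: Int_commute)
    next
      case False
      have "0 \<in> U \<inter> \<pi>" using singular_subspacesD(1)[OF U] generatorsD(2)[OF True] by (simp add: vec.subspace_0)
      then show ?thesis using False by auto
    qed
    finally have L: "?L $ \<pi> = real (card (if U \<inter> \<pi> = {0} then {\<sigma> \<in> generators. U \<subseteq> \<sigma> \<and> \<sigma> \<inter> \<pi> = U \<inter> \<pi>} else {}))" .
    show ?thesis
    proof (cases "U \<inter> \<pi> = {0}")
      case 0: True
      show ?thesis
        unfolding L if_P[OF 0] card_generators_above_meeting[OF U True] using True 0 by (simp add: meets_component)
    next
      case False
      then show ?thesis unfolding L by (simp add: meets_component)
    qed
  qed
  then show ?thesis by (simp add: vec_eq_iff)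
qed

definition disjointness_eigenvalue :: "nat \<Rightarrow> nat \<Rightarrow> nat \<Rightarrow> real" where
  "disjointness_eigenvalue q d k = (-1) ^ k * real q ^ (((d - k) choose 2) + (k choose 2))"

lemma disjointness_matrix_star_flag:
  fixes U :: "('a::{field,finite}, 'm::finite) space set"
  assumes U: "U \<in> singular_subspaces"
  shows "disjointness_matrix generators *v star U - disjointness_eigenvalue CARD('a) CARD('m) (vec.dim U) *\<^sub>R star U
    \<in> flag (vec.dim U)"
proof -
  let ?N = "real CARD('a) ^ ((CARD('m) - vec.dim U) choose 2)"
  have "?N *\<^sub>R (meets {0} U - ((-1) ^ (vec.dim U - vec.dim {0 :: ('a, 'm) space})
      * real CARD('a) ^ ((vec.dim U - vec.dim {0 :: ('a, 'm) space}) choose 2)) *\<^sub>R star U) \<in> flag (vec.dim U)"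
    using singular_subspacesD(1)[OF U]
    by (intro subspace_scale subspace_flag meets_minus_star_in_flag U) (auto simp: vec.subspace_0)
  then show ?thesis
    unfolding disjointness_matrix_star[OF U]
    by (simp add: disjointness_eigenvalue_def scaleR_right_diff_distrib power_add mult_ac)
qed

text \<open>Absolute values leave an equation between exponents; doubled and moved to the integers
  it factors as (k - 1)(k - (d - 1)) = 0.\<close>

lemma disjointness_eigenvalue_eq_iff:
  assumes q: "2 \<le> q" and d: "2 \<le> d" "even d" and "k \<le> d"
    and eq: "disjointness_eigenvalue q d k = - (real q ^ ((d - 1) choose 2))"
  shows "k = 1 \<or> k = d - 1"
proof -
  have "\<bar>disjointness_eigenvalue q d k\<bar> = real q ^ (((d - k) choose 2) + (k choose 2))"
    by (simp add: disjointness_eigenvalue_def abs_mult power_abs)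
  then have "real q ^ (((d - k) choose 2) + (k choose 2)) = real q ^ ((d - 1) choose 2)" using eq by simp
  then have e: "((d - k) choose 2) + (k choose 2) = (d - 1) choose 2"
    using q by (simp add: power_inject_exp)
  have c: "2 * int (n choose 2) = int n * (int n - 1)" for n
    by (induction n) (auto simp: numeral_2_eq_2 algebra_simps)
  define a where "a = int k"
  define b where "b = int d"
  have "2 * int ((d - k) choose 2) + 2 * int (k choose 2) = 2 * int ((d - 1) choose 2)"
    using arg_cong[OF e, of "\<lambda>n. 2 * int n"] by simp
  then have "(b - a) * (b - a - 1) + a * (a - 1) = (b - 1) * (b - 2)"
    unfolding c using assms(4) d(1) by (simp add: a_def b_def of_nat_diff)
  then have "(a - 1) * (a - (b - 1)) = 0" by algebra
  then have "a = 1 \<or> a = b - 1" by auto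
  then show ?thesis using d(1) by (auto simp: a_def b_def)
qed

section \<open>The eigenspaces of the dual polar scheme\<close>

lemma transpose_dual_polar_matrix: "transpose dual_polar_matrix = (dual_polar_matrix :: ('a::{field,finite}, 'm::finite) rmat)"
  unfolding dual_polar_matrix_def by (rule transpose_rel_matrix) (simp add: Int_commute)

lemma transpose_disjointness_matrix: "transpose (disjointness_matrix G) = disjointness_matrix G"
  unfolding disjointness_matrix_def by (rule transpose_rel_matrix) (simp add: Int_commute)

lemmas flag_props = subspace_flag flag_0 flag_Suc_mono

lemma dual_polar_matrix_layer:
  fixes v :: "('a::{field,finite}, 'm::finite) rvec"
  assumes "k < Suc CARD('m)" "v \<in> layer flag k"
  shows "dual_polar_matrix *v v = dual_polar_eigenvalue CARD('a) CARD('m) k *\<^sub>R v"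
proof (rule layer_eigen[OF flag_props, where n = "Suc CARD('m)"])
  show "inner (dual_polar_matrix *v u) v = inner u (dual_polar_matrix *v v)" for u v :: "('a, 'm) rvec"
    by (rule inner_symmetric_matrix[OF transpose_dual_polar_matrix])
  show "dual_polar_matrix *v v - dual_polar_eigenvalue CARD('a) CARD('m) k *\<^sub>R v \<in> flag k"
    if "k < Suc CARD('m)" "v \<in> flag (Suc k)" for k and v :: "('a, 'm) rvec"
    using flag_Suc_minus[OF matrix_vector_mul_linear dual_polar_matrix_star_flag that(2)] that(1) by simp
qed (use assms in auto)

lemma disjointness_matrix_layer:
  fixes v :: "('a::{field,finite}, 'm::finite) rvec"
  assumes "k < Suc CARD('m)" "v \<in> layer flag k"
  shows "disjointness_matrix generators *v v = disjointness_eigenvalue CARD('a) CARD('m) k *\<^sub>R v"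
proof (rule layer_eigen[OF flag_props, where n = "Suc CARD('m)"])
  show "inner (disjointness_matrix generators *v u) v = inner u (disjointness_matrix generators *v v)"
    for u v :: "('a, 'm) rvec"
    by (rule inner_symmetric_matrix[OF transpose_disjointness_matrix])
  show "disjointness_matrix generators *v v - disjointness_eigenvalue CARD('a) CARD('m) k *\<^sub>R v \<in> flag k"
    if "k < Suc CARD('m)" "v \<in> flag (Suc k)" for k and v :: "('a, 'm) rvec"
    using flag_Suc_minus[OF matrix_vector_mul_linear disjointness_matrix_star_flag that(2)] that(1) by simp
qed (use assms in auto)

lemma layer_flag_eq_eigenspace:
  assumes "k \<le> CARD('m)"
  shows "layer flag k = eigenspace (generators :: ('a::{field,finite}, 'm::finite) space set set)
    dual_polar_matrix (dual_polar_eigenvalue CARD('a) CARD('m) k)"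
  unfolding eigenspace_def flag_top[symmetric]
  using assms two_le_card_field[where 'a = 'a]
  by (intro eigenspace_eq_layer[OF flag_props, symmetric] matrix_vector_mul_linear dual_polar_matrix_layer
      dual_polar_eigenvalue_inj) auto

section \<open>Nonvanishing of the layers and uniqueness of the decomposition\<close>

lemma dim_Int_neighbour_le:
  fixes \<sigma> \<tau> \<pi> :: "('a::{field,finite}, 'm::finite) space set"
  assumes \<sigma>: "\<sigma> \<in> generators" and \<tau>: "\<tau> \<in> generators" and \<pi>: "\<pi> \<in> generators"
    and d: "vec.dim (\<sigma> \<inter> \<tau>) + 1 = CARD('m)"
  shows "vec.dim (\<tau> \<inter> \<pi>) \<le> vec.dim (\<sigma> \<inter> \<pi>) + 1"
proof -
  have "vec.dim (\<tau> \<inter> \<pi>) \<le> vec.dim (\<sigma> \<inter> \<tau> \<inter> \<pi>) + 1"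
    using d generatorsD(3)[OF \<tau>]
    by (intro dim_le_Int_hyperplane vec.subspace_inter generatorsD(2)[OF \<sigma>] generatorsD(2)[OF \<tau>]
        generatorsD(2)[OF \<pi>]) auto
  also have "vec.dim (\<sigma> \<inter> \<tau> \<inter> \<pi>) \<le> vec.dim (\<sigma> \<inter> \<pi>)" by (intro vec.dim_subset) auto
  finally show ?thesis by simp
qed

text \<open>If the \<open>j\<close>-th layer were zero, then \<open>\<Prod>\<^sub>i (A - \<theta>\<^sub>i)\<close> over \<open>i \<noteq> j\<close> would vanish; as the diameter is \<open>d\<close>, its entry
  at a pair of opposite generators is that of \<open>A\<^sup>d\<close>, which is positive.\<close>

lemma layer_flag_nonzero:
  assumes j: "j \<le> CARD('m)"
  shows "layer flag j \<noteq> ({0} :: ('a::{field,finite}, 'm::finite) rvec set)"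
proof
  assume z: "layer flag j = ({0} :: ('a, 'm) rvec set)"
  let ?d = "CARD('m)" and ?A = "dual_polar_matrix :: ('a, 'm) rmat"
  let ?\<theta> = "dual_polar_eigenvalue CARD('a) CARD('m)"
  obtain \<pi> :: "('a, 'm) space set" where \<pi>: "\<pi> \<in> generators" using left_generator by blast
  define e where "e = char_vec {\<pi>}"
  have "e \<in> flag (Suc ?d)" unfolding flag_top e_def using \<pi> by (intro char_vec_supported) auto
  then obtain c where c: "\<forall>k<Suc ?d. c k \<in> layer flag k" "e = (\<Sum>k<Suc ?d. c k)"
    by (rule layer_decomposition[OF flag_props])
  define w where "w n = ((\<lambda>v. ?A *v v) ^^ n) e" for n
  have w0: "w 0 = e" and wS: "w (Suc n) = ?A *v w n" for n by (simp_all add: w_def)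
  have wc: "w n = (\<Sum>k<Suc ?d. ?\<theta> k ^ n *\<^sub>R c k)" for n
  proof (induction n)
    case 0
    then show ?case by (simp add: w0 c(2))
  next
    case (Suc n)
    have "w (Suc n) = (\<Sum>k<Suc ?d. ?\<theta> k ^ n *\<^sub>R (?A *v c k))"
      unfolding wS Suc by (simp add: linear_sum[OF matrix_vector_mul_linear]
          linear_scale[OF matrix_vector_mul_linear] del: sum.lessThan_Suc)
    also have "\<dots> = (\<Sum>k<Suc ?d. ?\<theta> k ^ Suc n *\<^sub>R c k)"
    proof (rule sum.cong[OF refl])
      fix k assume "k \<in> {..<Suc ?d}"
      then have "?A *v c k = ?\<theta> k *\<^sub>R c k" using c(1) by (intro dual_polar_matrix_layer) auto
      then show "?\<theta> k ^ n *\<^sub>R (?A *v c k) = ?\<theta> k ^ Suc n *\<^sub>R c k" by (simp add: mult.commute)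
    qed
    finally show ?case .
  qed
  \<comment> \<open>\<open>w n\<close> is A^n applied to the unit vector of \<pi>, and \<sigma> has
    distance d - dim (\<sigma> \<inter> \<pi>) from \<pi>. A walk of n steps reaches no larger
    distance than n, and distance n with positive weight.\<close>
  have supp: "\<forall>\<sigma>\<in>generators. (vec.dim (\<sigma> \<inter> \<pi>) + n < ?d \<longrightarrow> w n $ \<sigma> = 0) \<and>
      (vec.dim (\<sigma> \<inter> \<pi>) + n = ?d \<longrightarrow> 0 < w n $ \<sigma>)" for n
  proof (induction n)
    case 0
    have "\<sigma> = \<pi>" if \<sigma>: "\<sigma> \<in> generators" "vec.dim (\<sigma> \<inter> \<pi>) = ?d" for \<sigma>
    proof (rule ccontr)
      assume "\<sigma> \<noteq> \<pi>"
      then obtain \<tau> where "vec.dim (\<tau> \<inter> \<pi>) = ?d + 1"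
        using ex_closer_neighbour[OF \<sigma>(1) \<pi>] \<sigma>(2) by metis
      then show False using vec.dim_subset[of "\<tau> \<inter> \<pi>" \<pi>] generatorsD(3)[OF \<pi>] by simp
    qed
    then show ?case using generatorsD(3)[OF \<pi>] by (auto simp: w0 e_def char_vec_def)
  next
    case (Suc n)
    let ?N = "\<lambda>\<sigma>. {\<tau>. \<tau> \<in> generators \<and> vec.dim (\<sigma> \<inter> \<tau>) = ?d - 1}"
    have Aw: "w (Suc n) $ \<sigma> = (\<Sum>\<tau>\<in>?N \<sigma>. w n $ \<tau>)" if "\<sigma> \<in> generators" for \<sigma>
      using that by (simp add: wS dual_polar_matrix_def rel_matrix_mult_component)
    have le: "vec.dim (\<tau> \<inter> \<pi>) + n < Suc ?d \<and> 0 \<le> w n $ \<tau>"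
      if "\<sigma> \<in> generators" "vec.dim (\<sigma> \<inter> \<pi>) + Suc n \<le> ?d" "\<tau> \<in> ?N \<sigma>" for \<sigma> \<tau>
    proof -
      have "vec.dim (\<tau> \<inter> \<pi>) + n \<le> ?d"
        using dim_Int_neighbour_le[OF that(1) _ \<pi>, of \<tau>] that dual_polar_rel[of \<sigma> \<tau>] by auto
      then consider "vec.dim (\<tau> \<inter> \<pi>) + n < ?d" | "vec.dim (\<tau> \<inter> \<pi>) + n = ?d" by linarith
      then show ?thesis using Suc that(3) by cases (auto intro: less_imp_le)
    qed
    show ?case
    proof (intro ballI conjI impI)
      fix \<sigma> :: "('a, 'm) space set"
      assume \<sigma>: "\<sigma> \<in> generators" and lt: "vec.dim (\<sigma> \<inter> \<pi>) + Suc n < ?d"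
      have "w n $ \<tau> = 0" if "\<tau> \<in> ?N \<sigma>" for \<tau>
        using dim_Int_neighbour_le[OF \<sigma> _ \<pi>, of \<tau>] that Suc lt dual_polar_rel[of \<sigma> \<tau>] by auto
      then show "w (Suc n) $ \<sigma> = 0" using Aw[OF \<sigma>] by simp
    next
      fix \<sigma> :: "('a, 'm) space set"
      assume \<sigma>: "\<sigma> \<in> generators" and eq: "vec.dim (\<sigma> \<inter> \<pi>) + Suc n = ?d"
      have "\<sigma> \<noteq> \<pi>" using eq generatorsD(3)[OF \<pi>] by auto
      then obtain \<tau> where \<tau>: "\<tau> \<in> generators" "vec.dim (\<sigma> \<inter> \<tau>) + 1 = ?d"
        "vec.dim (\<tau> \<inter> \<pi>) = vec.dim (\<sigma> \<inter> \<pi>) + 1"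
        by (rule ex_closer_neighbour[OF \<sigma> \<pi>])
      then have "0 < w n $ \<tau>" using Suc eq by auto
      then show "0 < w (Suc n) $ \<sigma>"
        unfolding Aw[OF \<sigma>] using \<tau> le[OF \<sigma>] eq dual_polar_rel[of \<sigma> \<tau>] by (intro sum_pos2[of _ \<tau>]) auto
    qed
  qed
  \<comment> \<open>Monic of degree d, with all eigenvalues except the j-th as roots. It kills every
    component of e, the j-th being zero by assumption.\<close>
  define p where "p = (\<Prod>k\<in>{..<Suc ?d} - {j}. [:- ?\<theta> k, 1:])"
  have deg: "degree p = ?d"
    unfolding p_def using j by (subst degree_prod_eq_sum_degree) auto
  have lc: "coeff p ?d = 1"
    unfolding deg[symmetric] unfolding p_def lead_coeff_prod by (rule prod.neutral) simp
  have "poly p (?\<theta> k) *\<^sub>R c k = 0" if "k < Suc ?d" for k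
  proof (cases "k = j")
    case True
    then show ?thesis using c(1) that z by auto
  next
    case False
    then have "poly p (?\<theta> k) = 0" unfolding p_def poly_prod using that by (intro prod_zero bexI[of _ k]) auto
    then show ?thesis by simp
  qed
  then have "0 = (\<Sum>k<Suc ?d. poly p (?\<theta> k) *\<^sub>R c k)" by (intro sum.neutral[symmetric]) auto
  also have "\<dots> = (\<Sum>k<Suc ?d. \<Sum>i\<le>?d. (coeff p i * ?\<theta> k ^ i) *\<^sub>R c k)"
    by (simp add: poly_altdef deg scaleR_left.sum del: sum.lessThan_Suc)
  also have "\<dots> = (\<Sum>i\<le>?d. coeff p i *\<^sub>R w i)"
    unfolding wc by (subst sum.swap) (simp add: scaleR_right.sum del: sum.lessThan_Suc)
  finally have 0: "(\<Sum>i\<le>?d. coeff p i *\<^sub>R w i) = 0" by simp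
  obtain \<sigma> where \<sigma>: "\<sigma> \<in> generators" "\<sigma> \<inter> \<pi> = {0}" using ex_opposite_generator[OF \<pi>] .
  have "0 = (\<Sum>i\<le>?d. coeff p i * w i $ \<sigma>)" using arg_cong[OF 0, of "\<lambda>v. v $ \<sigma>"] by simp
  also have "\<dots> = (\<Sum>i\<le>?d. if i = ?d then w ?d $ \<sigma> else 0)"
    using supp \<sigma> lc by (intro sum.cong) (auto simp: le_less)
  also have "\<dots> > 0" using supp[of ?d] \<sigma> by simp
  finally show False by simp
qed

lemma flag_Suc_0: "flag (Suc 0) = span {char_vec (generators :: ('a::{field,finite}, 'm::finite) space set set)}"
proof -
  have "U = {0}" if "vec.subspace U" "vec.dim U = 0" for U :: "('a, 'm) space set"
    using that vec.subspace_0[OF that(1)] by auto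
  then have "singular_subspaces_dim 0 = {{0 :: ('a, 'm) space}}"
    by (auto simp: singular_subspaces_dim_def singular_subspaces_def hyperbolic_form_def)
  moreover have "{\<sigma> \<in> generators. {0} \<subseteq> \<sigma>} = (generators :: ('a, 'm) space set set)"
    using vec.subspace_0[OF generatorsD(2)] by auto
  ultimately show ?thesis by (simp add: flag_def star_def lessThan_Suc)
qed

lemma is_dual_polar_decomposition_layer:
  "is_dual_polar_decomposition (layer flag :: nat \<Rightarrow> ('a::{field,finite}, 'm::finite) rvec set)"
  unfolding is_dual_polar_decomposition_def
proof (intro conjI allI impI ballI)
  fix j assume "j \<le> CARD('m)"
  then show "\<exists>\<theta>. layer flag j = eigenspace (generators :: ('a, 'm) space set set) dual_polar_matrix \<theta> \<and> layer flag j \<noteq> ({0} :: ('a, 'm) rvec set)"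
    using layer_flag_eq_eigenspace layer_flag_nonzero by blast
next
  fix i j and u v :: "('a, 'm) rvec" assume "i \<noteq> j" "u \<in> layer flag i" "v \<in> layer flag j"
  then show "orthogonal u v" unfolding orthogonal_def by (rule layer_orthogonal[OF flag_props])
next
  show "span (\<Union>j\<le>CARD('m). layer flag j) = supported (generators :: ('a, 'm) space set set)"
    unfolding flag_top[symmetric] lessThan_Suc_atMost[symmetric] by (rule span_layers[OF flag_props])
next
  show "layer flag 0 = span {char_vec (generators :: ('a, 'm) space set set)}"
    by (simp add: layer_def flag_0 flag_Suc_0)
next
  fix k assume "k \<in> {1..CARD('m)}"
  then show "im_transpose (incidence_matrix k :: ('a, 'm) rmat) = span (\<Union>j\<le>k. layer flag j)"
    unfolding lessThan_Suc_atMost[symmetric] span_layers[OF flag_props]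
    by (intro im_incidence_matrix) simp
qed

text \<open>The members of the flag are the partial sums of the V j, so orthogonality identifies V k
  with the orthogonal difference of two consecutive members.\<close>

lemma is_dual_polar_decomposition_unique:
  fixes V :: "nat \<Rightarrow> ('a::{field,finite}, 'm::finite) rvec set"
  assumes V: "is_dual_polar_decomposition V" and k: "k \<le> CARD('m)"
  shows "V k = layer flag k"
proof -
  note V' = V[unfolded is_dual_polar_decomposition_def]
  have flagV: "flag (Suc i) = span (\<Union>j\<le>i. V j)" if "i \<le> CARD('m)" for i
  proof (cases "i = 0")
    case True
    have "V 0 = span {char_vec generators}" using V' by blast
    then show ?thesis using True by (simp add: flag_Suc_0 span_span)
  next
    case False
    then have "im_transpose (incidence_matrix i :: ('a, 'm) rmat) = span (\<Union>j\<le>i. V j)"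
      using V' that by auto
    then show ?thesis using im_incidence_matrix[OF that, where 'a = 'a] by simp
  qed
  have subV: "subspace (V k)"
  proof -
    obtain \<theta> where "V k = eigenspace generators dual_polar_matrix \<theta>" using V' k by blast
    moreover have "subspace (eigenspace (generators :: ('a, 'm) space set set) dual_polar_matrix \<theta>)"
      by (rule subspaceI)
        (auto simp: eigenspace_def matrix_vector_right_distrib scaleR_right_distrib
          linear_scale[OF matrix_vector_mul_linear] subspace_0 subspace_add subspace_scale subspace_supported)
    ultimately show ?thesis by simp
  qed
  show ?thesis
  proof (cases k)
    case 0
    then have "V k = flag (Suc 0)" using V' by (simp add: flag_Suc_0)
    then show ?thesis using 0 by (simp add: layer_def flag_0)
  next
    case (Suc i)
    have F: "flag k = span (\<Union>j\<le>i. V j)" "flag (Suc k) = span (\<Union>j\<le>k. V j)"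
      using flagV[of i] flagV[of k] k Suc by auto
    have orth: "inner y v = 0" if "y \<in> flag k" "v \<in> V k" for y v
    proof -
      have "orthogonal v y"
      proof (rule orthogonal_to_span)
        show "y \<in> span (\<Union>j\<le>i. V j)" using that F by simp
        fix x assume "x \<in> (\<Union>j\<le>i. V j)"
        then obtain j where "j \<le> i" "x \<in> V j" by blast
        moreover have "k \<noteq> j" "j \<le> CARD('m)" using \<open>j \<le> i\<close> Suc k by auto
        ultimately show "orthogonal v x" using V' that(2) k by blast
      qed
      then show ?thesis by (simp add: orthogonal_def inner_commute)
    qed
    show ?thesis
    proof
      have "V k \<subseteq> flag (Suc k)" unfolding F by (auto intro: span_base)
      then show "V k \<subseteq> layer flag k"
        using orth by (auto simp: layer_def orthogonal_comp_def orthogonal_def)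
      show "layer flag k \<subseteq> V k"
      proof
        fix v :: "('a, 'm) rvec" assume v: "v \<in> layer flag k"
        then have v1: "v \<in> flag (Suc k)" and v2: "\<And>y. y \<in> flag k \<Longrightarrow> inner y v = 0"
          by (auto simp: layer_def orthogonal_comp_def orthogonal_def)
        have "(\<Union>j\<le>k. V j) = (\<Union>j\<le>i. V j) \<union> V k" using Suc by (auto simp: le_Suc_eq)
        then obtain a b where ab: "a \<in> flag k" "b \<in> V k" "v = a + b"
          using v1 subV unfolding F by (auto simp: span_Un span_eq_iff[THEN iffD2])
        have "inner a a = 0" using v2[OF ab(1)] orth[OF ab(1,2)] ab(3) by (simp add: inner_add_right)
        then show "v \<in> V k" using ab by simp
      qed
    qed
  qed
qed

text \<open>Existence makes the choice operator meaningful, and uniqueness makes its value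
  concrete.\<close>

lemma dual_polar_V_eq_layer:
  assumes "k \<le> CARD('m)"
  shows "dual_polar_V k = (layer flag k :: ('a::{field,finite}, 'm::finite) rvec set)"
proof -
  have "is_dual_polar_decomposition (dual_polar_V :: nat \<Rightarrow> ('a, 'm) rvec set)"
    unfolding dual_polar_V_def by (rule someI[where P = is_dual_polar_decomposition, OF is_dual_polar_decomposition_layer])
  then show ?thesis using assms by (rule is_dual_polar_decomposition_unique)
qed

section \<open>Restriction to one class of generators\<close>

definition restrict_vec :: "'i::finite set \<Rightarrow> real ^ 'i \<Rightarrow> real ^ 'i" where
  "restrict_vec X v = (\<chi> i. if i \<in> X then v $ i else 0)"

text \<open>For X a class of generators this is the sign change of the bipartition; restriction to X
  is the mean of it and the identity.\<close>

definition flip_vec :: "'i::finite set \<Rightarrow> real ^ 'i \<Rightarrow> real ^ 'i" where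
  "flip_vec X v = (\<chi> i. if i \<in> X then v $ i else - v $ i)"

lemma prod_power_nonzero: "(\<Prod>i\<in>A. real q ^ i + 1) \<noteq> 0" for A :: "nat set"
  by (cases "finite A") (auto simp: add_nonneg_eq_0_iff)

lemma linear_restrict_vec: "linear (restrict_vec X)"
  by (rule linearI) (auto simp: restrict_vec_def vec_eq_iff)

lemma linear_flip_vec: "linear (flip_vec X)"
  by (rule linearI) (auto simp: flip_vec_def vec_eq_iff)

lemma restrict_vec_eq_flip: "restrict_vec X v = (1 / 2) *\<^sub>R (v + flip_vec X v)"
  by (auto simp: restrict_vec_def flip_vec_def vec_eq_iff)

lemma restrict_vec_flip [simp]: "restrict_vec X (flip_vec X v) = restrict_vec X v"
  by (auto simp: restrict_vec_def flip_vec_def vec_eq_iff)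

lemma flip_vec_flip [simp]: "flip_vec X (flip_vec X v) = v"
  by (auto simp: flip_vec_def vec_eq_iff)

lemma restrict_vec_supported: "restrict_vec X v \<in> supported X"
  by (auto simp: restrict_vec_def supported_def)

lemma restrict_vec_id: "v \<in> supported X \<Longrightarrow> restrict_vec X v = v"
  by (auto simp: restrict_vec_def supported_def vec_eq_iff)

lemma flip_vec_supported: "flip_vec X v \<in> supported Y \<longleftrightarrow> v \<in> supported Y"
  by (auto simp: flip_vec_def supported_def)

text \<open>Row space and kernel are orthogonal complements. Vectors are padded with zeros, so
  intersecting with \<open>supported Y\<close> takes the complement inside the real functions on
  Y.\<close>

lemma im_transpose_eq_orthogonal_comp_kernel:
  fixes M :: "real ^ 'j::finite ^ 'i::finite"
  assumes rows: "\<And>i. M $ i \<in> supported Y"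
  shows "im_transpose M = orthogonal_comp (kernel_on Y M) \<inter> supported Y"
proof
  have Mv: "(M *v v) $ i = inner (M $ i) v" for v i
    by (simp add: matrix_vector_mult_def inner_vec_def)
  show "im_transpose M \<subseteq> orthogonal_comp (kernel_on Y M) \<inter> supported Y"
    unfolding im_transpose_eq_span
  proof (rule span_minimal)
    show "range (\<lambda>i. M $ i) \<subseteq> orthogonal_comp (kernel_on Y M) \<inter> supported Y"
    proof (rule image_subsetI)
      fix i
      have "inner v (M $ i) = 0" if "v \<in> kernel_on Y M" for v
        using that Mv[of v i] by (simp add: kernel_on_def inner_commute)
      then show "M $ i \<in> orthogonal_comp (kernel_on Y M) \<inter> supported Y"
        using rows by (simp add: orthogonal_comp_def orthogonal_def)
    qed
  qed (intro subspace_inter subspace_orthogonal_comp subspace_supported)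
  show "orthogonal_comp (kernel_on Y M) \<inter> supported Y \<subseteq> im_transpose M"
  proof
    fix v assume v: "v \<in> orthogonal_comp (kernel_on Y M) \<inter> supported Y"
    let ?R = "range (\<lambda>i. M $ i)"
    obtain y z where yz: "y \<in> span ?R" "\<And>u. u \<in> span ?R \<Longrightarrow> orthogonal z u" "v = y + z"
      using orthogonal_subspace_decomp_exists[of ?R v] by metis
    have "span ?R \<subseteq> supported Y" using rows by (intro span_minimal subspace_supported) auto
    then have "v - y \<in> supported Y" using v yz(1) by (intro subspace_diff[OF subspace_supported]) auto
    then have "z \<in> supported Y" using yz(3) by simp
    moreover have "(M *v z) $ i = 0" for i
    proof -
      have "orthogonal z (M $ i)" by (rule yz(2)) (auto intro: span_base)
      then show ?thesis unfolding Mv by (simp add: orthogonal_def inner_commute)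
    qed
    ultimately have "z \<in> kernel_on Y M" by (simp add: kernel_on_def vec_eq_iff)
    then have "inner z v = 0" using v by (auto simp: orthogonal_comp_def orthogonal_def)
    moreover have "inner z y = 0" using yz(1,2) by (simp add: orthogonal_def)
    ultimately have "z = 0" using yz(3) by (simp add: inner_add_right)
    then show "v \<in> im_transpose M" using yz by (simp add: im_transpose_eq_span)
  qed
qed

section \<open>One class of generators in even rank\<close>

context
  fixes G :: "('a::{field,finite}, 'm::finite) space set set"
  assumes G: "G \<in> generator_classes" and ev: "even CARD('m)"
begin

lemma class_subset: "G \<subseteq> generators"
  using class_subset_generators[OF G] by blast

lemma two_le_rank: "2 \<le> CARD('m)"
proof -
  have "CARD('m) \<noteq> 1" using ev by auto
  then show ?thesis using zero_less_card_finite[where 'a = 'm] by linarith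
qed

lemma dual_polar_matrix_flip:
  "dual_polar_matrix *v flip_vec G v = - flip_vec G (dual_polar_matrix *v v)"
proof -
  have "(dual_polar_matrix *v flip_vec G v) $ \<pi> = (- flip_vec G (dual_polar_matrix *v v)) $ \<pi>" for \<pi>
  proof (cases "\<pi> \<in> generators")
    case False
    then show ?thesis using class_subset by (auto simp: dual_polar_matrix_def flip_vec_def rel_matrix_mult_component)
  next
    case True
    let ?N = "{\<sigma>. \<sigma> \<in> generators \<and> vec.dim (\<pi> \<inter> \<sigma>) = CARD('m) - 1}"
    have N: "\<pi> \<in> G \<longleftrightarrow> \<sigma> \<notin> G" if "\<sigma> \<in> ?N" for \<sigma>
      using class_adjacent[OF G True, of \<sigma>] that dual_polar_rel[of \<pi> \<sigma>] by simp
    have "(\<Sum>\<sigma>\<in>?N. flip_vec G v $ \<sigma>) = (\<Sum>\<sigma>\<in>?N. if \<pi> \<in> G then - v $ \<sigma> else v $ \<sigma>)"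
      using N by (intro sum.cong) (auto simp: flip_vec_def)
    then show ?thesis using True
      by (auto simp: dual_polar_matrix_def rel_matrix_mult_component flip_vec_def sum_negf)
  qed
  then show ?thesis by (simp add: vec_eq_iff)
qed

text \<open>The sign change anticommutes with the dual polar matrix, hence negates eigenvalues, and
  the eigenvalue at d - k is the negative of the one at k.\<close>

lemma flip_layer:
  assumes k: "k \<le> CARD('m)" and v: "v \<in> layer flag k"
  shows "flip_vec G v \<in> layer flag (CARD('m) - k)"
proof -
  have v': "v \<in> supported generators" "dual_polar_matrix *v v = dual_polar_eigenvalue CARD('a) CARD('m) k *\<^sub>R v"
    using v unfolding layer_flag_eq_eigenspace[OF k] by (auto simp: eigenspace_def)
  have "dual_polar_eigenvalue CARD('a) CARD('m) (CARD('m) - k) = - dual_polar_eigenvalue CARD('a) CARD('m) k"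
    using k by (simp add: dual_polar_eigenvalue_def)
  then show ?thesis
    unfolding layer_flag_eq_eigenspace[OF diff_le_self] eigenspace_def
    using v' by (simp add: flip_vec_supported dual_polar_matrix_flip linear_scale[OF linear_flip_vec])
qed

text \<open>A vector of layer d - k and its flip have the same restriction to G, and the flip lies
  in layer k. So the second layer adds nothing to the restriction of the first.\<close>

lemma half_V_eq:
  assumes k: "k \<le> CARD('m)"
  shows "half_V G k = restrict_vec G ` layer flag k"
proof -
  let ?d = "CARD('m)"
  have sL: "subspace (layer flag j :: ('a, 'm) rvec set)" for j by (rule subspace_layer[OF flag_props])
  have V: "dual_polar_V k = (layer flag k :: ('a, 'm) rvec set)"
    "dual_polar_V (?d - k) = (layer flag (?d - k) :: ('a, 'm) rvec set)"
    using k by (simp_all add: dual_polar_V_eq_layer)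
  show ?thesis
    unfolding half_V_def V
  proof (intro equalityI subsetI)
    fix w assume w: "w \<in> span (layer flag k \<union> layer flag (?d - k)) \<inter> supported G"
    then obtain a b where ab: "a \<in> layer flag k" "b \<in> layer flag (?d - k)" "w = a + b"
      unfolding span_Un using sL[of k] sL[of "?d - k"] by (auto simp: span_eq_iff[THEN iffD2])
    have "flip_vec G b \<in> layer flag k" using flip_layer[of "?d - k" b] ab k by simp
    then have "a + flip_vec G b \<in> layer flag k" using ab sL by (intro subspace_add)
    moreover have "w = restrict_vec G w" using w by (simp add: restrict_vec_id)
    then have "w = restrict_vec G (a + flip_vec G b)"
      using ab by (simp add: linear_add[OF linear_restrict_vec])
    ultimately show "w \<in> restrict_vec G ` layer flag k" by blast
  next
    fix w assume "w \<in> restrict_vec G ` layer flag k"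
    then obtain v where v: "v \<in> layer flag k" "w = restrict_vec G v" by blast
    have "v + flip_vec G v \<in> span (layer flag k \<union> layer flag (?d - k))"
      using v(1) flip_layer[OF k v(1)] by (intro span_add span_base) auto
    then have "w \<in> span (layer flag k \<union> layer flag (?d - k))"
      unfolding v(2) restrict_vec_eq_flip by (rule span_scale)
    then show "w \<in> span (layer flag k \<union> layer flag (?d - k)) \<inter> supported G"
      using v(2) restrict_vec_supported by blast
  qed
qed

lemma restrict_star: "restrict_vec G (star U) = char_vec {\<sigma> \<in> G. U \<subseteq> \<sigma>}"
  using class_subset by (auto simp: restrict_vec_def star_def char_vec_def vec_eq_iff)

lemma im_point_matrix: "im_transpose (point_matrix G) = restrict_vec G ` flag 2"
proof -
  have "flag 2 = span (star ` (points :: ('a, 'm) space set set))"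
    using im_incidence_matrix[of 1, where 'a = 'a and 'm = 'm] two_le_rank
    unfolding incidence_matrix_def im_transpose_rel_matrix star_def by (simp add: numeral_2_eq_2)
  then show ?thesis
    unfolding point_matrix_def im_transpose_rel_matrix
    by (simp add: linear_span_image[OF linear_restrict_vec, symmetric] image_image restrict_star)
qed

lemma span_half_V: "span (half_V G 0 \<union> half_V G 1) = im_transpose (point_matrix G)"
proof -
  have "half_V G 0 \<union> half_V G 1 = restrict_vec G ` (\<Union>k<2. layer flag k)"
    using half_V_eq[of 0] half_V_eq[of 1] two_le_rank
    by (simp add: image_Un numeral_2_eq_2 lessThan_Suc Un_commute)
  then show ?thesis
    unfolding im_point_matrix
    by (simp add: linear_span_image[OF linear_restrict_vec] span_layers[OF flag_props])
qed

lemma char_vec_class_in_im: "char_vec G \<in> im_transpose (point_matrix G)"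
proof -
  have "char_vec G = restrict_vec G (char_vec generators)"
    using class_subset by (auto simp: restrict_vec_def char_vec_def vec_eq_iff)
  moreover have "char_vec generators \<in> (flag 2 :: ('a, 'm) rvec set)"
  proof -
    have "char_vec generators \<in> (flag (Suc 0) :: ('a, 'm) rvec set)"
      unfolding flag_Suc_0 by (rule span_base) simp
    then show ?thesis using flag_Suc_mono[of "Suc 0"] unfolding numeral_2_eq_2 by blast
  qed
  ultimately show ?thesis unfolding im_point_matrix by blast
qed

text \<open>For d even a generator disjoint from a member of G is itself in G, so the matrix on all
  generators has no nonzero entries between the two classes.\<close>

lemma disjointness_matrix_class:
  assumes "v \<in> supported G"
  shows "disjointness_matrix generators *v v = disjointness_matrix G *v v"
proof -
  have "(disjointness_matrix generators *v v) $ \<pi> = (disjointness_matrix G *v v) $ \<pi>" for \<pi>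
  proof (cases "\<pi> \<in> generators")
    case False
    then show ?thesis using class_subset by (auto simp: disjointness_matrix_def rel_matrix_mult_component)
  next
    case True
    have "(disjointness_matrix generators *v v) $ \<pi> = (\<Sum>\<sigma> | \<sigma> \<in> generators \<and> \<pi> \<inter> \<sigma> = {0}. v $ \<sigma>)"
      using True by (simp add: disjointness_matrix_def rel_matrix_mult_component)
    also have "\<dots> = (\<Sum>\<sigma> | \<sigma> \<in> G \<and> \<pi> \<inter> \<sigma> = {0}. v $ \<sigma>)"
      using assms class_subset by (intro sum.mono_neutral_right) (auto simp: supported_def)
    also have "\<dots> = (disjointness_matrix G *v v) $ \<pi>"
    proof (cases "\<pi> \<in> G")
      case True
      then show ?thesis by (simp add: disjointness_matrix_def rel_matrix_mult_component)
    next
      case False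
      then have "{\<sigma>. \<sigma> \<in> G \<and> \<pi> \<inter> \<sigma> = {0}} = {}"
        using class_opposite[OF G ev _ True] by auto
      then show ?thesis using False by (simp only: sum.empty) (simp add: disjointness_matrix_def rel_matrix_mult_component)
    qed
    finally show ?thesis .
  qed
  then show ?thesis by (simp add: vec_eq_iff)
qed

lemma eigenvector_in_im:
  assumes "v \<in> eigenspace G (disjointness_matrix G) (- (real CARD('a) ^ ((CARD('m) - 1) choose 2)))"
  shows "v \<in> im_transpose (point_matrix G)"
proof -
  let ?d = "CARD('m)" and ?q = "CARD('a)"
  let ?K = "\<lambda>v :: ('a, 'm) rvec. disjointness_matrix generators *v v"
  let ?\<mu> = "- (real ?q ^ ((?d - 1) choose 2))"
  have v: "v \<in> supported G" "?K v = ?\<mu> *\<^sub>R v"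
    using assms disjointness_matrix_class by (auto simp: eigenspace_def)
  have "v \<in> flag (Suc ?d)" unfolding flag_top using v(1) supported_mono[OF class_subset] by blast
  then obtain c where c: "\<forall>k<Suc ?d. c k \<in> layer flag k" "v = (\<Sum>k<Suc ?d. c k)"
    by (rule layer_decomposition[OF flag_props])
  \<comment> \<open>The indices 1 and d - 1 coincide when d = 2; the span below is then a single
    layer.\<close>
  have c0: "c k = 0" if "k < Suc ?d" "k \<noteq> 1" "k \<noteq> ?d - 1" for k
  proof (rule eigenvector_components[OF flag_props matrix_vector_mul_linear, of "Suc ?d" "disjointness_matrix generators" c "disjointness_eigenvalue ?q ?d" ?\<mu>])
    show "?K (\<Sum>k<Suc ?d. c k) = ?\<mu> *\<^sub>R (\<Sum>k<Suc ?d. c k)" using v(2) c(2) by simp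
    show "disjointness_eigenvalue ?q ?d k \<noteq> ?\<mu>"
      using disjointness_eigenvalue_eq_iff[OF two_le_card_field[where 'a = 'a] two_le_rank ev, of k] that by auto
  qed (use c(1) that disjointness_matrix_layer in auto)
  have "c k \<in> span (layer flag 1 \<union> layer flag (?d - 1))" if "k < Suc ?d" for k
  proof (cases "k = 1 \<or> k = ?d - 1")
    case True
    then show ?thesis using c(1) that by (intro span_base) auto
  next
    case False
    then show ?thesis using c0[OF that] by (simp add: span_zero)
  qed
  then have "v \<in> span (layer flag 1 \<union> layer flag (?d - 1))"
    unfolding c(2) by (intro span_sum) auto
  moreover have "dual_polar_V 1 = (layer flag 1 :: ('a, 'm) rvec set)"
    "dual_polar_V (?d - 1) = (layer flag (?d - 1) :: ('a, 'm) rvec set)"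
    using two_le_rank by (simp_all add: dual_polar_V_eq_layer)
  ultimately have "v \<in> half_V G 1" using v(1) by (simp add: half_V_def)
  then show ?thesis unfolding span_half_V[symmetric] by (intro span_base) simp
qed

text \<open>By orthogonality of the layers \<open>0, 1\<close> and \<open>d\<close>, half of the generators through a point lie in each class.\<close>

lemma card_class_through_point:
  assumes "p \<in> points"
  shows "card {\<sigma> \<in> G. p \<subseteq> \<sigma>} = (\<Prod>i = 1..CARD('m) - 2. CARD('a) ^ i + 1)"
proof -
  note p = singular_subspaces_dimD[OF assms]
  let ?S = "{\<sigma> \<in> generators. p \<subseteq> \<sigma>}"
  have "char_vec generators \<in> (layer flag 0 :: ('a, 'm) rvec set)"
    by (simp add: layer_def flag_0 flag_Suc_0 span_base)
  then have "flip_vec G (char_vec generators) \<in> layer flag (CARD('m))" using flip_layer[of 0] by simp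
  moreover have "star p \<in> flag CARD('m)" using p two_le_rank by (intro star_in_flag) auto
  ultimately have "0 = inner (star p) (flip_vec G (char_vec generators))"
    by (auto simp: layer_def orthogonal_comp_def orthogonal_def)
  also have "\<dots> = (\<Sum>\<sigma>\<in>?S. if \<sigma> \<in> G then 1 else - 1)"
    unfolding star_def inner_char_vec by (intro sum.cong) (auto simp: flip_vec_def char_vec_def)
  also have "\<dots> = real (card (?S \<inter> G)) - real (card (?S \<inter> - G))" by (simp add: sum.If_cases)
  finally have "card (?S \<inter> G) = card (?S \<inter> - G)" by simp
  moreover have "card ?S = card (?S \<inter> G) + card (?S \<inter> - G)"
    by (subst card_Un_disjoint[symmetric]) (auto intro!: arg_cong[of _ _ card])
  moreover have "{\<sigma> \<in> G. p \<subseteq> \<sigma>} = ?S \<inter> G" using class_subset by blast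
  ultimately have "2 * card {\<sigma> \<in> G. p \<subseteq> \<sigma>} = (\<Prod>i<CARD('m) - 1. CARD('a) ^ i + 1)"
    using card_generators_above[OF p(1)] p(2) by simp
  \<comment> \<open>The factor for i = 0 equals 2 and cancels the 2 that comes from the two
    classes.\<close>
  also have "CARD('m) - 1 = Suc (CARD('m) - 2)" using two_le_rank by simp
  also have "(\<Prod>i<Suc (CARD('m) - 2). CARD('a) ^ i + 1) = 2 * (\<Prod>i<CARD('m) - 2. CARD('a) ^ Suc i + 1)"
    unfolding prod.lessThan_Suc_shift by simp
  also have "(\<Prod>i<CARD('m) - 2. CARD('a) ^ Suc i + 1) = (\<Prod>i = 1..CARD('m) - 2. CARD('a) ^ i + 1)"
    by (rule prod.reindex_bij_witness[of _ "\<lambda>i. i - 1" Suc]) auto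
  finally show ?thesis by simp
qed

lemma inner_class_pencil:
  assumes "p \<in> points"
  shows "inner (char_vec G) (char_vec {\<sigma> \<in> G. p \<subseteq> \<sigma>}) = (\<Prod>i = 1..CARD('m) - 2. real CARD('a) ^ i + 1)"
proof -
  have "G \<inter> {\<sigma> \<in> G. p \<subseteq> \<sigma>} = {\<sigma> \<in> G. p \<subseteq> \<sigma>}" by blast
  then show ?thesis
    using card_class_through_point[OF assms] by (simp add: inner_char_vec_char_vec add.commute)
qed

lemma card_class_disjoint_through:
  assumes U: "U \<in> singular_subspaces" and \<pi>: "\<pi> \<in> G" and "U \<inter> \<pi> = {0}"
  shows "card {\<sigma> \<in> G. U \<subseteq> \<sigma> \<and> \<sigma> \<inter> \<pi> = {0}} = CARD('a) ^ ((CARD('m) - vec.dim U) choose 2)"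
proof -
  have "\<sigma> \<in> G" if "\<sigma> \<in> generators" "\<sigma> \<inter> \<pi> = {0}" for \<sigma>
    by (rule class_opposite[OF G ev \<pi> that])
  then have "{\<sigma> \<in> G. U \<subseteq> \<sigma> \<and> \<sigma> \<inter> \<pi> = {0}} = {\<sigma> \<in> generators. U \<subseteq> \<sigma> \<and> \<sigma> \<inter> \<pi> = U \<inter> \<pi>}"
    using class_subset assms(3) by auto
  then show ?thesis using card_generators_above_meeting[OF U class_subset_generators[OF G \<pi>]] by simp
qed

lemma point_Int:
  assumes "p \<in> points" "vec.subspace \<pi>" "\<not> p \<subseteq> \<pi>"
  shows "p \<inter> \<pi> = {0}"
proof -
  note p = singular_subspaces_dimD[OF assms(1)]
  have sI: "vec.subspace (p \<inter> \<pi>)" using p(3) assms(2) by (rule vec.subspace_inter)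
  have "p \<inter> \<pi> \<subset> p" using assms(3) by blast
  then have "vec.dim (p \<inter> \<pi>) < 1" using dim_psubset_subspace[OF sI p(3)] p(2) by simp
  then have "p \<inter> \<pi> \<subseteq> {0}" by simp
  then show ?thesis using vec.subspace_0[OF sI] by blast
qed

text \<open>On the image of the transposed incidence matrix, \<open>K v = q\<^sup>N (c j - v)\<close> where \<open>c\<close> is proportional to the
  sum of the entries of \<open>v\<close>; this holds for the pencil of a point and is preserved by linear combinations.\<close>

lemma disjointness_matrix_im:
  assumes "v \<in> im_transpose (point_matrix G)"
  shows "disjointness_matrix G *v v = (real CARD('a) ^ ((CARD('m) - 1) choose 2)) *\<^sub>R
    ((inner (char_vec G) v / (\<Prod>i = 1..CARD('m) - 2. real CARD('a) ^ i + 1)) *\<^sub>R char_vec G - v)"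
proof -
  let ?r = "\<Prod>i = 1..CARD('m) - 2. real CARD('a) ^ i + 1"
  let ?N = "real CARD('a) ^ ((CARD('m) - 1) choose 2)"
  let ?T = "\<lambda>v. ?N *\<^sub>R ((inner (char_vec G) v / ?r) *\<^sub>R char_vec G - v)"
  have lT: "linear ?T"
    by (rule linearI) (simp_all add: inner_add_right add_divide_distrib scaleR_left_distrib algebra_simps)
  have "v \<in> span ((\<lambda>p. char_vec {\<sigma> \<in> G. p \<subseteq> \<sigma>}) ` points)"
    using assms unfolding point_matrix_def im_transpose_rel_matrix .
  then have "disjointness_matrix G *v v = ?T v"
  proof (rule linear_eq_on[OF matrix_vector_mul_linear lT])
    fix a :: "('a, 'm) rvec" assume "a \<in> (\<lambda>p. char_vec {\<sigma> \<in> G. p \<subseteq> \<sigma>}) ` points"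
    then obtain p where p: "p \<in> points" and a: "a = char_vec {\<sigma> \<in> G. p \<subseteq> \<sigma>}" by blast
    \<comment> \<open>The denominator is the size of a pencil, so on pencils the coefficient of j is
      1.\<close>
    have T: "?T a = ?N *\<^sub>R (char_vec G - a)" using inner_class_pencil[OF p] prod_power_nonzero by (simp add: a)
    have "(disjointness_matrix G *v a) $ \<pi> = (?N *\<^sub>R (char_vec G - a)) $ \<pi>" for \<pi>
    proof (cases "\<pi> \<in> G")
      case False
      then show ?thesis by (simp add: disjointness_matrix_def rel_matrix_mult_component a char_vec_def)
    next
      case True
      note s\<pi> = generatorsD(2)[OF class_subset_generators[OF G True]]
      have "(disjointness_matrix G *v a) $ \<pi> = real (card {\<sigma> \<in> {\<sigma> \<in> G. p \<subseteq> \<sigma>}. \<pi> \<inter> \<sigma> = {0}})"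
        unfolding disjointness_matrix_def a using True by (subst rel_matrix_mult_char_vec) auto
      also have "{\<sigma> \<in> {\<sigma> \<in> G. p \<subseteq> \<sigma>}. \<pi> \<inter> \<sigma> = {0}} = {\<sigma> \<in> G. p \<subseteq> \<sigma> \<and> \<sigma> \<inter> \<pi> = {0}}"
        by (auto simp: Int_commute)
      also have "real (card \<dots>) = (if p \<subseteq> \<pi> then 0 else ?N)"
      proof (cases "p \<subseteq> \<pi>")
        case pp: True
        have "p \<noteq> {0}" using singular_subspaces_dimD(2)[OF p] by auto
        moreover have "0 \<in> p" using singular_subspaces_dimD(3)[OF p] by (simp add: vec.subspace_0)
        ultimately have "{\<sigma> \<in> G. p \<subseteq> \<sigma> \<and> \<sigma> \<inter> \<pi> = {0}} = {}" using pp by blast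
        then show ?thesis using pp by (simp only: card.empty) simp
      next
        case False
        then show ?thesis
          using card_class_disjoint_through[OF singular_subspaces_dimD(1)[OF p] True point_Int[OF p s\<pi> False]]
            singular_subspaces_dimD(2)[OF p] by simp
      qed
      finally show ?thesis using True by (simp add: a char_vec_def)
    qed
    then show "disjointness_matrix G *v a = ?T a" unfolding T by (simp add: vec_eq_iff)
  qed
  then show ?thesis .
qed

lemma card_class_disjoint:
  assumes "\<pi> \<in> G"
  shows "card {\<sigma> \<in> G. \<sigma> \<inter> \<pi> = {0}} = CARD('a) ^ (CARD('m) choose 2)"
proof -
  have z: "{0} \<in> (singular_subspaces :: ('a, 'm) space set set)"
    by (auto simp: singular_subspaces_def hyperbolic_form_def)
  have 0: "0 \<in> \<sigma>" if "\<sigma> \<in> G" for \<sigma>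
    using generatorsD(2)[OF class_subset_generators[OF G that]] by (simp add: vec.subspace_0)
  then have "{\<sigma> \<in> G. \<sigma> \<inter> \<pi> = {0}} = {\<sigma> \<in> G. {0} \<subseteq> \<sigma> \<and> \<sigma> \<inter> \<pi> = {0}}" by blast
  then show ?thesis using card_class_disjoint_through[OF z assms] 0[OF assms] by simp
qed

lemma rank_choose_two: "CARD('m) choose 2 = (CARD('m) - 1) + ((CARD('m) - 1) choose 2)"
proof -
  obtain e where "CARD('m) = Suc e" using two_le_rank by (cases "CARD('m)") auto
  then show ?thesis by (simp add: numeral_2_eq_2)
qed

text \<open>The row sums of K on the class are q^C(d,2) by direct count. The formula for K on the
  image, applied to j, expresses them through |G| and is solved for it.\<close>

lemma card_class:
  "real (card G) = (real CARD('a) ^ (CARD('m) - 1) + 1) * (\<Prod>i = 1..CARD('m) - 2. real CARD('a) ^ i + 1)"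
proof -
  let ?r = "\<Prod>i = 1..CARD('m) - 2. real CARD('a) ^ i + 1"
  let ?N = "real CARD('a) ^ ((CARD('m) - 1) choose 2)"
  obtain \<pi> where \<pi>: "\<pi> \<in> G" using class_nonempty[OF G] ..
  have "(disjointness_matrix G *v char_vec G) $ \<pi> = real (card {\<sigma> \<in> G. \<pi> \<inter> \<sigma> = {0}})"
    unfolding disjointness_matrix_def using \<pi> by (subst rel_matrix_mult_char_vec) auto
  also have "{\<sigma> \<in> G. \<pi> \<inter> \<sigma> = {0}} = {\<sigma> \<in> G. \<sigma> \<inter> \<pi> = {0}}" by (auto simp: Int_commute)
  also have "real (card \<dots>) = real CARD('a) ^ (CARD('m) - 1) * ?N"
    unfolding card_class_disjoint[OF \<pi>] rank_choose_two power_add by simp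
  finally have "real CARD('a) ^ (CARD('m) - 1) * ?N = ?N * (real (card G) / ?r - 1)"
    unfolding disjointness_matrix_im[OF char_vec_class_in_im] using \<pi>
    by (simp add: inner_char_vec_char_vec char_vec_component)
  then have "real CARD('a) ^ (CARD('m) - 1) = real (card G) / ?r - 1" by simp
  moreover have "?r \<noteq> 0" by (rule prod_power_nonzero)
  ultimately show ?thesis by (simp add: field_simps)
qed

end

section \<open>Spreads and automorphisms\<close>

lemma spreadsD:
  assumes "S \<in> spreads"
  shows "\<pi> \<in> S \<Longrightarrow> \<pi> \<in> generators" "p \<in> points \<Longrightarrow> \<exists>!\<pi>. \<pi> \<in> S \<and> p \<subseteq> \<pi>"
  using assms by (auto simp: spreads_def)

lemma ex_point_subset:
  assumes "U \<in> singular_subspaces" "U \<noteq> {0}"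
  obtains p where "p \<in> points" "p \<subseteq> U"
proof -
  have "0 \<in> U" using singular_subspacesD(1)[OF assms(1)] by (simp add: vec.subspace_0)
  then obtain x where x: "x \<in> U" "x \<noteq> 0" using assms(2) by blast
  have "vec.span {x} \<subseteq> U" using x singular_subspacesD(1)[OF assms(1)] by (intro vec.span_minimal) auto
  moreover have "vec.span {x} \<in> points"
    using singular_mono[OF assms(1) calculation] x(2) by (simp add: singular_subspaces_dim_def)
  ultimately show ?thesis using that by blast
qed

lemma spread_disjoint:
  assumes S: "S \<in> spreads" and "\<pi> \<in> S" "\<sigma> \<in> S" "\<sigma> \<noteq> \<pi>"
  shows "\<sigma> \<inter> \<pi> = {0}"
proof (rule ccontr)
  assume ne: "\<sigma> \<inter> \<pi> \<noteq> {0}"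
  have "\<sigma> \<inter> \<pi> \<in> singular_subspaces"
    using spreadsD(1)[OF S assms(2)] spreadsD(1)[OF S assms(3)] by (intro singular_Int generatorsD)
  then obtain p where p: "p \<in> points" "p \<subseteq> \<sigma> \<inter> \<pi>" using ne by (rule ex_point_subset)
  from spreadsD(2)[OF S p(1)] obtain \<tau> where "\<forall>\<rho>. \<rho> \<in> S \<and> p \<subseteq> \<rho> \<longrightarrow> \<rho> = \<tau>" by (rule ex1E)
  then have "\<sigma> = \<tau>" "\<pi> = \<tau>" using p(2) assms(2,3) by simp_all
  then show False using assms(4) by simp
qed

lemma singular_zero: "{0} \<in> singular_subspaces"
  by (auto simp: singular_subspaces_def hyperbolic_form_def)

section \<open>Automorphisms and their action on spreads\<close>

context
  fixes g :: "('a::{field,finite}, 'm::finite) space set \<Rightarrow> ('a, 'm) space set"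
  assumes g: "g \<in> polar_automorphisms"
begin

lemma automorphism_singular: "U \<in> singular_subspaces \<Longrightarrow> g U \<in> singular_subspaces"
  using g Bij_imp_funcset by (fastforce simp: polar_automorphisms_def)

lemma automorphism_inj: "inj_on g singular_subspaces"
  using g by (simp add: polar_automorphisms_def Bij_def bij_betw_def)

lemma automorphism_surj:
  assumes "W \<in> singular_subspaces"
  obtains U where "U \<in> singular_subspaces" "g U = W"
proof -
  have "g ` singular_subspaces = singular_subspaces"
    using g by (simp add: polar_automorphisms_def Bij_def bij_betw_def)
  then have "W \<in> g ` singular_subspaces" using assms by simp
  then obtain U where "W = g U" "U \<in> singular_subspaces" by (rule imageE)
  then show ?thesis by (intro that[of U]) simp_all
qed

lemma automorphism_subset_iff:
  "U \<in> singular_subspaces \<Longrightarrow> W \<in> singular_subspaces \<Longrightarrow> g U \<subseteq> g W \<longleftrightarrow> U \<subseteq> W"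
  using g by (simp add: polar_automorphisms_def)

lemma automorphism_zero: "g {0} = {0}"
proof -
  obtain U where U: "U \<in> singular_subspaces" "g U = {0}" using automorphism_surj[OF singular_zero] .
  have "0 \<in> U" using singular_subspacesD(1)[OF U(1)] by (simp add: vec.subspace_0)
  then have "g {0} \<subseteq> {0}" using automorphism_subset_iff[OF singular_zero U(1)] U(2) by simp
  moreover have "0 \<in> g {0}"
    using singular_subspacesD(1)[OF automorphism_singular[OF singular_zero]] by (simp add: vec.subspace_0)
  ultimately show ?thesis by blast
qed

text \<open>Automorphisms are given through inclusion only, so dimensions must come from the order:
  a generator above g \<pi> has a preimage above \<pi>, which equals \<pi> because d is the largest
  dimension.\<close>

lemma automorphism_generator:
  assumes \<pi>: "\<pi> \<in> generators"
  shows "g \<pi> \<in> generators"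
proof -
  have s: "\<pi> \<in> singular_subspaces" using generatorsD(1)[OF \<pi>] .
  obtain \<sigma> where \<sigma>: "\<sigma> \<in> generators" "g \<pi> \<subseteq> \<sigma>" using singular_in_generator[OF automorphism_singular[OF s]] .
  obtain U where U: "U \<in> singular_subspaces" "g U = \<sigma>" using automorphism_surj[OF generatorsD(1)[OF \<sigma>(1)]] .
  have "\<pi> \<subseteq> U" using automorphism_subset_iff[OF s U(1)] U(2) \<sigma>(2) by simp
  moreover have "vec.dim U \<le> vec.dim \<pi>" using dim_singular_le[OF U(1)] generatorsD(3)[OF \<pi>] by simp
  ultimately have "\<pi> = U" using generatorsD(2)[OF \<pi>] singular_subspacesD(1)[OF U(1)] by (intro subspace_eqI_dim)
  then show ?thesis using U(2) \<sigma>(1) by simp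
qed

text \<open>Points are the minimal nonzero singular subspaces. A point r inside p has a nonzero
  image inside the point g p, hence the same image, so r = p.\<close>

lemma automorphism_point_preimage:
  assumes p: "g p \<in> points" "p \<in> singular_subspaces"
  shows "p \<in> points"
proof -
  have "p \<noteq> {0}"
  proof
    assume "p = {0}"
    then have "g p = {0}" using automorphism_zero by simp
    then show False using singular_subspaces_dimD(2)[OF p(1)] by simp
  qed
  then obtain r where r: "r \<in> points" "r \<subseteq> p" by (rule ex_point_subset[OF p(2)])
  note rs = singular_subspaces_dimD[OF r(1)] and gp = singular_subspaces_dimD[OF p(1)]
  have "g r \<subseteq> g p" using automorphism_subset_iff[OF rs(1) p(2)] r(2) by simp
  have "g r \<noteq> {0}"
  proof
    assume "g r = {0}"
    then have "g r = g {0}" using automorphism_zero by simp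
    then have "r = {0}" by (rule inj_onD[OF automorphism_inj _ rs(1) singular_zero])
    then show False using rs(2) by simp
  qed
  have "1 \<le> vec.dim (g r)"
  proof (rule ccontr)
    assume "\<not> 1 \<le> vec.dim (g r)"
    then have "vec.dim (g r) = 0" by linarith
    then have "g r \<subseteq> {0}" by (simp only: vec.dim_eq_0)
    then show False
      using \<open>g r \<noteq> {0}\<close> vec.subspace_0[OF singular_subspacesD(1)[OF automorphism_singular[OF rs(1)]]] by blast
  qed
  have "g r = g p"
    using \<open>g r \<subseteq> g p\<close> \<open>1 \<le> vec.dim (g r)\<close> gp singular_subspacesD(1)[OF automorphism_singular[OF rs(1)]] by (intro subspace_eqI_dim) auto
  then have "r = p" by (rule inj_onD[OF automorphism_inj _ rs(1) p(2)])
  then show ?thesis using r(1) by simp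
qed

lemma automorphism_spread:
  assumes S: "S \<in> spreads"
  shows "g ` S \<in> spreads"
  unfolding spreads_def
proof (intro CollectI conjI ballI)
  have sing: "\<pi> \<in> singular_subspaces" if "\<pi> \<in> S" for \<pi>
    using spreadsD(1)[OF S that] by (rule generatorsD)
  show "g ` S \<subseteq> generators" using spreadsD(1)[OF S] automorphism_generator by blast
  fix p :: "('a, 'm) space set" assume p: "p \<in> points"
  obtain p' where p': "p' \<in> singular_subspaces" "g p' = p"
    using automorphism_surj[OF singular_subspaces_dimD(1)[OF p]] .
  have "p' \<in> points" using automorphism_point_preimage[OF _ p'(1)] p'(2) p by simp
  from spreadsD(2)[OF S this] obtain \<pi> where \<pi>: "\<pi> \<in> S \<and> p' \<subseteq> \<pi>"
    and uniq: "\<forall>\<rho>. \<rho> \<in> S \<and> p' \<subseteq> \<rho> \<longrightarrow> \<rho> = \<pi>" by (rule ex1E)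
  have iff: "p \<subseteq> g \<rho> \<longleftrightarrow> p' \<subseteq> \<rho>" if "\<rho> \<in> S" for \<rho>
    using automorphism_subset_iff[OF p'(1) sing[OF that]] p'(2) by simp
  show "\<exists>!\<tau>. \<tau> \<in> g ` S \<and> p \<subseteq> \<tau>"
  proof (rule ex1I[of _ "g \<pi>"])
    show "g \<pi> \<in> g ` S \<and> p \<subseteq> g \<pi>" using \<pi> iff by simp
    fix \<tau> assume \<tau>: "\<tau> \<in> g ` S \<and> p \<subseteq> \<tau>"
    then obtain \<rho> where \<rho>: "\<rho> \<in> S" "\<tau> = g \<rho>" by blast
    then have "\<rho> = \<pi>" using uniq[rule_format, of \<rho>] \<tau> iff by simp
    then show "\<tau> = g \<pi>" using \<rho>(2) by simp
  qed
qed

end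

lemma union_of_spread_orbits_closed:
  fixes H :: "(('a::{field,finite}, 'm::finite) space set \<Rightarrow> ('a, 'm) space set) set"
  assumes H: "automorphism_group H" and C: "union_of_spread_orbits H C"
  shows "C \<subseteq> spreads" "\<And>T h. T \<in> C \<Longrightarrow> h \<in> H \<Longrightarrow> h ` T \<in> C"
proof -
  let ?S = "singular_subspaces :: ('a, 'm) space set set"
  let ?B = "BijGroup ?S"
  have Hg: "subgroup H ?B" "H \<subseteq> polar_automorphisms" using H by (auto simp: automorphism_group_def)
  obtain \<O> where O: "\<O> \<subseteq> orbits (?B\<lparr>carrier := H\<rparr>) spreads (\<lambda>g S. g ` S)" "C = \<Union>\<O>"
    using C by (auto simp: union_of_spread_orbits_def)
  have orb: "\<exists>S\<in>spreads. \<exists>g\<in>H. T = g ` S \<and> {h ` S |h. h \<in> H} \<subseteq> C" if T: "T \<in> C" for T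
  proof -
    obtain X where X: "X \<in> \<O>" "T \<in> X" using T O(2) by blast
    have "X \<in> orbits (?B\<lparr>carrier := H\<rparr>) spreads (\<lambda>g S. g ` S)" using X(1) O(1) by blast
    then obtain S where "S \<in> spreads" "X = {h ` S |h. h \<in> H}"
      by (auto simp: orbits_def orbit_def)
    moreover have "X \<subseteq> C" using X(1) O(2) by blast
    moreover obtain g where "g \<in> H" "T = g ` S" using X(2) calculation(2) by blast
    ultimately show ?thesis by blast
  qed
  show "C \<subseteq> spreads"
  proof
    fix T assume "T \<in> C"
    then obtain S g where "S \<in> spreads" "g \<in> H" "T = g ` S" using orb by blast
    then show "T \<in> spreads" using automorphism_spread Hg(2) by blast
  qed
  show "h ` T \<in> C" if T: "T \<in> C" and h: "h \<in> H" for T h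
  proof -
    obtain S g where S: "S \<in> spreads" "g \<in> H" "T = g ` S" "{h ` S |h. h \<in> H} \<subseteq> C"
      using orb[OF T] by blast
    have "h \<otimes>\<^bsub>?B\<^esub> g \<in> H" using subgroup.m_closed[OF Hg(1) h S(2)] .
    moreover have "h \<otimes>\<^bsub>?B\<^esub> g = compose ?S h g"
      using h S(2) Hg(2) by (auto simp: BijGroup_def polar_automorphisms_def)
    \<comment> \<open>The product in \<open>BijGroup\<close> is composition restricted to singular
      subspaces; the elements of a spread are singular, so on S it is plain composition.\<close>
    moreover have "compose ?S h g ` S = h ` T"
      unfolding S(3) image_image
      using spreadsD(1)[OF S(1)] generatorsD(1) by (intro image_cong) (auto simp: compose_def)
    ultimately show ?thesis using S(4) by (metis (mono_tags, lifting) mem_Collect_eq subsetD)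
  qed
qed

section \<open>Isometries\<close>

definition isometry :: "(('a::{field,finite}, 'm::finite) space \<Rightarrow> ('a, 'm) space) \<Rightarrow> bool" where
  "isometry f \<longleftrightarrow> bij f \<and> (\<forall>u v. f (u + v) = f u + f v) \<and> (\<forall>c v. f (c *s v) = c *s f v) \<and>
     (\<forall>v. hyperbolic_form (f v) = hyperbolic_form v)"

lemma isometry_compose: "isometry f \<Longrightarrow> isometry g \<Longrightarrow> isometry (f \<circ> g)"
  by (auto simp: isometry_def intro: bij_comp)

lemma isometry_inv:
  assumes "isometry f"
  shows "isometry (inv_into UNIV f)"
proof -
  have b: "bij f" and f: "\<And>x. f (inv_into UNIV f x) = x" "\<And>x. inv_into UNIV f (f x) = x"
    using assms by (auto simp: isometry_def bij_is_surj surj_f_inv_f bij_is_inj)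
  have add: "f (x + y) = f x + f y" and sc: "f (c *s x) = c *s f x"
    and Q: "hyperbolic_form (f x) = hyperbolic_form x" for x y c
    using assms by (auto simp: isometry_def)
  have "inv_into UNIV f (u + v) = inv_into UNIV f u + inv_into UNIV f v" for u v
    using f(2)[of "inv_into UNIV f u + inv_into UNIV f v"] by (simp add: add f(1))
  moreover have "inv_into UNIV f (c *s v) = c *s inv_into UNIV f v" for c v
    using f(2)[of "c *s inv_into UNIV f v"] by (simp add: sc f(1))
  moreover have "hyperbolic_form (inv_into UNIV f v) = hyperbolic_form v" for v
    using Q[of "inv_into UNIV f v"] by (simp add: f(1))
  ultimately show ?thesis using b by (auto simp: isometry_def bij_imp_bij_inv)
qed

lemma isometry_singular:
  assumes f: "isometry f" and U: "U \<in> singular_subspaces"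
  shows "f ` U \<in> singular_subspaces"
proof -
  have add: "f (u + v) = f u + f v" and sc: "f (c *s v) = c *s f v"
    and Q: "hyperbolic_form (f v) = hyperbolic_form v" for u v c
    using f by (auto simp: isometry_def)
  have "f 0 = 0" using sc[of 0 0] by simp
  have "vec.subspace (f ` U)"
  proof (rule vec.subspaceI)
    note sU = singular_subspacesD(1)[OF U]
    show "0 \<in> f ` U" using vec.subspace_0[OF sU] \<open>f 0 = 0\<close> by (metis imageI)
    fix x y assume "x \<in> f ` U" "y \<in> f ` U"
    then obtain u v where "u \<in> U" "v \<in> U" "x = f u" "y = f v" by blast
    then show "x + y \<in> f ` U" using vec.subspace_add[OF sU] by (auto simp flip: add)
  next
    fix c x assume "x \<in> f ` U"
    then obtain u where "u \<in> U" "x = f u" by blast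
    then show "c *s x \<in> f ` U" using vec.subspace_scale[OF singular_subspacesD(1)[OF U]] by (auto simp flip: sc)
  qed
  then show ?thesis using singular_subspacesD(2)[OF U] Q by (auto simp: singular_subspaces_def)
qed

lemma isometry_automorphism:
  fixes f :: "('a::{field,finite}, 'm::finite) space \<Rightarrow> ('a, 'm) space"
  assumes f: "isometry f"
  shows "(\<lambda>U\<in>singular_subspaces. f ` U) \<in> polar_automorphisms"
proof -
  let ?S = "singular_subspaces :: ('a, 'm) space set set"
  have b: "bij f" using f by (simp add: isometry_def)
  have "bij_betw ((`) f) ?S ?S"
  proof (rule bij_betw_byWitness[where f' = "(`) (inv_into UNIV f)"])
    show "\<forall>U\<in>?S. inv_into UNIV f ` f ` U = U" using b by (simp add: bij_is_inj image_inv_f_f)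
    show "\<forall>U\<in>?S. f ` inv_into UNIV f ` U = U" using b by (simp add: bij_is_surj image_f_inv_f)
    show "(`) f ` ?S \<subseteq> ?S" using isometry_singular[OF f] by blast
    show "(`) (inv_into UNIV f) ` ?S \<subseteq> ?S" using isometry_singular[OF isometry_inv[OF f]] by blast
  qed
  then have "bij_betw (\<lambda>U\<in>?S. f ` U) ?S ?S" by (subst bij_betw_cong[of ?S _ "(`) f"]) auto
  then show ?thesis
    using bij_is_inj[OF b] by (auto simp: polar_automorphisms_def Bij_def inj_image_subset_iff)
qed

lemma polar_sum_right: "polar u (\<Sum>i\<in>A. f i) = (\<Sum>i\<in>A. polar u (f i))"
  by (induction A rule: infinite_finite_induct) (auto simp: polar_add_right)

lemma polar_sum_left: "polar (\<Sum>i\<in>A. f i) u = (\<Sum>i\<in>A. polar (f i) u)"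
  by (simp add: polar_commute[of _ u] polar_sum_right)

text \<open>Opposite generators are dual to each other under the polar form, so they have dual bases, which
  correspond to the standard coordinates.\<close>

lemma ex_isometry_standard:
  fixes \<pi> \<sigma> :: "('a::{field,finite}, 'm::finite) space set"
  assumes \<pi>: "\<pi> \<in> generators" and \<sigma>: "\<sigma> \<in> generators" and disj: "\<sigma> \<inter> \<pi> = {0}"
  obtains f where "isometry f" "f ` left_generator = \<pi>" "f ` right_generator = \<sigma>"
proof -
  note s\<pi> = generatorsD(2)[OF \<pi>] and s\<sigma> = generatorsD(2)[OF \<sigma>]
  obtain B where B: "B \<subseteq> \<pi>" "vec.independent B" "\<pi> \<subseteq> vec.span B" "card B = vec.dim \<pi>"
    using vec.basis_exists[of \<pi>] by metis
  obtain b where b: "bij_betw b (UNIV :: 'm set) B"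
    using B(4) generatorsD(3)[OF \<pi>] by (metis finite finite_same_card_bij)
  have b\<pi>: "b i \<in> \<pi>" for i using b B(1) by (auto simp: bij_betw_def)
  \<comment> \<open>The coordinates, with respect to b, of the functional that s induces on \<pi>.
    On \<sigma> its kernel lies in \<open>perp \<pi> = \<pi>\<close> and is trivial; as \<sigma> has
    as many elements as the target, it is onto. The preimages of the unit vectors form the dual
    basis.\<close>
  define ev where "ev s = (\<chi> i. polar (b i) s)" for s
  have "inj_on ev \<sigma>"
  proof (rule inj_onI)
    fix s t assume st: "s \<in> \<sigma>" "t \<in> \<sigma>" "ev s = ev t"
    have "polar (b i) (s - t) = 0" for i
      using st(3) by (simp add: ev_def vec_eq_iff polar_diff_right)
    then have "s - t \<in> perp B" using b by (auto simp: perp_def bij_betw_def)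
    also have "perp B \<subseteq> perp \<pi>" using perp_antimono[OF B(3)] by simp
    finally have "s - t \<in> \<pi>" using perp_generator[OF \<pi>] by simp
    moreover have "s - t \<in> \<sigma>" using st s\<sigma> by (intro vec.subspace_diff)
    ultimately have "s - t \<in> \<sigma> \<inter> \<pi>" by blast
    then show "s = t" unfolding disj by simp
  qed
  then have "card (ev ` \<sigma>) = CARD('a ^ 'm)"
    using card_subspace[OF s\<sigma>] generatorsD(3)[OF \<sigma>] by (simp add: card_image)
  then have "ev ` \<sigma> = UNIV" by (intro card_subset_eq) auto
  then have "\<exists>c. c \<in> \<sigma> \<and> ev c = axis j 1" for j by (metis UNIV_I imageE)
  then obtain c where c: "\<And>j. c j \<in> \<sigma>" "\<And>j. ev (c j) = axis j 1" by metis
  have bc: "polar (b i) (c j) = (if i = j then 1 else 0)" for i j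
    using c(2)[of j] by (auto simp: ev_def vec_eq_iff axis_def)
  define f1 where "f1 v = (\<Sum>i\<in>UNIV. v $ Inl i *s b i)" for v :: "('a, 'm) space"
  define f2 where "f2 v = (\<Sum>i\<in>UNIV. v $ Inr i *s c i)" for v :: "('a, 'm) space"
  define f where "f v = f1 v + f2 v" for v
  have f1: "f1 v \<in> \<pi>" for v unfolding f1_def using b\<pi> by (intro vec.subspace_sum vec.subspace_scale s\<pi>)
  have f2: "f2 v \<in> \<sigma>" for v unfolding f2_def using c by (intro vec.subspace_sum vec.subspace_scale s\<sigma>)
  have add: "f (u + v) = f u + f v" for u v
    by (simp add: f_def f1_def f2_def vec.scale_left_distrib sum.distrib algebra_simps)
  have sc: "f (k *s v) = k *s f v" for k v
    by (simp add: f_def f1_def f2_def vec.scale_sum_right vec.scale_right_distrib)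
  have Q: "hyperbolic_form (f v) = hyperbolic_form v" for v
  proof -
    have "hyperbolic_form (f v) = polar (f1 v) (f2 v)"
      using singular_subspacesD(2)[OF generatorsD(1)[OF \<pi>] f1] singular_subspacesD(2)[OF generatorsD(1)[OF \<sigma>] f2]
      by (simp add: f_def hyperbolic_form_add)
    also have "\<dots> = (\<Sum>j\<in>UNIV. \<Sum>i\<in>UNIV. v $ Inr j * (v $ Inl i * (if i = j then 1 else 0)))"
      by (simp add: f1_def f2_def polar_sum_left polar_sum_right polar_scale_left polar_scale_right bc sum_distrib_left)
    also have "\<dots> = hyperbolic_form v"
      by (simp add: hyperbolic_form_def if_distrib[of "\<lambda>x. _ * x"] mult.commute cong: if_cong)
    finally show ?thesis .
  qed
  have P: "polar (f u) (f v) = polar u v" for u v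
    using Q[of "u + v"] Q[of u] Q[of v] unfolding add hyperbolic_form_add by simp
  \<comment> \<open>Injectivity comes from the form: f preserves B, and B is nondegenerate.\<close>
  have "inj f"
  proof (rule injI)
    fix u v assume "f u = f v"
    then have "f (u + (-1) *s v) = 0" unfolding add sc by simp
    then have "polar (u + (-1) *s v) w = 0" for w using P[of "u + (-1) *s v" w] by simp
    then have "u + (-1) *s v = 0" by (rule polar_nondegenerate)
    then show "u = v" by simp
  qed
  then have "bij f" by (simp add: bij_def finite_UNIV_inj_surj)
  then have iso: "isometry f" using add sc Q by (simp add: isometry_def)
  \<comment> \<open>f maps generators to generators, so an inclusion is enough for equality.\<close>
  have img: "f ` X = \<tau>" if X: "X \<in> generators" "f ` X \<subseteq> \<tau>" "\<tau> \<in> generators" for X \<tau>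
  proof -
    have "(\<lambda>U\<in>singular_subspaces. f ` U) X \<in> generators"
      by (rule automorphism_generator[OF isometry_automorphism[OF iso] X(1)])
    then have "f ` X \<in> generators" using generatorsD(1)[OF X(1)] by simp
    then show ?thesis using X(3,2) by (rule generator_eqI)
  qed
  have "f ` left_generator \<subseteq> \<pi>"
    using f1 by (auto simp: f_def f2_def left_generator_def)
  moreover have "f ` right_generator \<subseteq> \<sigma>"
    using f2 by (auto simp: f_def f1_def right_generator_def)
  ultimately show ?thesis
    using that[OF iso] img[OF left_generator _ \<pi>] img[OF right_generator _ \<sigma>] by blast
qed

text \<open>Both pairs are images of the standard pair of coordinate generators.\<close>

lemma ex_isometry_opposite:
  fixes \<pi> \<sigma> \<pi>' \<sigma>' :: "('a::{field,finite}, 'm::finite) space set"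
  assumes "\<pi> \<in> generators" "\<sigma> \<in> generators" "\<sigma> \<inter> \<pi> = {0}"
    and "\<pi>' \<in> generators" "\<sigma>' \<in> generators" "\<sigma>' \<inter> \<pi>' = {0}"
  obtains f where "isometry f" "f ` \<pi> = \<pi>'" "f ` \<sigma> = \<sigma>'"
proof -
  obtain f where f: "isometry f" "f ` left_generator = \<pi>" "f ` right_generator = \<sigma>"
    using ex_isometry_standard[OF assms(1-3)] .
  obtain f' where f': "isometry f'" "f' ` left_generator = \<pi>'" "f' ` right_generator = \<sigma>'"
    using ex_isometry_standard[OF assms(4-6)] .
  have "bij f" using f by (simp add: isometry_def)
  then have "inv_into UNIV f ` \<pi> = left_generator" "inv_into UNIV f ` \<sigma> = right_generator"
    unfolding f(2,3)[symmetric] by (simp_all add: bij_is_inj image_inv_f_f)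
  then have "(f' \<circ> inv_into UNIV f) ` \<pi> = \<pi>'" "(f' \<circ> inv_into UNIV f) ` \<sigma> = \<sigma>'"
    using f' unfolding image_comp[symmetric] by simp_all
  then show ?thesis using that isometry_compose[OF f'(1) isometry_inv[OF f(1)]] by blast
qed

section \<open>The full automorphism group and the class of all spreads\<close>

lemma automorphism_group_all: "automorphism_group (polar_automorphisms :: (('a::{field,finite}, 'm::finite) space set \<Rightarrow> _) set)"
proof -
  let ?S = "singular_subspaces :: ('a, 'm) space set set"
  let ?B = "BijGroup ?S"
  have Bij: "f \<in> Bij ?S" if "f \<in> polar_automorphisms" for f
    using that by (simp add: polar_automorphisms_def)
  have "subgroup polar_automorphisms ?B"
  proof (rule group.subgroupI[OF group_BijGroup])
    show "polar_automorphisms \<subseteq> carrier ?B" using Bij by (auto simp: BijGroup_def)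
    have "(\<lambda>U\<in>?S. U) \<in> polar_automorphisms"
      using id_Bij by (auto simp: polar_automorphisms_def)
    then show "polar_automorphisms \<noteq> ({} :: (('a, 'm) space set \<Rightarrow> _) set)" by blast
  next
    fix f assume f: "f \<in> (polar_automorphisms :: (('a, 'm) space set \<Rightarrow> _) set)"
    have fi: "inv_into ?S f U \<in> ?S" "f (inv_into ?S f U) = U" if "U \<in> ?S" for U
    proof -
      have "U \<in> f ` ?S" using Bij[OF f] that by (simp add: Bij_def bij_betw_def)
      then show "f (inv_into ?S f U) = U" by (rule f_inv_into_f)
    qed (rule Bij_inv_into_mem[OF Bij[OF f] that])
    have "(\<lambda>U\<in>?S. inv_into ?S f U) \<in> polar_automorphisms"
      using restrict_inv_into_Bij[OF Bij[OF f]] fi automorphism_subset_iff[OF f fi(1) fi(1)]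
      by (auto simp: polar_automorphisms_def)
    then show "inv\<^bsub>?B\<^esub> f \<in> polar_automorphisms" using inv_BijGroup[OF Bij[OF f]] by simp
  next
    fix f g assume fg: "f \<in> (polar_automorphisms :: (('a, 'm) space set \<Rightarrow> _) set)" "g \<in> (polar_automorphisms :: (('a, 'm) space set \<Rightarrow> _) set)"
    have "compose ?S f g \<in> polar_automorphisms"
      using compose_Bij[OF Bij[OF fg(1)] Bij[OF fg(2)]] automorphism_subset_iff[OF fg(1)]
        automorphism_subset_iff[OF fg(2)] automorphism_singular[OF fg(2)]
      by (simp add: polar_automorphisms_def compose_def)
    then show "f \<otimes>\<^bsub>?B\<^esub> g \<in> polar_automorphisms" using Bij fg by (simp add: BijGroup_def)
  qed
  then show ?thesis by (simp add: automorphism_group_def)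
qed

lemma union_of_spread_orbits_all:
  "union_of_spread_orbits polar_automorphisms (spreads :: ('a::{field,finite}, 'm::finite) space set set set)"
proof -
  let ?S = "singular_subspaces :: ('a, 'm) space set set"
  let ?O = "orbits ((BijGroup ?S)\<lparr>carrier := polar_automorphisms\<rparr>) spreads (\<lambda>g S. g ` S)"
  have id: "(\<lambda>U\<in>?S. U) \<in> polar_automorphisms"
    using id_Bij by (auto simp: polar_automorphisms_def)
  have "spreads = \<Union>?O"
  proof
    show "spreads \<subseteq> \<Union>?O"
    proof
      fix S :: "('a, 'm) space set set" assume S: "S \<in> spreads"
      have "(\<lambda>U\<in>?S. U) ` S = (\<lambda>U. U) ` S"
        using generatorsD(1)[OF spreadsD(1)[OF S]] by (intro image_cong) auto
      then have "S = (\<lambda>U\<in>?S. U) ` S" by simp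
      then have "S \<in> {g ` S |g. g \<in> polar_automorphisms}" using id by blast
      then show "S \<in> \<Union>?O" using S by (auto simp: orbits_def orbit_def)
    qed
    show "\<Union>?O \<subseteq> spreads" using automorphism_spread by (auto simp: orbits_def orbit_def)
  qed
  then show ?thesis unfolding union_of_spread_orbits_def by blast
qed

lemma transitive_on_disjoint_pairs_all:
  fixes G :: "('a::{field,finite}, 'm::finite) space set set"
  assumes "G \<subseteq> generators"
  shows "transitive_on_disjoint_pairs polar_automorphisms G"
  unfolding transitive_on_disjoint_pairs_def
proof (intro ballI impI)
  fix \<pi> \<sigma> \<pi>' \<sigma>' assume m: "\<pi> \<in> G" "\<sigma> \<in> G" "\<pi>' \<in> G" "\<sigma>' \<in> G"
    and d: "\<pi> \<inter> \<sigma> = {0} \<and> \<pi>' \<inter> \<sigma>' = {0}"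
  have g: "\<pi> \<in> generators" "\<sigma> \<in> generators" "\<pi>' \<in> generators" "\<sigma>' \<in> generators"
    using m assms by blast+
  obtain f where f: "isometry f" "f ` \<pi> = \<pi>'" "f ` \<sigma> = \<sigma>'"
    using ex_isometry_opposite[OF g(1,2) _ g(3,4)] d by (metis Int_commute)
  then show "\<exists>g\<in>polar_automorphisms. g \<pi> = \<pi>' \<and> g \<sigma> = \<sigma>'"
    using isometry_automorphism[OF f(1)] generatorsD(1)[OF g(1)] generatorsD(1)[OF g(2)]
    by (intro bexI[of _ "\<lambda>U\<in>singular_subspaces. f ` U"]) auto
qed

text \<open>A generator opposite to one element of the spread contains a point off that element, and
  the spread element through this point is a second one.\<close>

lemma spread_two_elements:
  fixes S :: "('a::{field,finite}, 'm::finite) space set set"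
  assumes S: "S \<in> spreads"
  obtains \<pi> \<sigma> where "\<pi> \<in> S" "\<sigma> \<in> S" "\<sigma> \<inter> \<pi> = {0}"
proof -
  have z: "\<pi> \<noteq> {0}" if "\<pi> \<in> generators" for \<pi> :: "('a, 'm) space set"
    using generatorsD(3)[OF that] by auto
  obtain p :: "('a, 'm) space set" where p: "p \<in> points"
    using ex_point_subset[OF generatorsD(1)[OF left_generator] z[OF left_generator]] .
  obtain \<pi> where \<pi>: "\<pi> \<in> S" using spreadsD(2)[OF S p] by blast
  have \<pi>g: "\<pi> \<in> generators" using spreadsD(1)[OF S \<pi>] .
  obtain \<tau> where \<tau>: "\<tau> \<in> generators" "\<tau> \<inter> \<pi> = {0}" using ex_opposite_generator[OF \<pi>g] .
  obtain r where r: "r \<in> points" "r \<subseteq> \<tau>"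
    using ex_point_subset[OF generatorsD(1)[OF \<tau>(1)] z[OF \<tau>(1)]] .
  obtain \<sigma> where \<sigma>: "\<sigma> \<in> S" "r \<subseteq> \<sigma>" using spreadsD(2)[OF S r(1)] by blast
  have "\<sigma> \<noteq> \<pi>"
  proof
    assume "\<sigma> = \<pi>"
    then have "r \<subseteq> \<tau> \<inter> \<pi>" using \<sigma> r by blast
    then have "r \<subseteq> {0}" unfolding \<tau>(2) .
    then have "vec.dim r = 0" by (simp only: vec.dim_eq_0)
    then show False using singular_subspaces_dimD(2)[OF r(1)] by simp
  qed
  then show ?thesis using that[OF \<pi> \<sigma>(1)] spread_disjoint[OF S \<pi> \<sigma>(1)] by blast
qed

section \<open>Spreads inside one class and double counting\<close>

context
  fixes G :: "('a::{field,finite}, 'm::finite) space set set"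
  assumes G: "G \<in> generator_classes" and ev: "even CARD('m)"
begin

lemma spread_subset_class:
  assumes S: "S \<in> spreads" and "\<pi> \<in> S" "\<pi> \<in> G"
  shows "S \<subseteq> G"
proof
  fix \<sigma> assume \<sigma>: "\<sigma> \<in> S"
  show "\<sigma> \<in> G"
  proof (cases "\<sigma> = \<pi>")
    case False
    then show ?thesis
      using class_opposite[OF G ev assms(3) spreadsD(1)[OF S \<sigma>] spread_disjoint[OF S assms(2) \<sigma>]] by simp
  qed (use assms in simp)
qed

text \<open>Both sides are linear in v and equal 1 on every pencil, since a spread has exactly one
  element through each point; pencils span the image.\<close>

lemma sum_spread:
  assumes S: "S \<in> spreads" "S \<subseteq> G" and v: "v \<in> im_transpose (point_matrix G)"
  shows "(\<Sum>\<sigma>\<in>S. v $ \<sigma>) = inner (char_vec G) v / (\<Prod>i = 1..CARD('m) - 2. real CARD('a) ^ i + 1)"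
proof -
  let ?r = "\<Prod>i = 1..CARD('m) - 2. real CARD('a) ^ i + 1"
  have l1: "linear (\<lambda>v. \<Sum>\<sigma>\<in>S. v $ \<sigma>)" for S :: "('a, 'm) space set set"
    by (rule linearI) (simp_all add: sum.distrib scaleR_right.sum)
  have l2: "linear (\<lambda>v. inner (char_vec G) v / ?r)"
    by (rule linearI) (simp_all add: inner_add_right add_divide_distrib)
  have "v \<in> span ((\<lambda>p. char_vec {\<sigma> \<in> G. p \<subseteq> \<sigma>}) ` points)"
    using v unfolding point_matrix_def im_transpose_rel_matrix .
  then show ?thesis
  proof (rule linear_eq_on[OF l1 l2])
    fix a :: "('a, 'm) rvec" assume "a \<in> (\<lambda>p. char_vec {\<sigma> \<in> G. p \<subseteq> \<sigma>}) ` points"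
    then obtain p where p: "p \<in> points" and a: "a = char_vec {\<sigma> \<in> G. p \<subseteq> \<sigma>}" by blast
    have 1: "inner (char_vec G) a / ?r = 1"
      unfolding a inner_class_pencil[OF G ev p] using prod_power_nonzero by simp
    from spreadsD(2)[OF S(1) p] obtain \<tau> where \<tau>: "\<tau> \<in> S \<and> p \<subseteq> \<tau>"
      and uniq: "\<forall>\<rho>. \<rho> \<in> S \<and> p \<subseteq> \<rho> \<longrightarrow> \<rho> = \<tau>" by (rule ex1E)
    have "(\<Sum>\<sigma>\<in>S. a $ \<sigma>) = (\<Sum>\<sigma>\<in>S. if \<sigma> = \<tau> then 1 else 0)"
    proof (rule sum.cong[OF refl])
      fix \<sigma> assume \<sigma>: "\<sigma> \<in> S"
      then have "p \<subseteq> \<sigma> \<longleftrightarrow> \<sigma> = \<tau>" using \<tau> uniq by metis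
      then show "a $ \<sigma> = (if \<sigma> = \<tau> then 1 else 0)" using \<sigma> S(2) by (auto simp: a char_vec_def)
    qed
    also have "\<dots> = 1" using \<tau> by simp
    finally show "(\<Sum>\<sigma>\<in>S. a $ \<sigma>) = inner (char_vec G) a / ?r" unfolding 1 .
  qed
qed

lemma card_Int_spread:
  assumes S: "S \<in> spreads" "S \<subseteq> G" and L: "char_vec L \<in> im_transpose (point_matrix G)" "L \<subseteq> G"
  shows "real (card (L \<inter> S)) = real (card L) / (\<Prod>i = 1..CARD('m) - 2. real CARD('a) ^ i + 1)"
proof -
  have "G \<inter> L = L" using L(2) by blast
  moreover have "(\<Sum>\<sigma>\<in>S. char_vec L $ \<sigma>) = real (card (L \<inter> S))"
    unfolding inner_char_vec[symmetric] inner_char_vec_char_vec by (simp add: Int_commute)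
  ultimately show ?thesis using sum_spread[OF S L(1)] by (simp add: inner_char_vec_char_vec)
qed

text \<open>The intersection formula applied to the whole class, whose vector j lies in the
  image.\<close>

lemma card_spread:
  assumes S: "S \<in> spreads" "S \<subseteq> G"
  shows "card S = CARD('a) ^ (CARD('m) - 1) + 1"
proof -
  let ?r = "\<Prod>i = 1..CARD('m) - 2. real CARD('a) ^ i + 1"
  have "?r \<noteq> 0" by (rule prod_power_nonzero)
  moreover have "G \<inter> S = S" using S(2) by blast
  ultimately have "real (card S) = real CARD('a) ^ (CARD('m) - 1) + 1"
    using card_Int_spread[OF S char_vec_class_in_im[OF G ev] order_refl] card_class[OF G ev] by simp
  then have "real (card S) = real (CARD('a) ^ (CARD('m) - 1) + 1)" by simp
  then show ?thesis by (simp only: of_nat_eq_iff)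
qed

text \<open>Double counting the pairs \<open>(\<sigma>, T)\<close> of a generator disjoint from \<open>\<pi>\<close> and a spread of the class through \<open>\<pi>\<close>
  and \<open>\<sigma>\<close>; by transitivity the number of spreads through \<open>\<pi>\<close> and \<open>\<sigma>\<close> does not depend on \<open>\<sigma>\<close>.\<close>

lemma card_disjoint_of_spread_class:
  assumes adm: "admissible_spread_class G C" and L: "L \<subseteq> G" and \<pi>: "\<pi> \<in> G"
    and x: "\<And>S. S \<in> C \<Longrightarrow> S \<subseteq> G \<Longrightarrow> real (card (L \<inter> S)) = x"
  shows "real (card {\<sigma> \<in> L. \<sigma> \<inter> \<pi> = {0}}) = (x - char_vec L $ \<pi>) * real CARD('a) ^ ((CARD('m) - 1) choose 2)"
proof -
  let ?q = "CARD('a)" and ?d = "CARD('m)"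
  obtain H where H: "automorphism_group H" "transitive_on_disjoint_pairs H G" "union_of_spread_orbits H C"
    using adm by (auto simp: admissible_spread_class_def)
  obtain S0 where S0: "S0 \<in> C" "S0 \<subseteq> G" using adm by (auto simp: admissible_spread_class_def)
  note C = union_of_spread_orbits_closed[OF H(1,3)]
  have Haut: "H \<subseteq> polar_automorphisms" using H(1) by (simp add: automorphism_group_def)
  have trans: "\<exists>h\<in>H. h \<alpha> = \<alpha>' \<and> h \<beta> = \<beta>'"
    if "\<alpha> \<in> G" "\<beta> \<in> G" "\<beta> \<inter> \<alpha> = {0}" "\<alpha>' \<in> G" "\<beta>' \<in> G" "\<beta>' \<inter> \<alpha>' = {0}" for \<alpha> \<beta> \<alpha>' \<beta>'
    using H(2)[unfolded transitive_on_disjoint_pairs_def, rule_format, OF that(1,2,4,5)] that(3,6)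
    by (simp add: Int_commute)
  let ?X = "{T \<in> C. \<pi> \<in> T}"
  let ?D = "{\<sigma> \<in> G. \<sigma> \<inter> \<pi> = {0}}"
  let ?n = "\<lambda>\<sigma>. card {T \<in> ?X. \<sigma> \<in> T}"
  have XG: "T \<in> spreads" "T \<subseteq> G" "\<pi> \<in> T" if "T \<in> ?X" for T
    using that C(1) spread_subset_class[of T \<pi>] \<pi> by auto
  \<comment> \<open>One inequality suffices, as \<sigma> and \<sigma>' can be exchanged. An element
    of H fixing \<pi> and mapping \<sigma> to \<sigma>' carries the spreads of C through \<pi> and
    \<sigma> injectively to those through \<pi> and \<sigma>'.\<close>
  have le: "?n \<sigma> \<le> ?n \<sigma>'" if s: "\<sigma> \<in> ?D" "\<sigma>' \<in> ?D" for \<sigma> \<sigma>'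
  proof -
    have "\<exists>h\<in>H. h \<pi> = \<pi> \<and> h \<sigma> = \<sigma>'" using s by (intro trans \<pi>) simp_all
    then obtain h where h: "h \<in> H" "h \<pi> = \<pi>" "h \<sigma> = \<sigma>'" by (elim bexE conjE)
    have hp: "h \<in> polar_automorphisms" using h Haut by blast
    have sing: "T \<subseteq> singular_subspaces" if "T \<in> C" for T
      using C(1) that spreadsD(1) generatorsD(1) by blast
    show ?thesis
    proof (rule card_inj_on_le[where f = "(`) h"])
      show "inj_on ((`) h) {T \<in> ?X. \<sigma> \<in> T}"
      proof (rule inj_onI)
        fix T T' assume T: "T \<in> {T \<in> ?X. \<sigma> \<in> T}" "T' \<in> {T \<in> ?X. \<sigma> \<in> T}" "h ` T = h ` T'"
        then have "T \<subseteq> singular_subspaces" "T' \<subseteq> singular_subspaces" using sing by auto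
        then show "T = T'" using inj_on_image_eq_iff[OF automorphism_inj[OF hp]] T(3) by simp
      qed
      show "(`) h ` {T \<in> ?X. \<sigma> \<in> T} \<subseteq> {T \<in> ?X. \<sigma>' \<in> T}"
      proof (rule image_subsetI)
        fix T assume "T \<in> {T \<in> ?X. \<sigma> \<in> T}"
        then have T: "T \<in> C" "\<pi> \<in> T" "\<sigma> \<in> T" by auto
        have "h \<pi> \<in> h ` T" "h \<sigma> \<in> h ` T" using T by blast+
        then show "h ` T \<in> {T \<in> ?X. \<sigma>' \<in> T}" using C(2)[OF T(1) h(1)] h(2,3) by simp
      qed
    qed simp
  qed
  obtain \<sigma>0 where \<sigma>0: "\<sigma>0 \<in> generators" "\<sigma>0 \<inter> \<pi> = {0}"
    using ex_opposite_generator[OF class_subset_generators[OF G \<pi>]] .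
  then have \<sigma>0D: "\<sigma>0 \<in> ?D" using class_opposite[OF G ev \<pi>] by simp
  have n: "?n \<sigma> = ?n \<sigma>0" if "\<sigma> \<in> ?D" for \<sigma>
    using le[OF that \<sigma>0D] le[OF \<sigma>0D that] by simp
  have \<pi>\<pi>: "\<pi> \<inter> \<pi> \<noteq> {0}" using generatorsD(3)[OF class_subset_generators[OF G \<pi>]] by auto
  have DT: "{\<sigma> \<in> Z. \<sigma> \<inter> \<pi> = {0}} \<inter> T = Z \<inter> T - {\<pi>}" if "T \<in> ?X" for T and Z :: "('a, 'm) space set set"
    
  proof -
    have "\<sigma> \<inter> \<pi> = {0} \<longleftrightarrow> \<sigma> \<noteq> \<pi>" if "\<sigma> \<in> T" for \<sigma>
      using spread_disjoint[OF XG(1)[OF \<open>T \<in> ?X\<close>] XG(3)[OF \<open>T \<in> ?X\<close>] that] \<pi>\<pi> by metis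
    then have "\<sigma> \<in> {\<sigma> \<in> Z. \<sigma> \<inter> \<pi> = {0}} \<inter> T \<longleftrightarrow> \<sigma> \<in> Z \<inter> T - {\<pi>}" for \<sigma>
      by (cases "\<sigma> \<in> T") simp_all
    then show ?thesis by (rule Set.set_eqI)
  qed
  \<comment> \<open>Used twice: Z = G, where the sizes are known, relates the number of spreads
    through a disjoint pair to the number through \<pi>; Z = L then gives the claim.\<close>
  have count: "?n \<sigma>0 * card {\<sigma> \<in> Z. \<sigma> \<inter> \<pi> = {0}} = (\<Sum>T\<in>?X. card (Z \<inter> T - {\<pi>}))" if Z: "Z \<subseteq> G" for Z
  proof -
    have "(\<Sum>T\<in>?X. card {\<sigma> \<in> {\<sigma> \<in> Z. \<sigma> \<inter> \<pi> = {0}}. \<sigma> \<in> T}) = ?n \<sigma>0 * card {\<sigma> \<in> Z. \<sigma> \<inter> \<pi> = {0}}"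
      using n Z by (intro sum_multicount) auto
    moreover have "{\<sigma> \<in> {\<sigma> \<in> Z. \<sigma> \<inter> \<pi> = {0}}. \<sigma> \<in> T} = {\<sigma> \<in> Z. \<sigma> \<inter> \<pi> = {0}} \<inter> T" for T by blast
    ultimately show ?thesis using DT by simp
  qed
  have "card (G \<inter> T - {\<pi>}) = ?q ^ (?d - 1)" if "T \<in> ?X" for T
  proof -
    have "G \<inter> T = T" using XG(2)[OF that] by blast
    then show ?thesis using card_spread[OF XG(1,2)[OF that]] XG(3)[OF that] by simp
  qed
  then have "?n \<sigma>0 * ?q ^ (?d choose 2) = card ?X * ?q ^ (?d - 1)"
    using count[of G] card_class_disjoint[OF G ev \<pi>] by simp
  then have "?q ^ (?d - 1) * (?n \<sigma>0 * ?q ^ ((?d - 1) choose 2)) = ?q ^ (?d - 1) * card ?X"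
    unfolding rank_choose_two[OF G ev] power_add by (simp add: mult_ac)
  then have nX: "?n \<sigma>0 * ?q ^ ((?d - 1) choose 2) = card ?X" by simp
  \<comment> \<open>Without a spread of C through \<pi> the double count would be empty. A disjoint
    pair in S0 is moved onto (\<pi>, \<sigma>0) by an element of H.\<close>
  have pos: "card ?X \<noteq> 0"
  proof -
    obtain \<alpha> \<beta> where ab: "\<alpha> \<in> S0" "\<beta> \<in> S0" "\<beta> \<inter> \<alpha> = {0}"
      using spread_two_elements S0(1) C(1) by blast
    have "\<alpha> \<in> G" "\<beta> \<in> G" using ab S0(2) by auto
    then have "\<exists>h\<in>H. h \<alpha> = \<pi> \<and> h \<beta> = \<sigma>0" using ab(3) \<sigma>0D by (intro trans \<pi>) simp_all
    then obtain h where h: "h \<in> H" "h \<alpha> = \<pi>" by (elim bexE conjE)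
    have "h \<alpha> \<in> h ` S0" using ab(1) by blast
    then have "h ` S0 \<in> ?X" using C(2)[OF S0(1) h(1)] h(2) by simp
    then have "?X \<noteq> {}" by blast
    then show ?thesis by simp
  qed
  have "real (card (L \<inter> T - {\<pi>})) = x - char_vec L $ \<pi>" if "T \<in> ?X" for T
  proof -
    have xT: "real (card (L \<inter> T)) = x" using x that XG(2)[OF that] by blast
    show ?thesis
    proof (cases "\<pi> \<in> L")
      case True
      then have "\<pi> \<in> L \<inter> T" using XG(3)[OF that] by blast
      then have "card (L \<inter> T) = Suc (card (L \<inter> T - {\<pi>}))" by (metis card.remove finite)
      then show ?thesis using xT True by (simp add: char_vec_def)
    next
      case False
      then have "L \<inter> T - {\<pi>} = L \<inter> T" by blast
      then show ?thesis using xT False by (simp add: char_vec_def)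
    qed
  qed
  then have "real (?n \<sigma>0 * card {\<sigma> \<in> L. \<sigma> \<inter> \<pi> = {0}}) = real (card ?X) * (x - char_vec L $ \<pi>)"
    unfolding count[OF L] by (simp add: of_nat_sum)
  then have "real (?n \<sigma>0) * real (card {\<sigma> \<in> L. \<sigma> \<inter> \<pi> = {0}})
      = real (?n \<sigma>0) * ((x - char_vec L $ \<pi>) * real ?q ^ ((?d - 1) choose 2))"
    unfolding nX[symmetric] by (simp add: mult_ac)
  moreover have "real (?n \<sigma>0) \<noteq> 0"
  proof
    assume "real (?n \<sigma>0) = 0"
    then have "?n \<sigma>0 = 0" by (simp only: of_nat_eq_0_iff)
    then show False using nX pos by (simp only: mult_0)
  qed
  ultimately show ?thesis by (simp only: mult_cancel_left) blast
qed

text \<open>The given spread may lie in the other class. An isometry moves one of its elements into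
  G, and in even rank the other elements follow, being disjoint from it.\<close>

lemma spread_in_class:
  assumes S: "(S :: ('a, 'm) space set set) \<in> spreads"
  obtains S' where "S' \<in> spreads" "S' \<subseteq> G"
proof -
  obtain \<alpha> \<beta> where ab: "\<alpha> \<in> S" "\<beta> \<in> S" "\<beta> \<inter> \<alpha> = {0}" using spread_two_elements[OF S] .
  obtain \<pi> where \<pi>: "\<pi> \<in> G" using class_nonempty[OF G] ..
  note \<pi>g = class_subset_generators[OF G \<pi>]
  \<comment> \<open>The opposite generator completes \<pi> to a disjoint pair, so that transitivity
    on such pairs applies.\<close>
  obtain \<sigma> where \<sigma>: "\<sigma> \<in> generators" "\<sigma> \<inter> \<pi> = {0}" using ex_opposite_generator[OF \<pi>g] .
  obtain f where f: "isometry f" "f ` \<alpha> = \<pi>"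
    using ex_isometry_opposite[OF spreadsD(1)[OF S ab(1)] spreadsD(1)[OF S ab(2)] ab(3) \<pi>g \<sigma>] by metis
  let ?g = "\<lambda>U\<in>singular_subspaces. f ` U"
  have "?g ` S \<in> spreads" by (rule automorphism_spread[OF isometry_automorphism[OF f(1)] S])
  moreover have "?g \<alpha> = \<pi>" using f(2) generatorsD(1)[OF spreadsD(1)[OF S ab(1)]] by simp
  then have "\<pi> \<in> ?g ` S" using ab(1) by (metis imageI)
  ultimately show ?thesis using that[of "?g ` S"] spread_subset_class[OF _ _ \<pi>] by blast
qed

text \<open>Makes (vi) the instance of (vii) for the full automorphism group and all spreads; the
  clause on a spread inside G is where the existence of a spread enters.\<close>

lemma admissible_spreads:
  assumes "(spreads :: ('a, 'm) space set set set) \<noteq> {}"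
  shows "admissible_spread_class G spreads"
proof -
  obtain S :: "('a, 'm) space set set" where S: "S \<in> spreads" using assms by blast
  obtain S' where "S' \<in> spreads" "S' \<subseteq> G" using spread_in_class[OF S] .
  then show ?thesis
    unfolding admissible_spread_class_def
    using automorphism_group_all union_of_spread_orbits_all
      transitive_on_disjoint_pairs_all[OF class_subset[OF G ev]] by blast
qed

end

section \<open>Equivalence of the conditions\<close>

theorem theorem3p16:
  fixes G L :: "('a::{field,finite}, 'm::finite) space set set"
    and d q :: nat and x :: real
  assumes "d = CARD('m)" and "q = CARD('a)" and "even d"
    and "G \<in> generator_classes" and "L \<subseteq> G"
    and "x = real (card L) / (\<Prod>i = 1..d - 2. real q ^ i + 1)"
  shows
    "let i = (\<forall>\<pi>\<in>G. real (card {\<sigma> \<in> L. \<sigma> \<inter> \<pi> = {0}})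
                     = (x - char_vec L $ \<pi>) * real q ^ ((d - 1) choose 2));
         ii = (char_vec L - (x / (real q ^ (d - 1) + 1)) *\<^sub>R char_vec G
                 \<in> eigenspace G (disjointness_matrix G) (- (real q ^ ((d - 1) choose 2))));
         iii = (char_vec L \<in> span (half_V G 0 \<union> half_V G 1));
         iv = (char_vec L \<in> im_transpose (point_matrix G));
         v = (char_vec L \<in> orthogonal_comp (kernel_on G (point_matrix G)) \<inter> supported G);
         vi = (\<forall>S\<in>spreads. S \<subseteq> G \<longrightarrow> real (card (L \<inter> S)) = x);
         vii = (\<lambda>C. \<forall>S\<in>C. S \<subseteq> G \<longrightarrow> real (card (L \<inter> S)) = x)
     in (i \<longleftrightarrow> ii) \<and> (i \<longleftrightarrow> iii) \<and> (i \<longleftrightarrow> iv) \<and> (i \<longleftrightarrow> v) \<and>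
        ((spreads :: ('a, 'm) space set set set) \<noteq> {} \<longrightarrow>
           (i \<longleftrightarrow> vi) \<and> (\<forall>C. admissible_spread_class G C \<longrightarrow> (i \<longleftrightarrow> vii C)))"
proof -
  note G = assms(4) and L = assms(5) and x = assms(6)
  have ev: "even CARD('m)" using assms(1,3) by simp
  let ?N = "real q ^ ((d - 1) choose 2)"
  let ?c = "x / (real q ^ (d - 1) + 1)"
  let ?K = "disjointness_matrix G"
  define i where "i \<longleftrightarrow> (\<forall>\<pi>\<in>G. real (card {\<sigma> \<in> L. \<sigma> \<inter> \<pi> = {0}}) = (x - char_vec L $ \<pi>) * ?N)"
  define ii where "ii \<longleftrightarrow> char_vec L - ?c *\<^sub>R char_vec G \<in> eigenspace G ?K (- ?N)"
  define iii where "iii \<longleftrightarrow> char_vec L \<in> span (half_V G 0 \<union> half_V G 1)"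
  define iv where "iv \<longleftrightarrow> char_vec L \<in> im_transpose (point_matrix G)"
  define v where "v \<longleftrightarrow> char_vec L \<in> orthogonal_comp (kernel_on G (point_matrix G)) \<inter> supported G"
  define vii where "vii C \<longleftrightarrow> (\<forall>S\<in>C. S \<subseteq> G \<longrightarrow> real (card (L \<inter> S)) = x)" for C
  have KL: "(?K *v char_vec Z) $ \<pi> = (if \<pi> \<in> G then real (card {\<sigma> \<in> Z. \<sigma> \<inter> \<pi> = {0}}) else 0)"
    if "Z \<subseteq> G" for Z \<pi>
    unfolding disjointness_matrix_def rel_matrix_mult_char_vec[OF that] by (simp add: Int_commute)
  \<comment> \<open>Condition (i) is this matrix equation read row by row; outside G both sides are
    zero.\<close>
  have i_K: "i \<longleftrightarrow> ?K *v char_vec L = ?N *\<^sub>R (x *\<^sub>R char_vec G - char_vec L)"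
  proof -
    have "?K *v char_vec L = ?N *\<^sub>R (x *\<^sub>R char_vec G - char_vec L) \<longleftrightarrow>
        (\<forall>\<pi>\<in>G. (?K *v char_vec L) $ \<pi> = (?N *\<^sub>R (x *\<^sub>R char_vec G - char_vec L)) $ \<pi>)"
      using KL[OF L] L by (auto simp: vec_eq_iff char_vec_component)
    then show ?thesis unfolding i_def using KL[OF L] by (simp add: char_vec_component mult.commute)
  qed
  \<comment> \<open>With N = C(d-1,2), subtracting c j from the characteristic vector shifts the
    equation of (i) by c (q^(d-1) + 1) q^N j. It has to absorb x q^N j, whence c = x/(q^(d-1) +
    1).\<close>
  have KG: "?K *v char_vec G = (real q ^ (d - 1) * ?N) *\<^sub>R char_vec G"
    using KL[OF order_refl] card_class_disjoint[OF G ev, unfolded rank_choose_two[OF G ev] power_add] assms(1,2)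
    by (auto simp: vec_eq_iff char_vec_component)
  have i_ii: "i \<longleftrightarrow> ii"
  proof -
    have "char_vec L - ?c *\<^sub>R char_vec G \<in> supported G"
      using L by (intro subspace_diff subspace_scale subspace_supported char_vec_supported) auto
    then have "ii \<longleftrightarrow> ?K *v char_vec L - ?c *\<^sub>R (?K *v char_vec G) = (- ?N) *\<^sub>R (char_vec L - ?c *\<^sub>R char_vec G)"
      unfolding ii_def eigenspace_def
      by (simp add: linear_diff[OF matrix_vector_mul_linear] linear_scale[OF matrix_vector_mul_linear])
    also have "\<dots> \<longleftrightarrow> ?K *v char_vec L = (?c * (real q ^ (d - 1) + 1) * ?N) *\<^sub>R char_vec G - ?N *\<^sub>R char_vec L"
    proof -
      have "k - c *\<^sub>R ((r * n) *\<^sub>R g) = (- n) *\<^sub>R (l - c *\<^sub>R g) \<longleftrightarrow>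
          k = (c * (r + 1) * n) *\<^sub>R g - n *\<^sub>R l" for c r n :: real and k g l :: "('a, 'm) rvec"
        by (simp add: algebra_simps)
      then show ?thesis unfolding KG .
    qed
    also have "?c * (real q ^ (d - 1) + 1) = x"
    proof -
      have "real q ^ (d - 1) + 1 \<noteq> 0" by (simp add: add_nonneg_eq_0_iff)
      then show ?thesis by simp
    qed
    finally show ?thesis unfolding i_K by (simp add: scaleR_right_diff_distrib mult.commute)
  qed
  have iv_i: "i" if "iv"
    using disjointness_matrix_im[OF G ev that[unfolded iv_def]] L x assms(1,2)
    unfolding i_K by (simp add: inner_char_vec_char_vec inf.absorb2)
  have ii_iv: "iv" if "ii"
  proof -
    have "char_vec L - ?c *\<^sub>R char_vec G \<in> im_transpose (point_matrix G)"
      using that eigenvector_in_im[OF G ev] assms(1,2) unfolding ii_def by blast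
    moreover have "?c *\<^sub>R char_vec G \<in> im_transpose (point_matrix G)"
      using char_vec_class_in_im[OF G ev] unfolding im_transpose_eq_span by (rule span_scale)
    ultimately have "char_vec L - ?c *\<^sub>R char_vec G + ?c *\<^sub>R char_vec G \<in> im_transpose (point_matrix G)"
      unfolding im_transpose_eq_span by (rule span_add)
    then show ?thesis by (simp add: iv_def)
  qed
  have i_iv: "i \<longleftrightarrow> iv" using iv_i ii_iv i_ii by blast
  have iii_iv: "iii \<longleftrightarrow> iv" unfolding iii_def iv_def span_half_V[OF G ev] ..
  have "point_matrix G $ p \<in> supported G" for p
    by (simp add: point_matrix_def rel_matrix_row supported_def char_vec_component)
  then have v_iv: "v \<longleftrightarrow> iv"
    unfolding v_def iv_def using im_transpose_eq_orthogonal_comp_kernel by blast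
  have i_vii: "i \<longleftrightarrow> vii C" if "admissible_spread_class G C" for C
  proof
    assume i
    then have im: "char_vec L \<in> im_transpose (point_matrix G)" using i_iv iv_def by blast
    have "C \<subseteq> spreads"
      using that union_of_spread_orbits_closed(1) unfolding admissible_spread_class_def by blast
    then show "vii C" using card_Int_spread[OF G ev _ _ im L] x assms(1,2) by (auto simp: vii_def)
  next
    assume "vii C"
    then show i
      unfolding i_def assms(1,2) using card_disjoint_of_spread_class[OF G ev that L] by (simp add: vii_def)
  qed
  have "i \<longleftrightarrow> vii spreads" if "(spreads :: ('a, 'm) space set set set) \<noteq> {}"
    using i_vii[OF admissible_spreads[OF G ev that]] .
  then have "(i \<longleftrightarrow> ii) \<and> (i \<longleftrightarrow> iii) \<and> (i \<longleftrightarrow> iv) \<and> (i \<longleftrightarrow> v) \<and>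
        ((spreads :: ('a, 'm) space set set set) \<noteq> {} \<longrightarrow>
           (i \<longleftrightarrow> vii spreads) \<and> (\<forall>C. admissible_spread_class G C \<longrightarrow> (i \<longleftrightarrow> vii C)))"
    using i_ii i_iv iii_iv v_iv i_vii by blast
  then show ?thesis
    unfolding Let_def i_def ii_def iii_def iv_def v_def vii_def .
qed

end
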